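(* Consider the geometric model and suppose that $\overline{\alpha}\,\overline{\beta}<1$. Then the shape function $g$ satisfies $$g(s,t)=\inf_{z\in(\overline{\alpha},\,1/\overline{\beta})}\left\{s\,E\left[\frac{a/z}{1-a/z}\right]+t\,E\left[\frac{bz}{1-bz}\right]\right\}\quad\text{for all } s,t>0.$$
   Context: $\mathbb{N}=\{1,2,\dots\}$, $\mathbb{Z}_+=\{0,1,2,\dots\}$, $\mathbb{R}_+=[0,\infty)$; $\lfloor x\rfloor$ is the integer part; $x\vee y=\max\{x,y\}$. Environment. Let $\mathbf{a}=(a_n)_{n\in\mathbb{N}}$ and $\mathbf{b}=(b_n)_{n\in\mathbb{N}}$ be stationary random sequences in $(0,1)$, and let $\mu$ be the distribution of $(\mathbf{a},\mathbf{b})$. For $k\in\mathbb{Z}_+$ let $\tau_k$ be the shift $(c_n)_{n\in\mathbb{N}}\mapsto(c_{n+k})_{n\in\mathbb{N}}$. It is assumed that $\mu$ is (stationary and) ergodic under the map $\tau_k\times\tau_l:(\mathbf{a},\mathbf{b})\mapsto(\tau_k\mathbf{a},\tau_l\mathbf{b})$ for each $k,l\in\mathbb{N}$. Write $E$ for expectation under $\mu$, $a=a_1$, $b=b_1$, and let $\alpha,\beta$ be the distributions of $a,b$. For a Borel measure $\eta$ on $\mathbb{R}$, $\overline{\eta}$ is the right endpoint of the support of $\eta$. Geometric model. Given $(\mathbf{a},\mathbf{b})$, the weights $W(i,j)$, $i,j\in\mathbb{N}$, are (conditionally) independent and $W(i,j)$ is geometric with parameter $a_ib_j$, i.e. $\mathbf{P}_{\mathbf{a},\mathbf{b}}(W(i,j)\ge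 k)=a_i^kb_j^k$ for $k\in\mathbb{Z}_+$ (values in $\mathbb{Z}_+$). Here $\mathbf{P}_{\mathbf{a},\mathbf{b}}$ is the conditional joint law (a product measure on $\mathbb{R}_+^{\mathbb{N}^2}$), and $\mathbb{P}(\cdot)=\int\mathbf{P}_{\mathbf{a},\mathbf{b}}(\cdot)\,\mu(d\mathbf{a},d\mathbf{b})$ is the joint law of the weights. Last-passage times. $G(i,j)=G(i-1,j)\vee G(i,j-1)+W(i,j)$ for $i,j\in\mathbb{N}$, with $G(i,0)=G(0,j)=0$. Equivalently, $G(m,n)$ is the maximum over all directed paths $\pi$ from $(1,1)$ to $(m,n)$ with steps $(1,0)$ or $(0,1)$ of $\sum_{(i,j)\in\pi}W(i,j)$. Shape function. There is a deterministic function $g:(0,\infty)^2\to[0,\infty]$, called the shape function, such that $\mathbb{P}$-a.s. $\lim_{n\to\infty}G(\lfloor ns\rfloor,\lfloor nt\rfloor)/n=g(s,t)$ for all $s,t>0$. *)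

theory Defs
  imports "HOL-Probability.Probability"
begin

text \<open>
  The index set \<open>{1, 2, ...}\<close> is rendered literally as \<^term>\<open>{1::nat..}\<close>: sequences and arrays are
  extensional functions, that is, elements of product spaces over \<^term>\<open>{1::nat..}\<close> and
  \<^term>\<open>{1::nat..} \<times> {1::nat..}\<close>.
\<close>

definition seq_space :: "(nat \<Rightarrow> real) measure" where
  "seq_space = PiM {1..} (\<lambda>_. restrict_space borel {0<..<1})"

type_synonym env = "(nat \<Rightarrow> real) \<times> (nat \<Rightarrow> real)"

definition env_space :: "env measure" where
  "env_space = seq_space \<Otimes>\<^sub>M seq_space"

definition shift :: "nat \<Rightarrow> (nat \<Rightarrow> real) \<Rightarrow> nat \<Rightarrow> real" where
  "shift k c = (\<lambda>n\<in>{1..}. c (n + k))"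

definition ergodic_map :: "'x measure \<Rightarrow> ('x \<Rightarrow> 'x) \<Rightarrow> bool" where
  "ergodic_map M T \<longleftrightarrow>
     T \<in> measurable M M \<and> distr M M T = M \<and>
     (\<forall>A\<in>sets M. T -` A \<inter> space M = A \<longrightarrow> emeasure M A = 0 \<or> emeasure M (space M - A) = 0)"

text \<open>
  The measure \<open>\<mu>\<close> is the joint distribution of the two sequences.  Stationarity of each sequence
  is contained in the invariance of \<open>\<mu>\<close> under the product shifts.
\<close>

definition ergodic_environment :: "env measure \<Rightarrow> bool" where
  "ergodic_environment \<mu> \<longleftrightarrow>
     prob_space \<mu> \<and> sets \<mu> = sets env_space \<and>
     (\<forall>k\<ge>1. \<forall>l\<ge>1. ergodic_map \<mu> (map_prod (shift k) (shift l)))"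

definition law_a :: "env measure \<Rightarrow> real measure" where
  "law_a \<mu> = distr \<mu> borel (\<lambda>(a, b). a 1)"

definition law_b :: "env measure \<Rightarrow> real measure" where
  "law_b \<mu> = distr \<mu> borel (\<lambda>(a, b). b 1)"

definition measure_support :: "real measure \<Rightarrow> real set" where
  "measure_support \<eta> = {x. \<forall>U. open U \<and> x \<in> U \<longrightarrow> 0 < emeasure \<eta> U}"

text \<open>
  The real supremum is the right endpoint only if the support is nonempty and bounded above.  This
  covers the laws of the two environment parameters, which are probability measures carried
  by \<open>(0, 1)\<close>.
\<close>

definition right_endpoint :: "real measure \<Rightarrow> real" where
  "right_endpoint \<eta> = Sup (measure_support \<eta>)"

text \<open>
  The library's \<^term>\<open>geometric_pmf p\<close> is parametrised by the success probability \<open>p\<close> and counts the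
  failures, so its tail is \<open>P(W \<ge> k) = (1 - p)^k\<close>.  The parameter \<open>q\<close> below is the ratio of the tail.
\<close>

definition geometric_law :: "real \<Rightarrow> real measure" where
  "geometric_law q = distr (measure_pmf (geometric_pmf (1 - q))) borel real"

type_synonym weights = "nat \<times> nat \<Rightarrow> real"

definition weight_space :: "weights measure" where
  "weight_space = PiM ({1..} \<times> {1..}) (\<lambda>_. borel)"

definition quenched_law :: "env \<Rightarrow> weights measure" where
  "quenched_law = (\<lambda>(a, b). PiM ({1..} \<times> {1..}) (\<lambda>(i, j). geometric_law (a i * b j)))"

definition annealed_law :: "env measure \<Rightarrow> weights measure" where
  "annealed_law \<mu> = \<mu> \<bind> quenched_law"

fun last_passage :: "weights \<Rightarrow> nat \<Rightarrow> nat \<Rightarrow> real" where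
  "last_passage W 0 j = 0"
| "last_passage W (Suc i) 0 = 0"
| "last_passage W (Suc i) (Suc j) =
     max (last_passage W i (Suc j)) (last_passage W (Suc i) j) + W (Suc i, Suc j)"

text \<open>
  A shape function is determined on \<open>(0, \<infinity>) \<times> (0, \<infinity>)\<close> only.  The weights are nonnegative almost
  surely, so \<^const>\<open>ennreal\<close> truncates nothing.
\<close>

definition shape_function :: "env measure \<Rightarrow> (real \<Rightarrow> real \<Rightarrow> ennreal) \<Rightarrow> bool" where
  "shape_function \<mu> g \<longleftrightarrow>
     (AE W in annealed_law \<mu>. \<forall>s>0. \<forall>t>0.
        (\<lambda>n. ennreal (last_passage W (nat \<lfloor>real n * s\<rfloor>) (nat \<lfloor>real n * t\<rfloor>) / real n))
          \<longlonglongrightarrow> g s t)"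

lemma prob_space_geometric_law [simp]: "prob_space (geometric_law q)"
  unfolding geometric_law_def
  by (intro prob_space.prob_space_distr prob_space_measure_pmf) simp

lemma sets_geometric_law [simp, measurable_cong]: "sets (geometric_law q) = sets borel"
  by (simp add: geometric_law_def)

lemma geometric_law_tail:
  assumes "0 < q" "q < 1"
  shows "measure (geometric_law q) {real k..} = q ^ k"
proof -
  let ?G = "geometric_pmf (1 - q)"
  have "measure (geometric_law q) {real k..} = measure (measure_pmf ?G) {k..}"
    unfolding geometric_law_def by (subst measure_distr) (auto simp: vimage_def atLeast_def)
  also have "\<dots> = 1 - measure (measure_pmf ?G) {..<k}"
    using measure_pmf.prob_compl[of "{..<k}" ?G] by (simp add: Compl_eq_Diff_UNIV[symmetric] Compl_lessThan)
  also have "measure (measure_pmf ?G) {..<k} = (\<Sum>n<k. q ^ n * (1 - q))"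
    using assms by (subst measure_measure_pmf_finite) auto
  also have "\<dots> = 1 - q ^ k"
    using assms by (simp add: sum_gp_strict flip: sum_distrib_right)
  finally show ?thesis by simp
qed

lemma space_seq_spaceD: "c \<in> space seq_space \<Longrightarrow> 1 \<le> n \<Longrightarrow> 0 < c n \<and> c n < 1"
  by (auto simp: seq_space_def space_PiM space_restrict_space PiE_iff)

lemma measurable_seq_component [measurable]:
  assumes "1 \<le> n"
  shows "(\<lambda>c. c n) \<in> borel_measurable seq_space"
proof -
  have "(\<lambda>c. c n) \<in> seq_space \<rightarrow>\<^sub>M restrict_space borel {0<..<1}"
    unfolding seq_space_def using assms by (intro measurable_component_singleton) simp
  then show ?thesis by (simp add: measurable_restrict_space2_iff)
qed

lemma measurable_geometric_law_emeasure:
  assumes [measurable]: "A \<in> sets borel" "q \<in> borel_measurable M"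
    and q: "\<And>x. x \<in> space M \<Longrightarrow> 0 < q x \<and> q x < 1"
  shows "(\<lambda>x. emeasure (geometric_law (q x)) A) \<in> borel_measurable M"
proof -
  have "emeasure (geometric_law (q x)) A =
      (\<Sum>n. ennreal (q x ^ n * (1 - q x)) * indicator A (real n))" if "x \<in> space M" for x
    using q[OF that] unfolding geometric_law_def
    by (subst emeasure_distr)
       (auto simp: nn_integral_measure_pmf nn_integral_count_space_nat indicator_def
         simp flip: nn_integral_indicator intro!: suminf_cong)
  then show ?thesis
    by (subst measurable_cong) auto
qed

text \<open>
  The kernel is measurable, so the monadic bind in \<^const>\<open>annealed_law\<close> is the genuine mixture
  of the quenched laws.
\<close>

lemma measurable_quenched_law [measurable]: "quenched_law \<in> env_space \<rightarrow>\<^sub>M prob_algebra weight_space"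
proof (rule measurable_prob_algebra_generated)
  let ?I = "{1..} \<times> {1..} :: (nat \<times> nat) set"
  show "sets weight_space = sigma_sets (PiE ?I (\<lambda>_. UNIV :: real set)) (prod_algebra ?I (\<lambda>_. borel))"
    by (simp add: weight_space_def sets_PiM)
  show "Int_stable (prod_algebra ?I (\<lambda>_. borel :: real measure))"
    by (rule Int_stable_prod_algebra)
  show "prod_algebra ?I (\<lambda>_. borel) \<subseteq> Pow (PiE ?I (\<lambda>_. UNIV :: real set))"
    using prod_algebra_sets_into_space[of ?I "\<lambda>_. borel :: real measure"] by simp
next
  fix e assume "e \<in> space env_space"
  show "prob_space (quenched_law e)"
    by (auto simp: quenched_law_def split: prod.splits intro!: prob_space_PiM)
  show "sets (quenched_law e) = sets weight_space"
    by (auto simp: quenched_law_def weight_space_def split: prod.splits intro!: sets_PiM_cong)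
next
  let ?I = "{1..} \<times> {1..} :: (nat \<times> nat) set"
  fix A assume "A \<in> prod_algebra ?I (\<lambda>_. borel :: real measure)"
  from prod_algebraE[OF this] obtain J E where
    A: "A = prod_emb ?I (\<lambda>_. borel) J (PiE J E)" and J: "finite J" "J \<subseteq> ?I"
      and E: "\<And>i. i \<in> J \<Longrightarrow> E i \<in> sets (borel :: real measure)" by metis
  let ?f = "\<lambda>e p. emeasure (geometric_law (fst e (fst p) * snd e (snd p))) (E p)"
  have "emeasure (quenched_law e) A = (\<Prod>p\<in>J. ?f e p)" for e :: env
  proof -
    let ?M = "\<lambda>p. geometric_law (fst e (fst p) * snd e (snd p))"
    have "quenched_law e = PiM ?I ?M"
      by (simp add: quenched_law_def case_prod_beta')
    moreover have "A = prod_emb ?I ?M J (PiE J E)"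
      unfolding A prod_emb_def by (simp add: geometric_law_def)
    ultimately show ?thesis
      using J E by (simp add: emeasure_PiM_emb)
  qed
  moreover have "(\<lambda>e. ?f e p) \<in> borel_measurable env_space" if "p \<in> J" for p
  proof (rule measurable_geometric_law_emeasure)
    have p: "1 \<le> fst p" "1 \<le> snd p" using that J by auto
    show "E p \<in> sets borel" using E that .
    show "(\<lambda>e. fst e (fst p) * snd e (snd p)) \<in> borel_measurable env_space"
      unfolding env_space_def
      by (intro borel_measurable_times
           measurable_compose[OF measurable_fst measurable_seq_component[OF p(1)]]
           measurable_compose[OF measurable_snd measurable_seq_component[OF p(2)]])
    show "0 < fst e (fst p) * snd e (snd p) \<and> fst e (fst p) * snd e (snd p) < 1"
      if "e \<in> space env_space" for e
    proof -
      have "0 < fst e (fst p) \<and> fst e (fst p) < 1" "0 < snd e (snd p) \<and> snd e (snd p) < 1"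
        using that space_seq_spaceD[OF _ p(1), of "fst e"] space_seq_spaceD[OF _ p(2), of "snd e"]
        by (auto simp: env_space_def space_pair_measure)
      then show ?thesis
        using mult_strict_mono[of "fst e (fst p)" 1 "snd e (snd p)" 1] by simp
    qed
  qed
  ultimately show "(\<lambda>e. emeasure (quenched_law e) A) \<in> borel_measurable env_space"
    by simp
qed

lemma emeasure_annealed_law:
  assumes "prob_space \<mu>" "sets \<mu> = sets env_space" "A \<in> sets weight_space"
  shows "emeasure (annealed_law \<mu>) A = (\<integral>\<^sup>+e. emeasure (quenched_law e) A \<partial>\<mu>)"
  unfolding annealed_law_def
  using assms by (intro emeasure_bind_prob_algebra[of _ env_space])
    (auto simp: space_prob_algebra)

end

theory Submission
  imports Defs
begin

text \<open>
  Fix an environment and a number \<open>z\<close> between the right endpoint \<open>u\<close> of the law of the \<open>a\<close>'s and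
  \<open>1 / v\<close>, where \<open>v\<close> is the right endpoint of the law of the \<open>b\<close>'s.  Put further independent
  geometric weights on the two coordinate axes, with ratio \<open>a i / z\<close> at \<open>(i, 0)\<close> and \<open>z * b j\<close> at
  \<open>(0, j)\<close>, and no weight at the origin.  The last-passage time \<open>H\<close> of this larger model is stationary:
  on every row its horizontal increments are again independent with the laws of the weights on the
  horizontal axis (\<open>boundary_law_sweep\<close>).  So \<open>H\<close> is a sum of a column of independent weights
  and a sum that has the law of a row of independent weights, and Chebyshev's inequality together with
  the ergodic theorem for the environment gives \<open>H / n \<longlonglongrightarrow> h z\<close> in probability at the points with
  coordinates \<open>n * s\<close> and \<open>n * t\<close>, rounded down, where
  \<open>h z = s * A z + t * B z\<close>, \<open>A z = E [a / (z - a)]\<close> and \<open>B z = E [b z / (1 - b z)]\<close>.  The last-passage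
  time \<open>G\<close> of the original model is at most \<open>H\<close>, hence \<open>g s t \<le> h z\<close> for every \<open>z\<close>.

  For the lower bound one has to show, for a suitable \<open>z\<close>, that \<open>H\<close> exceeds \<open>G\<close> by little only.  An
  optimal path of the larger model follows one of the axes up to an exit point and then continues as
  a path of the original model (\<open>blp_exit_bound\<close>).  If it leaves the horizontal axis at
  distance \<open>x * n\<close>, then the upper bound with another parameter \<open>z'\<close> for the second part limits its
  weight to \<open>n\<close> times \<open>x * A z + (s - x) * A z' + t * B z' = h z' - x * (A z' - A z)\<close>.  When \<open>z\<close> is a critical
  point of \<open>h\<close> and \<open>z'\<close> is slightly smaller than \<open>z\<close>, the gain \<open>h z' - h z\<close> is of smaller order than
  \<open>z - z'\<close> while the loss \<open>x * (A z' - A z)\<close> is of that order.  Thus \<open>H\<close> itself would be too small, and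
  the exit point lies at distance \<open>o(n)\<close> from the origin (\<open>right_exits_controlled_by_comparison\<close>); the
  vertical axis is treated in the same way after a transposition, which exchanges \<open>a\<close> with \<open>b\<close> and \<open>z\<close>
  with \<open>1 / z\<close>.

  If \<open>h\<close> has no critical point, it is strictly monotone and the infimum sits at an end of the
  interval.  This is where the limit shape has a flat piece.  Take \<open>z\<close> close to that end.  The
  comparison still works for one axis.  For the other axis, a single row (or column) of the original
  model whose parameter is almost the right endpoint carries nearly as much weight as the axis, so a
  path along the axis may be replaced by a path along that row
  (\<open>right_exits_controlled_by_row\<close>).  Such a row is present at index one with positive probability,
  and as \<open>g s t\<close> is deterministic, the bound obtained in one such environment suffices.

  The existence of the limit \<open>g\<close> is a hypothesis, so convergence in probability under the
  quenched law of a single suitable environment is enough (\<open>quenched_limit_in_closed\<close>).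
\<close>

section \<open>Last passage with weights on the axes\<close>

text \<open>
  The last-passage time of the model with weights on the axes.  It takes values in \<open>nat\<close>, as the
  weights do, so that the increments and the Burke involution can be written with natural numbers.
\<close>

fun blp :: "(nat \<times> nat \<Rightarrow> nat) \<Rightarrow> nat \<Rightarrow> nat \<Rightarrow> nat" where
  "blp f 0 0 = 0"
| "blp f (Suc i) 0 = blp f i 0 + f (Suc i, 0)"
| "blp f 0 (Suc j) = blp f 0 j + f (0, Suc j)"
| "blp f (Suc i) (Suc j) = max (blp f i (Suc j)) (blp f (Suc i) j) + f (Suc i, Suc j)"

text \<open>
  The recursion \<open>last_passage\<close> on real arrays, read on integer-valued weights.
\<close>

definition lpt :: "(nat \<times> nat \<Rightarrow> nat) \<Rightarrow> nat \<Rightarrow> nat \<Rightarrow> real" where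
  "lpt f m n = last_passage (\<lambda>p. real (f p)) m n"

definition translate :: "nat \<Rightarrow> nat \<Rightarrow> (nat \<times> nat \<Rightarrow> nat) \<Rightarrow> nat \<times> nat \<Rightarrow> nat" where
  "translate k l f = (\<lambda>(i, j). f (i + k, j + l))"

lemma lpt_simps [simp]:
  "lpt f 0 n = 0" "lpt f m 0 = 0"
  "lpt f (Suc i) (Suc j) = max (lpt f i (Suc j)) (lpt f (Suc i) j) + real (f (Suc i, Suc j))"
  by (cases m; simp add: lpt_def)+

lemma lpt_nonneg: "0 \<le> lpt f m n"
proof (induction m arbitrary: n)
  case (Suc m)
  then show ?case by (induction n) (auto simp: le_max_iff_disj intro!: add_nonneg_nonneg)
qed simp

lemma lpt_le_blp: "lpt f m n \<le> real (blp f m n)"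
proof (induction m arbitrary: n)
  case (Suc m)
  note IH = Suc
  show ?case
  proof (induction n)
    case (Suc n)
    then show ?case using IH[of "Suc n"]
      by (simp add: max_def)
  qed simp
qed simp

lemma last_passage_cong:
  assumes "\<And>i j. 1 \<le> i \<Longrightarrow> i \<le> m \<Longrightarrow> 1 \<le> j \<Longrightarrow> j \<le> n \<Longrightarrow> W (i, j) = W' (i, j)"
  shows "last_passage W m n = last_passage W' m n"
  using assms
proof (induction m arbitrary: n)
  case (Suc m)
  note IH = Suc.IH
  from Suc.prems show ?case
  proof (induction n)
    case (Suc n)
    have "last_passage W (Suc m) n = last_passage W' (Suc m) n" using Suc by auto
    moreover have "last_passage W m (Suc n) = last_passage W' m (Suc n)"
      by (rule IH) (use Suc.prems in auto)
    ultimately show ?case using Suc.prems by simp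
  qed simp
qed simp

lemma lpt_cong:
  assumes "\<And>i j. 1 \<le> i \<Longrightarrow> i \<le> m \<Longrightarrow> 1 \<le> j \<Longrightarrow> j \<le> n \<Longrightarrow> f (i, j) = f' (i, j)"
  shows "lpt f m n = lpt f' m n"
  unfolding lpt_def using assms by (intro last_passage_cong) simp

lemma lpt_transpose: "lpt (f \<circ> prod.swap) n m = lpt f m n"
proof (induction m arbitrary: n)
  case (Suc m)
  then show ?case by (induction n) (auto simp: max.commute)
qed simp

lemma blp_bottom: "blp f m 0 = (\<Sum>i\<in>{1..m}. f (i, 0))"
  by (induction m) auto

lemma blp_left: "blp f 0 n = (\<Sum>j\<in>{1..n}. f (0, j))"
  by (induction n) auto

lemma translate_0 [simp]: "translate 0 0 f = f"
  by (simp add: translate_def)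

lemma translate_translate [simp]: "translate k l (translate k' l' f) = translate (k + k') (l + l') f"
  by (auto simp: translate_def fun_eq_iff add_ac)

lemma lpt_mono_right: "n \<le> n' \<Longrightarrow> lpt f m n \<le> lpt f m n'"
proof (induction n' rule: dec_induct)
  case (step n')
  have "lpt f m n' \<le> lpt f m (Suc n')" by (cases m) (auto simp: add_increasing2)
  with step show ?case by simp
qed simp

lemma row_path_le_lpt:
  assumes "1 \<le> n"
  shows "(\<Sum>i\<in>{1..k}. real (f (i, 1))) \<le> lpt f k n"
proof (induction k)
  case (Suc k)
  obtain n' where n: "n = Suc n'" using assms by (cases n) auto
  have "(\<Sum>i\<in>{1..Suc k}. real (f (i, 1))) \<le> lpt f (Suc k) 1"
  proof (induction k)
    case 0
    then show ?case by (simp add: One_nat_def)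
  next
    case (Suc k)
    then show ?case by (simp add: max_def)
  qed
  also have "\<dots> \<le> lpt f (Suc k) n" using assms by (rule lpt_mono_right)
  finally show ?case .
qed (simp add: lpt_nonneg)

text \<open>
  Superadditivity along a particular concatenation: go right on the first row up to column \<open>k\<close>, then
  follow an optimal path from \<open>(k + 1, 1)\<close>.
\<close>

lemma row_path_translate_le_lpt:
  assumes "1 \<le> n"
  shows "(\<Sum>i\<in>{1..k}. real (f (i, 1))) + lpt (translate k 0 f) m n \<le> lpt f (k + m) n"
  using assms
proof (induction m arbitrary: n)
  case 0
  then show ?case using row_path_le_lpt by simp
next
  case (Suc m)
  note IH = Suc.IH
  let ?S = "\<Sum>i\<in>{1..k}. real (f (i, 1))" and ?g = "translate k 0 f"
  from Suc.prems show ?case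
  proof (induction n rule: nat_induct_at_least)
    case base
    have "?S + lpt ?g m 1 \<le> lpt f (k + m) 1" using IH by blast
    then show ?case using lpt_nonneg[of ?g m 1] lpt_nonneg[of f "k + m" 1]
      by (simp add: translate_def max_def add_ac)
  next
    case (Suc n)
    have "?S + lpt ?g m (Suc n) \<le> lpt f (k + m) (Suc n)" by (rule IH) auto
    with Suc show ?case by (simp add: translate_def max_def add_ac)
  qed
qed

text \<open>
  A starting point further to the right on the first row leaves fewer paths to choose from.
\<close>

lemma lpt_translate_mono:
  assumes "k \<le> k'" "k' \<le> m" "1 \<le> n"
  shows "lpt (translate k' 0 f) (m - k') n \<le> lpt (translate k 0 f) (m - k) n"
proof -
  have "0 \<le> (\<Sum>i\<in>{1..k' - k}. real (translate k 0 f (i, 1)))" by (simp add: sum_nonneg)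
  with row_path_translate_le_lpt[OF assms(3), of "translate k 0 f" "k' - k" "m - k'"] assms
  show ?thesis by simp
qed

text \<open>
  An optimal path runs along one of the axes, leaves it at column \<open>k + 1\<close> (or row \<open>l + 1\<close>) and from
  there on sees only the weights off the axes.  By induction over the recursion: the maximum picks a
  neighbour, and the exit point of an optimal path to that neighbour serves for the new point.
\<close>

lemma blp_exit_bound:
  assumes "1 \<le> m" "1 \<le> n"
  shows "(\<exists>k<m. real (blp f m n) \<le> (\<Sum>i\<in>{1..Suc k}. real (f (i, 0))) + lpt (translate k 0 f) (m - k) n)
       \<or> (\<exists>l<n. real (blp f m n) \<le> (\<Sum>j\<in>{1..Suc l}. real (f (0, j))) + lpt (translate 0 l f) m (n - l))"
    (is "?X m n \<or> ?Y m n")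
proof -
  have X_right: "?X (Suc m) (Suc n)"
    if X: "?X m (Suc n)" and b: "blp f (Suc m) n \<le> blp f m (Suc n)" for m n
  proof -
    from X obtain k where k: "k < m"
      "real (blp f m (Suc n)) \<le> (\<Sum>i\<in>{1..Suc k}. real (f (i, 0))) + lpt (translate k 0 f) (m - k) (Suc n)"
      by blast
    have "lpt (translate k 0 f) (m - k) (Suc n) + real (f (Suc m, Suc n))
        \<le> lpt (translate k 0 f) (Suc m - k) (Suc n)"
      using k(1) by (simp add: Suc_diff_le translate_def)
    with k b show ?thesis by (intro exI[of _ k]) simp
  qed
  have X_up: "?X (Suc m) (Suc n)"
    if X: "?X (Suc m) n" and b: "blp f m (Suc n) \<le> blp f (Suc m) n" for m n
  proof -
    from X obtain k where k: "k < Suc m"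
      "real (blp f (Suc m) n) \<le> (\<Sum>i\<in>{1..Suc k}. real (f (i, 0))) + lpt (translate k 0 f) (Suc m - k) n"
      by blast
    have "lpt (translate k 0 f) (Suc m - k) n + real (f (Suc m, Suc n))
        \<le> lpt (translate k 0 f) (Suc m - k) (Suc n)"
      using k(1) by (simp add: Suc_diff_le translate_def)
    with k b show ?thesis by (intro exI[of _ k]) (simp add: max_def)
  qed
  have Y_right: "?Y (Suc m) (Suc n)"
    if Y: "?Y m (Suc n)" and b: "blp f (Suc m) n \<le> blp f m (Suc n)" for m n
  proof -
    from Y obtain k where k: "k < Suc n"
      "real (blp f m (Suc n)) \<le> (\<Sum>j\<in>{1..Suc k}. real (f (0, j))) + lpt (translate 0 k f) m (Suc n - k)"
      by blast
    have "lpt (translate 0 k f) m (Suc n - k) + real (f (Suc m, Suc n))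
        \<le> lpt (translate 0 k f) (Suc m) (Suc n - k)"
      using k(1) by (simp add: Suc_diff_le translate_def)
    with k b show ?thesis by (intro exI[of _ k]) simp
  qed
  have Y_up: "?Y (Suc m) (Suc n)"
    if Y: "?Y (Suc m) n" and b: "blp f m (Suc n) \<le> blp f (Suc m) n" for m n
  proof -
    from Y obtain k where k: "k < n"
      "real (blp f (Suc m) n) \<le> (\<Sum>j\<in>{1..Suc k}. real (f (0, j))) + lpt (translate 0 k f) (Suc m) (n - k)"
      by blast
    have "lpt (translate 0 k f) (Suc m) (n - k) + real (f (Suc m, Suc n))
        \<le> lpt (translate 0 k f) (Suc m) (Suc n - k)"
      using k(1) by (simp add: Suc_diff_le translate_def)
    with k b show ?thesis by (intro exI[of _ k]) (simp add: max_def)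
  qed
  have X0: "?X (Suc m) (Suc 0)" if "blp f m (Suc 0) \<le> blp f (Suc m) 0" for m
    using that by (intro exI[of _ m]) (simp add: blp_bottom translate_def max_def del: blp.simps(2))
  have Y0: "?Y (Suc 0) (Suc n)" if "blp f (Suc 0) n \<le> blp f 0 (Suc n)" for n
    using that by (intro exI[of _ n]) (simp add: blp_left translate_def max_def del: blp.simps(3))
  have "?X (Suc m) (Suc n) \<or> ?Y (Suc m) (Suc n)" for m n
  proof (induction m arbitrary: n)
    case 0
    show ?case
    proof (induction n)
      case 0
      then show ?case using X0 Y0 by (meson linear)
    next
      case (Suc n)
      then show ?case using X_up Y_up Y0 by (meson linear)
    qed
  next
    case (Suc m)
    note IH = Suc
    show ?case
    proof (induction n)
      case 0
      then show ?case using X0 IH X_right Y_right by (meson linear)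
    next
      case (Suc n)
      then show ?case using IH X_up Y_up X_right Y_right by (meson linear)
    qed
  qed
  from this[of "m - 1" "n - 1"] assms show ?thesis by simp
qed

section \<open>The Burke involution\<close>

text \<open>
  One step of the recursion as a change of coordinates.  Before the step, \<open>f (i, 0)\<close> holds the
  increment of the last-passage time over the bottom edge of the unit square at \<open>(i, j)\<close>, \<open>f (0, j)\<close> the
  increment over its left edge, and \<open>f (i, j)\<close> the weight of its upper right corner; with truncated
  subtraction the new entries at \<open>(i, 0)\<close> and \<open>(0, j)\<close> are the increments over the top and the right
  edge.  Storing the minimum of the two old increments in place of the used weight makes the step an
  involution.
\<close>

definition flip :: "nat \<Rightarrow> nat \<Rightarrow> (nat \<times> nat \<Rightarrow> nat) \<Rightarrow> nat \<times> nat \<Rightarrow> nat" where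
  "flip i j f = f((i, 0) := f (i, j) + (f (i, 0) - f (0, j)),
                  (0, j) := f (i, j) + (f (0, j) - f (i, 0)),
                  (i, j) := min (f (i, 0)) (f (0, j)))"

lemma flip_flip: "1 \<le> i \<Longrightarrow> 1 \<le> j \<Longrightarrow> flip i j (flip i j f) = f"
  by (auto simp: flip_def fun_eq_iff)

text \<open>
  Sweeping over the squares of a row from left to right, and over the rows from the bottom upwards,
  leaves the horizontal increments of row \<open>n\<close> in the entries \<open>(i, 0)\<close>.
\<close>

fun sweep_row :: "nat \<Rightarrow> nat \<Rightarrow> (nat \<times> nat \<Rightarrow> nat) \<Rightarrow> nat \<times> nat \<Rightarrow> nat" where
  "sweep_row 0 j f = f"
| "sweep_row (Suc i) j f = flip (Suc i) j (sweep_row i j f)"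

fun sweep :: "nat \<Rightarrow> nat \<Rightarrow> (nat \<times> nat \<Rightarrow> nat) \<Rightarrow> nat \<times> nat \<Rightarrow> nat" where
  "sweep m 0 f = f"
| "sweep m (Suc j) f = sweep_row m (Suc j) (sweep m j f)"

text \<open>
  The state in the middle of a row: the first \<open>i\<close> entries on the horizontal axis are already
  increments of row \<open>Suc j\<close>, the others are still increments of row \<open>j\<close>, and the entry at \<open>(0, Suc j)\<close> is
  the vertical increment in column \<open>i\<close>.
\<close>

lemma sweep_row_increments:
  assumes bottom: "\<And>i. i < m \<Longrightarrow> blp f (Suc i) j = blp f i j + g (Suc i, 0)"
    and above: "\<And>i. g (i, Suc j) = f (i, Suc j)"
  assumes "i \<le> m"
  shows "(\<forall>i'<m. blp f (Suc i') (if i' < i then Suc j else j)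
             = blp f i' (if i' < i then Suc j else j) + sweep_row i (Suc j) g (Suc i', 0))
    \<and> blp f i (Suc j) = blp f i j + sweep_row i (Suc j) g (0, Suc j)
    \<and> (\<forall>i'>i. sweep_row i (Suc j) g (i', Suc j) = f (i', Suc j))"
  using \<open>i \<le> m\<close>
proof (induction i)
  case 0
  show ?case using bottom above by (cases j) auto
next
  case (Suc i)
  let ?g = "sweep_row i (Suc j) g"
  from Suc have IH:
    "\<And>i'. i' < m \<Longrightarrow> blp f (Suc i') (if i' < i then Suc j else j)
             = blp f i' (if i' < i then Suc j else j) + ?g (Suc i', 0)"
    "blp f i (Suc j) = blp f i j + ?g (0, Suc j)"
    "\<And>i'. i' > i \<Longrightarrow> ?g (i', Suc j) = f (i', Suc j)" by auto
  have I: "blp f (Suc i) j = blp f i j + ?g (Suc i, 0)" using IH(1)[of i] Suc.prems by simp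
  have W: "?g (Suc i, Suc j) = f (Suc i, Suc j)" using IH(3) by simp
  have "blp f (Suc i) (Suc j) = blp f i (Suc j) + flip (Suc i) (Suc j) ?g (Suc i, 0)"
    using I IH(2) W by (simp add: flip_def)
  moreover have "blp f (Suc i) (Suc j) = blp f (Suc i) j + flip (Suc i) (Suc j) ?g (0, Suc j)"
    using I IH(2) W by (simp add: flip_def)
  moreover have "flip (Suc i) (Suc j) ?g (Suc i', 0) = ?g (Suc i', 0)" if "i' \<noteq> i" for i'
    using that by (simp add: flip_def)
  ultimately show ?case
    using IH(1,3) by (auto simp: less_Suc_eq flip_def simp del: blp.simps)
qed

lemma sweep_row_other: "j' \<noteq> 0 \<Longrightarrow> j' \<noteq> j \<Longrightarrow> sweep_row i j f (i', j') = f (i', j')"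
  by (induction i) (auto simp: flip_def)

lemma sweep_above: "n < j \<Longrightarrow> sweep m n f (i, j) = f (i, j)"
  by (induction n) (auto simp: sweep_row_other)

lemma sweep_increments: "i < m \<Longrightarrow> blp f (Suc i) n = blp f i n + sweep m n f (Suc i, 0)"
proof (induction n arbitrary: i)
  case (Suc n)
  have "\<And>i. sweep m n f (i, Suc n) = f (i, Suc n)" by (simp add: sweep_above)
  with sweep_row_increments[of m f n "sweep m n f" m] Suc show ?case
    by (simp del: blp.simps)
qed simp

text \<open>
  Reach \<open>(m, n)\<close> from the origin by going up the vertical axis and then along row \<open>n\<close>, and add up the
  increments.
\<close>

lemma blp_eq_boundary_sums:
  "blp f m n = (\<Sum>j\<in>{1..n}. f (0, j)) + (\<Sum>i\<in>{1..m}. sweep m n f (i, 0))"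
proof -
  have "k \<le> m \<Longrightarrow> blp f k n = blp f 0 n + (\<Sum>i\<in>{1..k}. sweep m n f (i, 0))" for k
  proof (induction k)
    case (Suc k)
    then show ?case using sweep_increments[of k m f n] by (simp del: blp.simps)
  qed simp
  then show ?thesis by (simp add: blp_left)
qed

section \<open>Fields of independent geometric weights\<close>

definition geo_field :: "(nat \<times> nat) set \<Rightarrow> (nat \<times> nat \<Rightarrow> real) \<Rightarrow> (nat \<times> nat \<Rightarrow> nat) pmf" where
  "geo_field K q = Pi_pmf K 0 (\<lambda>p. geometric_pmf (1 - q p))"

lemma geo_field_cong: "K = K' \<Longrightarrow> (\<And>p. p \<in> K \<Longrightarrow> q p = q' p) \<Longrightarrow> geo_field K q = geo_field K' q'"
  unfolding geo_field_def by (intro Pi_pmf_cong) auto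

text \<open>
  The coordinates \<open>h p\<close> of a product, for distinct \<open>h p\<close>, are again a product.  This covers restriction to
  a smaller rectangle, translation and transposition at once.
\<close>

lemma Pi_pmf_reindex:
  assumes K: "finite K" and h: "inj_on h J" "h ` J \<subseteq> K"
  shows "map_pmf (\<lambda>f p. if p \<in> J then f (h p) else d) (Pi_pmf K d P) = Pi_pmf J d (\<lambda>p. P (h p))"
    (is "map_pmf ?\<phi> _ = _")
proof (rule pmf_eqI)
  fix g
  have J: "finite J" using h K by (metis finite_imageD finite_subset)
  show "pmf (map_pmf ?\<phi> (Pi_pmf K d P)) g = pmf (Pi_pmf J d (\<lambda>p. P (h p))) g"
  proof (cases "\<forall>p. p \<notin> J \<longrightarrow> g p = d")
    case False
    then have "?\<phi> -` {g} = {}" by auto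
    then have "pmf (map_pmf ?\<phi> (Pi_pmf K d P)) g = 0" by (simp only: pmf_map measure_empty)
    moreover have "pmf (Pi_pmf J d (\<lambda>p. P (h p))) g = 0"
      using False J by (intro pmf_Pi_outside) auto
    ultimately show ?thesis by simp
  next
    case True
    \<comment> \<open>The fibre over \<open>g\<close> is a cylinder, which constrains the coordinates in the image of \<open>h\<close> only.\<close>
    define B where "B r = (if r \<in> h ` J then {g (the_inv_into J h r)} else UNIV)" for r
    have Bh: "B (h p) = {g p}" if "p \<in> J" for p
      using that h by (simp add: B_def the_inv_into_f_f)
    have "?\<phi> -` {g} = Pi K B"
    proof (intro equalityI subsetI)
      fix f assume f: "f \<in> ?\<phi> -` {g}"
      then have "\<And>p. p \<in> J \<Longrightarrow> f (h p) = g p" by (auto simp: fun_eq_iff) metis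
      then show "f \<in> Pi K B" using h by (auto simp: B_def the_inv_into_f_f)
    next
      fix f assume "f \<in> Pi K B"
      then have "\<And>p. p \<in> J \<Longrightarrow> f (h p) = g p" using h(2) Bh by (fastforce simp: Pi_iff)
      then show "f \<in> ?\<phi> -` {g}" using True by (auto simp: fun_eq_iff)
    qed
    then have "pmf (map_pmf ?\<phi> (Pi_pmf K d P)) g = (\<Prod>r\<in>K. measure_pmf.prob (P r) (B r))"
      using K by (simp add: pmf_map measure_Pi_pmf_Pi)
    also have "\<dots> = (\<Prod>r\<in>h ` J. measure_pmf.prob (P r) (B r))"
      using K h by (intro prod.mono_neutral_right) (auto simp: B_def)
    also have "\<dots> = (\<Prod>p\<in>J. pmf (P (h p)) (g p))"
      using h by (simp add: prod.reindex Bh measure_pmf_single)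
    finally show ?thesis using True J by (simp add: pmf_Pi)
  qed
qed

lemma geo_field_reindex:
  assumes "finite K" "inj_on h J" "h ` J \<subseteq> K"
  shows "map_pmf (\<lambda>f p. if p \<in> J then f (h p) else 0) (geo_field K q) = geo_field J (\<lambda>p. q (h p))"
  unfolding geo_field_def by (rule Pi_pmf_reindex[OF assms])

lemma pmf_geo_field:
  assumes "finite K" "\<And>p. p \<in> K \<Longrightarrow> 0 < q p \<and> q p < 1"
  shows "pmf (geo_field K q) f =
    (if \<forall>p. p \<notin> K \<longrightarrow> f p = 0 then (\<Prod>p\<in>K. q p ^ f p) * (\<Prod>p\<in>K. 1 - q p) else 0)"
proof -
  have "(\<Prod>p\<in>K. pmf (geometric_pmf (1 - q p)) (f p)) = (\<Prod>p\<in>K. q p ^ f p * (1 - q p))"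
    by (intro prod.cong refl, subst pmf_geometric) (use assms(2) in \<open>auto simp: less_imp_le\<close>)
  then show ?thesis using assms(1) unfolding geo_field_def by (simp only: pmf_Pi prod.distrib)
qed

text \<open>
  The Burke property.  The probability of a configuration depends on it only through the product of
  the powers \<open>q p ^ f p\<close>.  Since \<open>q (i, j)\<close> is the product of the two other ratios, the three sites contribute
  \<open>q (i, 0) ^ (f (i, 0) + f (i, j)) * q (0, j) ^ (f (0, j) + f (i, j))\<close>, and both exponents are invariant under
  the involution.
\<close>

lemma geo_field_flip:
  assumes K: "finite K" and q: "\<And>p. p \<in> K \<Longrightarrow> 0 < q p \<and> q p < 1"
    and ij: "1 \<le> i" "1 \<le> j" and T: "{(i, 0), (0, j), (i, j)} \<subseteq> K"
    and factor: "q (i, j) = q (i, 0) * q (0, j)"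
  shows "map_pmf (flip i j) (geo_field K q) = geo_field K q"
proof (rule pmf_eqI)
  fix g
  let ?T = "{(i, 0), (0, j), (i, j)}"
  \<comment> \<open>As \<open>flip i j\<close> is its own inverse, the image law has at \<open>g\<close> the mass that the original law has at
    \<open>flip i j g\<close>.\<close>
  have inj: "inj (flip i j)" using flip_flip[OF ij] by (metis injI)
  have "pmf (map_pmf (flip i j) (geo_field K q)) g
      = pmf (map_pmf (flip i j) (geo_field K q)) (flip i j (flip i j g))"
    by (simp add: flip_flip[OF ij])
  also have "\<dots> = pmf (geo_field K q) (flip i j g)"
    by (rule pmf_map_inj'[OF inj])
  also have "\<dots> = pmf (geo_field K q) g"
  proof -
    have prod_T: "(\<Prod>p\<in>?T. q p ^ f p) = q (i, 0) ^ (f (i, 0) + f (i, j)) * q (0, j) ^ (f (0, j) + f (i, j))" for f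
      using ij by (simp add: factor power_mult_distrib power_add)
    have "(\<Prod>p\<in>?T. q p ^ flip i j g p) = (\<Prod>p\<in>?T. q p ^ g p)"
    proof -
      have "flip i j g (i, 0) + flip i j g (i, j) = g (i, 0) + g (i, j)"
        "flip i j g (0, j) + flip i j g (i, j) = g (0, j) + g (i, j)"
        using ij by (auto simp: flip_def)
      then show ?thesis by (simp only: prod_T)
    qed
    moreover have "(\<Prod>p\<in>K - ?T. q p ^ flip i j g p) = (\<Prod>p\<in>K - ?T. q p ^ g p)"
      by (intro prod.cong) (auto simp: flip_def)
    ultimately have "(\<Prod>p\<in>K. q p ^ flip i j g p) = (\<Prod>p\<in>K. q p ^ g p)"
      by (simp only: prod.subset_diff[OF T K])
    moreover have "(\<forall>p. p \<notin> K \<longrightarrow> flip i j g p = 0) \<longleftrightarrow> (\<forall>p. p \<notin> K \<longrightarrow> g p = 0)"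
    proof -
      have "flip i j g p = g p" if "p \<notin> K" for p
        using that T by (auto simp: flip_def)
      then show ?thesis by auto
    qed
    ultimately show ?thesis by (simp only: pmf_geo_field[OF K q])
  qed
  finally show "pmf (map_pmf (flip i j) (geo_field K q)) g = pmf (geo_field K q) g" .
qed

lemma geo_field_sweep:
  assumes K: "finite K" and q: "\<And>p. p \<in> K \<Longrightarrow> 0 < q p \<and> q p < 1"
    and T: "{0..m} \<times> {0..n} - {(0, 0)} \<subseteq> K"
    and factor: "\<And>i j. 1 \<le> i \<Longrightarrow> 1 \<le> j \<Longrightarrow> q (i, j) = q (i, 0) * q (0, j)"
  shows "map_pmf (sweep m n) (geo_field K q) = geo_field K q"
proof -
  have row: "map_pmf (sweep_row i (Suc j)) (geo_field K q) = geo_field K q"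
    if "i \<le> m" "j < n" for i j
    using that(1)
  proof (induction i)
    case 0
    have "sweep_row 0 (Suc j) = (\<lambda>f. f)" by (simp add: fun_eq_iff)
    then show ?case by (simp add: pmf.map_ident)
  next
    case (Suc i)
    have "sweep_row (Suc i) (Suc j) = flip (Suc i) (Suc j) \<circ> sweep_row i (Suc j)"
      by (simp add: fun_eq_iff)
    then have "map_pmf (sweep_row (Suc i) (Suc j)) (geo_field K q)
        = map_pmf (flip (Suc i) (Suc j)) (map_pmf (sweep_row i (Suc j)) (geo_field K q))"
      by (simp only: pmf.map_comp)
    also have "\<dots> = map_pmf (flip (Suc i) (Suc j)) (geo_field K q)" using Suc by simp
    also have "\<dots> = geo_field K q"
      by (rule geo_field_flip[OF K q]) (use Suc.prems that T factor in auto)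
    finally show ?case .
  qed
  have "j \<le> n \<Longrightarrow> map_pmf (sweep m j) (geo_field K q) = geo_field K q" for j
  proof (induction j)
    case 0
    have "sweep m 0 = (\<lambda>f. f)" by (simp add: fun_eq_iff)
    then show ?case by (simp add: pmf.map_ident)
  next
    case (Suc j)
    have "sweep m (Suc j) = sweep_row m (Suc j) \<circ> sweep m j"
      by (simp add: fun_eq_iff)
    then have "map_pmf (sweep m (Suc j)) (geo_field K q)
        = map_pmf (sweep_row m (Suc j)) (map_pmf (sweep m j) (geo_field K q))"
      by (simp only: pmf.map_comp)
    with Suc row[of m j] show ?case by (simp del: sweep.simps)
  qed
  then show ?thesis by simp
qed

text \<open>
  The second moment is bounded through \<open>k\<^sup>2 \<le> 2 * ((k + 2) choose k)\<close>: weighted by the geometric law, the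
  binomial coefficients sum to the total mass of a negative binomial law, up to the factor \<open>1 / p\<^sup>2\<close>.
\<close>

lemma geometric_second_moment:
  assumes p: "0 < p" "p \<le> 1"
  shows "integrable (geometric_pmf p) (\<lambda>k. (real k)\<^sup>2)"
    and "measure_pmf.expectation (geometric_pmf p) (\<lambda>k. (real k)\<^sup>2) \<le> 2 / p\<^sup>2"
proof -
  have le: "ennreal (pmf (geometric_pmf p) k) * ennreal ((real k)\<^sup>2)
      \<le> ennreal (2 / p\<^sup>2) * ennreal (pmf (neg_binomial_pmf 3 p) k)" for k
  proof -
    have "2 * ((k + 2) choose k) = (k + 2) * (k + 1)"
    proof -
      have "(k + 2) choose k = (k + 2) choose 2" using binomial_symmetric[of k "k + 2"] by simp
      also have "\<dots> = (k + 2) * (k + 1) div 2" by (simp add: choose_two)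
      moreover have "even ((k + 2) * (k + 1))" by simp
      ultimately show ?thesis by (simp only: dvd_mult_div_cancel)
    qed
    then have "real (2 * ((k + 2) choose k)) = real ((k + 2) * (k + 1))" by (rule arg_cong)
    then have "2 * real ((k + 2) choose k) = (real k + 2) * (real k + 1)"
      by (simp only: of_nat_mult of_nat_add of_nat_numeral of_nat_1)
    then have "(real k)\<^sup>2 \<le> 2 * real ((k + 2) choose k)"
      by (simp add: power2_eq_square algebra_simps)
    then have "(1 - p) ^ k * p * (real k)\<^sup>2 \<le> (1 - p) ^ k * p * (2 * real ((k + 2) choose k))"
      using p by (intro mult_left_mono) auto
    also have "\<dots> = 2 / p\<^sup>2 * pmf (neg_binomial_pmf 3 p) k"
      using p by (simp add: pmf_neg_binomial power3_eq_cube power2_eq_square)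
    finally show ?thesis using p
      by (simp add: ennreal_mult'[symmetric])
  qed
  have "(\<integral>\<^sup>+k. ennreal ((real k)\<^sup>2) \<partial>geometric_pmf p)
      \<le> (\<integral>\<^sup>+k. ennreal (2 / p\<^sup>2) * ennreal (pmf (neg_binomial_pmf 3 p) k) \<partial>count_space UNIV)"
    unfolding nn_integral_measure_pmf by (intro nn_integral_mono le)
  also have "\<dots> = ennreal (2 / p\<^sup>2)"
    by (simp add: nn_integral_cmult nn_integral_pmf_eq_1)
  finally have le2: "(\<integral>\<^sup>+k. ennreal ((real k)\<^sup>2) \<partial>geometric_pmf p) \<le> ennreal (2 / p\<^sup>2)" .
  show "integrable (geometric_pmf p) (\<lambda>k. (real k)\<^sup>2)"
    using le2 by (intro integrableI_bounded) (auto intro: le_less_trans)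
  then show "measure_pmf.expectation (geometric_pmf p) (\<lambda>k. (real k)\<^sup>2) \<le> 2 / p\<^sup>2"
    using le2 by (simp add: nn_integral_eq_integral)
qed

text \<open>
  Chebyshev's inequality for a sum of independent weights, with a bound on the variance that is
  uniform as long as the ratios stay below \<open>Q\<close>.
\<close>

lemma geo_field_Chebyshev:
  assumes K: "finite K" and L: "L \<subseteq> K" and q: "\<And>p. p \<in> L \<Longrightarrow> 0 < q p \<and> q p \<le> Q" and Q: "Q < 1"
    and x: "0 < x"
  shows "measure_pmf.prob (geo_field K q)
      {f. x \<le> \<bar>(\<Sum>p\<in>L. real (f p)) - (\<Sum>p\<in>L. q p / (1 - q p))\<bar>} \<le> real (card L) * (2 / (1 - Q)\<^sup>2) / x\<^sup>2"
proof -
  let ?P = "geo_field K q" and ?m = "\<lambda>p. q p / (1 - q p)"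
  let ?E = "measure_pmf.expectation (geo_field K q)"
  let ?X = "\<lambda>f. \<Sum>p\<in>L. real (f p)"
  have fL: "finite L" using K L finite_subset by blast
  have marginal: "map_pmf (\<lambda>f. f p) ?P = geometric_pmf (1 - q p)" if "p \<in> L" for p
    using that L K by (auto simp: geo_field_def Pi_pmf_component)
  have int1: "integrable ?P (\<lambda>f. real (f p))" and E1: "?E (\<lambda>f. real (f p)) = ?m p"
    and int2: "integrable ?P (\<lambda>f. (real (f p))\<^sup>2)"
    and E2: "?E (\<lambda>f. (real (f p))\<^sup>2) \<le> 2 / (1 - Q)\<^sup>2" if p: "p \<in> L" for p
  proof -
    have r: "0 < 1 - q p" "1 - q p \<le> 1" using q[OF p] Q by auto
    show "integrable ?P (\<lambda>f. real (f p))" "?E (\<lambda>f. real (f p)) = ?m p"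
      using integrable_real_geometric_pmf[of "1 - q p"] expectation_geometric_pmf[of "1 - q p"] r
        marginal[OF p, symmetric] by simp_all
    show "integrable ?P (\<lambda>f. (real (f p))\<^sup>2)"
      using geometric_second_moment(1)[OF r] marginal[OF p, symmetric] by simp
    have "?E (\<lambda>f. (real (f p))\<^sup>2) \<le> 2 / (1 - q p)\<^sup>2"
      using geometric_second_moment(2)[OF r] marginal[OF p, symmetric] by simp
    also have "\<dots> \<le> 2 / (1 - Q)\<^sup>2"
      using q[OF p] Q by (intro divide_left_mono power_mono mult_pos_pos zero_less_power) auto
    finally show "?E (\<lambda>f. (real (f p))\<^sup>2) \<le> 2 / (1 - Q)\<^sup>2" .
  qed
  have cross: "integrable ?P (\<lambda>f. real (f p) * real (f r)) \<and> ?E (\<lambda>f. real (f p) * real (f r)) = ?m p * ?m r"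
    if p: "p \<in> L" and r: "r \<in> L" and pr: "p \<noteq> r" for p r
  proof -
    \<comment> \<open>The product of two coordinates, written as a product over all of \<open>K\<close>.\<close>
    define \<phi> :: "nat \<times> nat \<Rightarrow> nat \<Rightarrow> real" where "\<phi> x = (if x \<in> {p, r} then real else (\<lambda>_. 1))" for x
    have int: "integrable (geometric_pmf (1 - q x)) (\<phi> x)" if "x \<in> K" for x
      using q[OF p] q[OF r] Q by (auto simp: \<phi>_def intro!: integrable_real_geometric_pmf)
    have eq: "(\<Prod>x\<in>K. \<phi> x (f x)) = real (f p) * real (f r)" for f
    proof -
      have "(\<Prod>x\<in>K. \<phi> x (f x)) = (\<Prod>x\<in>{p, r}. \<phi> x (f x))"
        using K L p r by (intro prod.mono_neutral_right) (auto simp: \<phi>_def)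
      then show ?thesis using pr by (simp add: \<phi>_def)
    qed
    have "?E (\<lambda>f. \<Prod>x\<in>K. \<phi> x (f x)) = (\<Prod>x\<in>K. measure_pmf.expectation (geometric_pmf (1 - q x)) (\<phi> x))"
      unfolding geo_field_def by (rule expectation_prod_Pi_pmf[OF K int]) (auto simp: \<phi>_def)
    also have "\<dots> = (\<Prod>x\<in>{p, r}. measure_pmf.expectation (geometric_pmf (1 - q x)) (\<phi> x))"
      using K L p r by (intro prod.mono_neutral_right) (auto simp: \<phi>_def)
    also have "\<dots> = ?m p * ?m r"
      using pr q[OF p] q[OF r] Q by (simp add: \<phi>_def expectation_geometric_pmf)
    finally have "?E (\<lambda>f. real (f p) * real (f r)) = ?m p * ?m r" by (simp add: eq)
    moreover have "integrable ?P (\<lambda>f. \<Prod>x\<in>K. \<phi> x (f x))"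
      unfolding geo_field_def by (rule integrable_prod_Pi_pmf[OF K int])
    then have "integrable ?P (\<lambda>f. real (f p) * real (f r))" by (simp add: eq)
    ultimately show ?thesis by simp
  qed
  have sq: "(?X f)\<^sup>2 = (\<Sum>p\<in>L. \<Sum>r\<in>L. real (f p) * real (f r))" for f
    by (simp add: power2_eq_square sum_product)
  have int': "integrable ?P (\<lambda>f. real (f p) * real (f r))" if "p \<in> L" "r \<in> L" for p r
    using cross[OF that] int2[OF that(1)] by (cases "p = r") (auto simp: power2_eq_square)
  have intX: "integrable ?P ?X" by (intro Bochner_Integration.integrable_sum int1)
  have intX2: "integrable ?P (\<lambda>f. (?X f)\<^sup>2)"
    unfolding sq by (intro Bochner_Integration.integrable_sum int')
  have EX: "?E ?X = (\<Sum>p\<in>L. ?m p)"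
    using int1 E1 by (subst Bochner_Integration.integral_sum) auto
  have EX2: "?E (\<lambda>f. (?X f)\<^sup>2) = (\<Sum>p\<in>L. \<Sum>r\<in>L. ?E (\<lambda>f. real (f p) * real (f r)))"
    unfolding sq using int'
    by (subst Bochner_Integration.integral_sum)
       (auto intro!: sum.cong Bochner_Integration.integral_sum Bochner_Integration.integrable_sum)
  have "?E (\<lambda>f. (?X f)\<^sup>2) - (?E ?X)\<^sup>2
      = (\<Sum>p\<in>L. \<Sum>r\<in>L. ?E (\<lambda>f. real (f p) * real (f r)) - ?m p * ?m r)"
    unfolding EX2 EX by (simp add: power2_eq_square sum_product sum_subtractf)
  also have "\<dots> = (\<Sum>p\<in>L. \<Sum>r\<in>L. if p = r then ?E (\<lambda>f. (real (f p))\<^sup>2) - (?m p)\<^sup>2 else 0)"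
    using cross by (intro sum.cong) (auto simp: power2_eq_square)
  also have "\<dots> = (\<Sum>p\<in>L. ?E (\<lambda>f. (real (f p))\<^sup>2) - (?m p)\<^sup>2)"
    using fL by (simp add: sum.delta')
  also have "\<dots> \<le> (\<Sum>p\<in>L. 2 / (1 - Q)\<^sup>2)"
  proof (rule sum_mono)
    fix p assume "p \<in> L"
    then show "?E (\<lambda>f. (real (f p))\<^sup>2) - (?m p)\<^sup>2 \<le> 2 / (1 - Q)\<^sup>2"
      using E2[of p] zero_le_power2[of "?m p"] by linarith
  qed
  finally have "?E (\<lambda>f. (?X f)\<^sup>2) - (?E ?X)\<^sup>2 \<le> real (card L) * (2 / (1 - Q)\<^sup>2)" by simp
  then have "measure_pmf.variance ?P ?X \<le> real (card L) * (2 / (1 - Q)\<^sup>2)"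
    by (simp only: measure_pmf.variance_eq[OF intX intX2])
  then have "measure_pmf.variance ?P ?X / x\<^sup>2 \<le> real (card L) * (2 / (1 - Q)\<^sup>2) / x\<^sup>2"
    by (rule divide_right_mono) simp
  moreover have "measure_pmf.prob ?P {f. x \<le> \<bar>?X f - ?E ?X\<bar>} \<le> measure_pmf.variance ?P ?X / x\<^sup>2"
    using measure_pmf.Chebyshev_inequality[of ?X ?P x] intX2 x by simp
  ultimately show ?thesis unfolding EX[symmetric] by (rule order_trans[rotated])
qed

section \<open>Events of probability tending to one\<close>

text \<open>
  With high probability: along a sequence of laws, typically on growing rectangles, the exceptional
  event has vanishing probability.
\<close>

definition whp :: "(nat \<Rightarrow> 'a pmf) \<Rightarrow> (nat \<Rightarrow> 'a \<Rightarrow> bool) \<Rightarrow> bool" where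
  "whp P E \<longleftrightarrow> (\<lambda>n. measure_pmf.prob (P n) {x. \<not> E n x}) \<longlonglongrightarrow> 0"

lemma whp_bound:
  assumes "eventually (\<lambda>n. measure_pmf.prob (P n) {x. \<not> E n x} \<le> e n) sequentially" "e \<longlonglongrightarrow> 0"
  shows "whp P E"
  unfolding whp_def
  by (rule tendsto_sandwich[OF _ assms(1) tendsto_const assms(2)]) simp

lemma whp_mono:
  assumes "whp P E" "eventually (\<lambda>n. \<forall>x. E n x \<longrightarrow> E' n x) sequentially"
  shows "whp P E'"
proof (rule whp_bound)
  show "eventually (\<lambda>n. measure_pmf.prob (P n) {x. \<not> E' n x} \<le> measure_pmf.prob (P n) {x. \<not> E n x}) sequentially"
    using assms(2) by eventually_elim (auto intro!: measure_pmf.finite_measure_mono)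
qed (use assms(1) in \<open>simp add: whp_def\<close>)

lemma whp_mono': "whp P E \<Longrightarrow> (\<And>n x. E n x \<Longrightarrow> E' n x) \<Longrightarrow> whp P E'"
  by (erule whp_mono) simp

lemma whp_conj:
  assumes "whp P E" "whp P E'"
  shows "whp P (\<lambda>n x. E n x \<and> E' n x)"
proof (rule whp_bound)
  have "measure_pmf.prob (P n) {x. \<not> (E n x \<and> E' n x)}
      \<le> measure_pmf.prob (P n) {x. \<not> E n x} + measure_pmf.prob (P n) {x. \<not> E' n x}" for n
  proof -
    have "{x. \<not> (E n x \<and> E' n x)} = {x. \<not> E n x} \<union> {x. \<not> E' n x}" by auto
    then show ?thesis by (simp add: measure_subadditive)
  qed
  then show "eventually (\<lambda>n. measure_pmf.prob (P n) {x. \<not> (E n x \<and> E' n x)}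
      \<le> measure_pmf.prob (P n) {x. \<not> E n x} + measure_pmf.prob (P n) {x. \<not> E' n x}) sequentially" by simp
  show "(\<lambda>n. measure_pmf.prob (P n) {x. \<not> E n x} + measure_pmf.prob (P n) {x. \<not> E' n x}) \<longlonglongrightarrow> 0"
    using tendsto_add[OF assms[unfolded whp_def]] by simp
qed

lemma whp_True [simp]: "whp P (\<lambda>_ _. True)"
  by (simp add: whp_def)

lemma whp_ball:
  assumes "finite R" "\<And>r. r \<in> R \<Longrightarrow> whp P (E r)"
  shows "whp P (\<lambda>n x. \<forall>r\<in>R. E r n x)"
  using assms
proof (induction R rule: finite_induct)
  case (insert r R)
  then have "whp P (\<lambda>n x. E r n x \<and> (\<forall>r\<in>R. E r n x))" by (intro whp_conj) auto
  then show ?case by (rule whp_mono') auto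
qed simp

lemma whp_map: "whp (\<lambda>n. map_pmf (\<phi> n) (P n)) E \<longleftrightarrow> whp P (\<lambda>n x. E n (\<phi> n x))"
  by (simp add: whp_def vimage_def)

lemma geo_field_sum_concentration:
  fixes K L :: "nat \<Rightarrow> (nat \<times> nat) set" and q :: "nat \<Rightarrow> nat \<times> nat \<Rightarrow> real"
  assumes K: "\<And>n. finite (K n)" and L: "\<And>n. L n \<subseteq> K n"
    and q: "\<And>n p. p \<in> L n \<Longrightarrow> 0 < q n p \<and> q n p \<le> Q" and Q: "Q < 1"
    and card: "\<And>n. real (card (L n)) \<le> C * real n" and e: "0 < e"
  shows "whp (\<lambda>n. geo_field (K n) (q n)) (\<lambda>n f.
    \<bar>(\<Sum>p\<in>L n. real (f p)) - (\<Sum>p\<in>L n. q n p / (1 - q n p))\<bar> \<le> e * real n)"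
proof (rule whp_bound)
  let ?c = "2 / (1 - Q)\<^sup>2"
  show "eventually (\<lambda>n. measure_pmf.prob (geo_field (K n) (q n)) {f.
      \<not> \<bar>(\<Sum>p\<in>L n. real (f p)) - (\<Sum>p\<in>L n. q n p / (1 - q n p))\<bar> \<le> e * real n}
      \<le> C * ?c / e\<^sup>2 * (1 / real n)) sequentially"
    using eventually_gt_at_top[of 0]
  proof eventually_elim
    case (elim n)
    have "measure_pmf.prob (geo_field (K n) (q n)) {f.
        \<not> \<bar>(\<Sum>p\<in>L n. real (f p)) - (\<Sum>p\<in>L n. q n p / (1 - q n p))\<bar> \<le> e * real n}
      \<le> measure_pmf.prob (geo_field (K n) (q n)) {f.
        e * real n \<le> \<bar>(\<Sum>p\<in>L n. real (f p)) - (\<Sum>p\<in>L n. q n p / (1 - q n p))\<bar>}"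
      by (intro measure_pmf.finite_measure_mono) auto
    also have "\<dots> \<le> real (card (L n)) * ?c / (e * real n)\<^sup>2"
      using e elim by (intro geo_field_Chebyshev[OF K L q Q]) auto
    also have "\<dots> \<le> (C * real n) * ?c / (e * real n)\<^sup>2"
      by (intro divide_right_mono mult_right_mono card) auto
    also have "\<dots> = C * ?c / e\<^sup>2 * (1 / real n)"
      using elim by (simp add: power_mult_distrib power2_eq_square divide_simps)
    finally show ?case .
  qed
  show "(\<lambda>n. C * ?c / e\<^sup>2 * (1 / real n)) \<longlonglongrightarrow> 0"
    using tendsto_mult[OF tendsto_const lim_1_over_n, of "C * ?c / e\<^sup>2"] by simp
qed

section \<open>Stationary boundary weights\<close>

text \<open>
  The mean of a geometric variable with ratio \<open>c / w\<close>.  Both axes use it: the mean at \<open>(i, 0)\<close> is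
  \<open>odds (a i) z\<close>, the mean at \<open>(0, j)\<close> is \<open>odds (b j) (1 / z)\<close>.
\<close>

definition odds :: "real \<Rightarrow> real \<Rightarrow> real" where
  "odds c w = c / (w - c)"

definition bounded_env :: "real \<Rightarrow> (nat \<Rightarrow> real) \<Rightarrow> bool" where
  "bounded_env u a \<longleftrightarrow> (\<forall>i\<ge>1. 0 < a i \<and> a i \<le> u)"

definition bulk_law :: "(nat \<Rightarrow> real) \<Rightarrow> (nat \<Rightarrow> real) \<Rightarrow> nat \<Rightarrow> nat \<Rightarrow> (nat \<times> nat \<Rightarrow> nat) pmf" where
  "bulk_law a b m n = geo_field ({1..m} \<times> {1..n}) (\<lambda>(i, j). a i * b j)"

text \<open>
  The axes behave like an additional column with \<open>a 0 = z\<close> and an additional row with \<open>b 0 = 1 / z\<close>.  At the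
  origin this would give the ratio one, which is why the origin is left out of the law below.
\<close>

definition boundary_rate :: "(nat \<Rightarrow> real) \<Rightarrow> (nat \<Rightarrow> real) \<Rightarrow> real \<Rightarrow> nat \<times> nat \<Rightarrow> real" where
  "boundary_rate a b z = (\<lambda>(i, j). (if i = 0 then z else a i) * (if j = 0 then 1 / z else b j))"

definition boundary_law :: "(nat \<Rightarrow> real) \<Rightarrow> (nat \<Rightarrow> real) \<Rightarrow> real \<Rightarrow> nat \<Rightarrow> nat \<Rightarrow> (nat \<times> nat \<Rightarrow> nat) pmf" where
  "boundary_law a b z m n = geo_field ({0..m} \<times> {0..n} - {(0, 0)}) (boundary_rate a b z)"

lemma bounded_envD: "bounded_env u a \<Longrightarrow> 1 \<le> i \<Longrightarrow> 0 < a i" "bounded_env u a \<Longrightarrow> 1 \<le> i \<Longrightarrow> a i \<le> u"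
  by (auto simp: bounded_env_def)

lemma bounded_env_pos: "bounded_env u a \<Longrightarrow> 0 < u"
  using bounded_envD[of u a 1] by simp

text \<open>
  The parameter \<open>z\<close> is confined to the open interval from \<open>u\<close> to \<open>1 / v\<close> precisely to keep all ratios away from
  one, uniformly in the site.
\<close>

lemma boundary_rate_bounds:
  assumes a: "bounded_env u a" and b: "bounded_env v b" and z: "u < z" "z * v < 1"
    and p: "p \<noteq> (0, 0)"
  shows "0 < boundary_rate a b z p" "boundary_rate a b z p \<le> Max {u * v, u / z, z * v}"
    and "Max {u * v, u / z, z * v} < 1"
proof -
  have u: "0 < u" and v: "0 < v" using a b bounded_env_pos by auto
  have "0 < z" using u z by simp
  obtain i j where ij: "p = (i, j)" by (cases p)
  show "0 < boundary_rate a b z p"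
    using p \<open>0 < z\<close> bounded_envD[OF a, of i] bounded_envD[OF b, of j]
    by (auto simp: boundary_rate_def ij)
  show "boundary_rate a b z p \<le> Max {u * v, u / z, z * v}"
  proof (cases "i = 0")
    case True
    with p have "1 \<le> j" by (simp add: ij)
    with True bounded_envD[OF b this] \<open>0 < z\<close> have "boundary_rate a b z p \<le> z * v"
      by (simp add: boundary_rate_def ij)
    then show ?thesis by (simp add: le_max_iff_disj)
  next
    case False
    then have i: "1 \<le> i" by simp
    show ?thesis
    proof (cases "j = 0")
      case True
      with i bounded_envD[OF a i] \<open>0 < z\<close> have "boundary_rate a b z p \<le> u / z"
        by (simp add: boundary_rate_def ij divide_right_mono)
      then show ?thesis by (simp add: le_max_iff_disj)
    next
      case False
      with i bounded_envD[OF a i] bounded_envD[OF b, of j] u have "boundary_rate a b z p \<le> u * v"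
        by (simp add: boundary_rate_def ij mult_mono)
      then show ?thesis by (simp add: le_max_iff_disj)
    qed
  qed
  have "u * v < z * v" using z v by simp
  then show "Max {u * v, u / z, z * v} < 1" using z \<open>0 < z\<close> by simp
qed

lemma odds_eq: "0 < z \<Longrightarrow> odds c z = (c / z) / (1 - c / z)"
  by (simp add: odds_def divide_simps)

lemma odds_inverse_eq: "0 < z \<Longrightarrow> odds c (1 / z) = (c * z) / (1 - c * z)"
  by (simp add: odds_def divide_simps)

lemma sum_bottom_sites: "(\<Sum>p\<in>{1..k} \<times> {0}. f p) = (\<Sum>i\<in>{1..k}. f (i, 0 :: nat))"
  for f :: "nat \<times> nat \<Rightarrow> real"
  by (rule sum.reindex_bij_witness[of _ "\<lambda>i. (i, 0)" fst]) auto

lemma sum_left_sites: "(\<Sum>p\<in>{0} \<times> {1..k}. f p) = (\<Sum>j\<in>{1..k}. f (0 :: nat, j))"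
  for f :: "nat \<times> nat \<Rightarrow> real"
  by (rule sum.reindex_bij_witness[of _ "\<lambda>j. (0, j)" snd]) auto

lemma bottom_concentration:
  fixes a b :: "nat \<Rightarrow> nat \<Rightarrow> real" and M N k :: "nat \<Rightarrow> nat"
  assumes a: "\<And>n. bounded_env u (a n)" and b: "\<And>n. bounded_env v (b n)"
    and z: "u < z" "z * v < 1" and k: "\<And>n. k n \<le> M n" "\<And>n. real (k n) \<le> C * real n" and e: "0 < e"
  shows "whp (\<lambda>n. boundary_law (a n) (b n) z (M n) (N n)) (\<lambda>n f.
    \<bar>(\<Sum>i\<in>{1..k n}. real (f (i, 0))) - (\<Sum>i\<in>{1..k n}. odds (a n i) z)\<bar> \<le> e * real n)"
proof -
  have u: "0 < u" using a bounded_env_pos by blast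
  let ?q = "\<lambda>n. boundary_rate (a n) (b n) z"
  have "whp (\<lambda>n. boundary_law (a n) (b n) z (M n) (N n)) (\<lambda>n f.
    \<bar>(\<Sum>p\<in>{1..k n} \<times> {0}. real (f p)) - (\<Sum>p\<in>{1..k n} \<times> {0}. ?q n p / (1 - ?q n p))\<bar> \<le> e * real n)"
    unfolding boundary_law_def
  proof (rule geo_field_sum_concentration[where C = C])
    show "{1..k n} \<times> {0} \<subseteq> {0..M n} \<times> {0..N n} - {(0, 0)}" for n using k(1)[of n] by auto
    show "0 < ?q n p \<and> ?q n p \<le> Max {u * v, u / z, z * v}" if "p \<in> {1..k n} \<times> {0}" for n p
      using that by (intro conjI boundary_rate_bounds[OF a b z]) auto
    show "Max {u * v, u / z, z * v} < 1"
      by (rule boundary_rate_bounds[OF a b z, of "(1, 1)"]) simp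
  qed (use k e in auto)
  moreover have "(\<Sum>p\<in>{1..k n} \<times> {0}. ?q n p / (1 - ?q n p)) = (\<Sum>i\<in>{1..k n}. odds (a n i) z)" for n
    unfolding sum_bottom_sites using u z by (intro sum.cong) (auto simp: boundary_rate_def odds_eq)
  ultimately show ?thesis by (simp only: sum_bottom_sites)
qed

lemma left_concentration:
  fixes a b :: "nat \<Rightarrow> nat \<Rightarrow> real" and M N k :: "nat \<Rightarrow> nat"
  assumes a: "\<And>n. bounded_env u (a n)" and b: "\<And>n. bounded_env v (b n)"
    and z: "u < z" "z * v < 1" and k: "\<And>n. k n \<le> N n" "\<And>n. real (k n) \<le> C * real n" and e: "0 < e"
  shows "whp (\<lambda>n. boundary_law (a n) (b n) z (M n) (N n)) (\<lambda>n f.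
    \<bar>(\<Sum>j\<in>{1..k n}. real (f (0, j))) - (\<Sum>j\<in>{1..k n}. odds (b n j) (1 / z))\<bar> \<le> e * real n)"
proof -
  have u: "0 < u" using a bounded_env_pos by blast
  let ?q = "\<lambda>n. boundary_rate (a n) (b n) z"
  have "whp (\<lambda>n. boundary_law (a n) (b n) z (M n) (N n)) (\<lambda>n f.
    \<bar>(\<Sum>p\<in>{0} \<times> {1..k n}. real (f p)) - (\<Sum>p\<in>{0} \<times> {1..k n}. ?q n p / (1 - ?q n p))\<bar> \<le> e * real n)"
    unfolding boundary_law_def
  proof (rule geo_field_sum_concentration[where C = C])
    show "{0} \<times> {1..k n} \<subseteq> {0..M n} \<times> {0..N n} - {(0, 0)}" for n using k(1)[of n] by auto
    show "0 < ?q n p \<and> ?q n p \<le> Max {u * v, u / z, z * v}" if "p \<in> {0} \<times> {1..k n}" for n p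
      using that by (intro conjI boundary_rate_bounds[OF a b z]) auto
    show "Max {u * v, u / z, z * v} < 1"
      by (rule boundary_rate_bounds[OF a b z, of "(1, 1)"]) simp
  qed (use k e in auto)
  moreover have "(\<Sum>p\<in>{0} \<times> {1..k n}. ?q n p / (1 - ?q n p)) = (\<Sum>j\<in>{1..k n}. odds (b n j) (1 / z))" for n
    unfolding sum_left_sites using u z
    by (intro sum.cong) (auto simp: boundary_rate_def odds_inverse_eq mult.commute)
  ultimately show ?thesis by (simp only: sum_left_sites)
qed

lemma boundary_law_sweep:
  assumes a: "bounded_env u a" and b: "bounded_env v b" and z: "u < z" "z * v < 1"
  shows "map_pmf (sweep m n) (boundary_law a b z m n) = boundary_law a b z m n"
  unfolding boundary_law_def
proof (rule geo_field_sweep)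
  show "0 < boundary_rate a b z p \<and> boundary_rate a b z p < 1" if "p \<in> {0..m} \<times> {0..n} - {(0, 0)}" for p
    using boundary_rate_bounds[OF a b z, of p] that by auto
  show "boundary_rate a b z (i, j) = boundary_rate a b z (i, 0) * boundary_rate a b z (0, j)"
    if "1 \<le> i" "1 \<le> j" for i j
    using that z bounded_env_pos[OF a] by (simp add: boundary_rate_def)
qed auto

text \<open>
  The last-passage time is a sum over the vertical axis plus, by stationarity, a sum with the law of
  the sum over the horizontal axis.  The two are dependent, but each one concentrates.  The
  environment may vary with \<open>n\<close>, because it will also be applied to translated environments.
\<close>

lemma blp_concentration:
  fixes a b :: "nat \<Rightarrow> nat \<Rightarrow> real" and M N :: "nat \<Rightarrow> nat"
  assumes a: "\<And>n. bounded_env u (a n)" and b: "\<And>n. bounded_env v (b n)"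
    and z: "u < z" "z * v < 1" and size: "\<And>n. real (M n) \<le> C * real n" "\<And>n. real (N n) \<le> C * real n"
    and e: "0 < e"
  shows "whp (\<lambda>n. boundary_law (a n) (b n) z (M n) (N n)) (\<lambda>n f.
    \<bar>real (blp f (M n) (N n))
      - ((\<Sum>i\<in>{1..M n}. odds (a n i) z) + (\<Sum>j\<in>{1..N n}. odds (b n j) (1 / z)))\<bar> \<le> e * real n)"
proof -
  let ?P = "\<lambda>n. boundary_law (a n) (b n) z (M n) (N n)"
  have "whp (\<lambda>n. map_pmf (sweep (M n) (N n)) (?P n)) (\<lambda>n f.
    \<bar>(\<Sum>i\<in>{1..M n}. real (f (i, 0))) - (\<Sum>i\<in>{1..M n}. odds (a n i) z)\<bar> \<le> e / 2 * real n)"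
    unfolding boundary_law_sweep[OF a b z]
    by (rule bottom_concentration[OF a b z _ size(1)]) (use e in auto)
  then have "whp ?P (\<lambda>n f.
    \<bar>(\<Sum>i\<in>{1..M n}. real (sweep (M n) (N n) f (i, 0))) - (\<Sum>i\<in>{1..M n}. odds (a n i) z)\<bar> \<le> e / 2 * real n)"
    unfolding whp_map .
  moreover have "whp ?P (\<lambda>n f.
    \<bar>(\<Sum>j\<in>{1..N n}. real (f (0, j))) - (\<Sum>j\<in>{1..N n}. odds (b n j) (1 / z))\<bar> \<le> e / 2 * real n)"
    by (rule left_concentration[OF a b z _ size(2)]) (use e in auto)
  ultimately have "whp ?P (\<lambda>n f.
      \<bar>(\<Sum>i\<in>{1..M n}. real (sweep (M n) (N n) f (i, 0))) - (\<Sum>i\<in>{1..M n}. odds (a n i) z)\<bar> \<le> e / 2 * real n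
    \<and> \<bar>(\<Sum>j\<in>{1..N n}. real (f (0, j))) - (\<Sum>j\<in>{1..N n}. odds (b n j) (1 / z))\<bar> \<le> e / 2 * real n)"
    by (rule whp_conj)
  then show ?thesis
  proof (rule whp_mono', goal_cases)
    case (1 n f)
    have "real (blp f (M n) (N n))
        = (\<Sum>j\<in>{1..N n}. real (f (0, j))) + (\<Sum>i\<in>{1..M n}. real (sweep (M n) (N n) f (i, 0)))"
      by (subst blp_eq_boundary_sums) simp
    moreover have "e / 2 * real n = e * real n / 2" by simp
    ultimately show ?case using 1 unfolding abs_le_iff by linarith
  qed
qed

text \<open>
  Couples the original model with the larger one.
\<close>

lemma bulk_of_boundary_law:
  "map_pmf (\<lambda>f p. if p \<in> {1..m} \<times> {1..n} then f p else 0) (boundary_law a b z m n) = bulk_law a b m n"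
proof -
  have "map_pmf (\<lambda>f p. if p \<in> {1..m} \<times> {1..n} then f (id p) else 0) (boundary_law a b z m n)
      = geo_field ({1..m} \<times> {1..n}) (\<lambda>p. boundary_rate a b z (id p))"
    unfolding boundary_law_def by (rule geo_field_reindex) auto
  also have "\<dots> = bulk_law a b m n"
    unfolding bulk_law_def by (rule geo_field_cong) (auto simp: boundary_rate_def)
  finally show ?thesis by (simp only: id_apply)
qed

lemma lpt_bulk: "lpt (\<lambda>p. if p \<in> {1..m} \<times> {1..n} then f p else 0) m n = lpt f m n"
  by (rule lpt_cong) auto

lemma lpt_upper_tail:
  fixes a b :: "nat \<Rightarrow> nat \<Rightarrow> real" and M N :: "nat \<Rightarrow> nat"
  assumes a: "\<And>n. bounded_env u (a n)" and b: "\<And>n. bounded_env v (b n)"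
    and z: "u < z" "z * v < 1" and size: "\<And>n. real (M n) \<le> C * real n" "\<And>n. real (N n) \<le> C * real n"
    and e: "0 < e"
  shows "whp (\<lambda>n. bulk_law (a n) (b n) (M n) (N n)) (\<lambda>n f. lpt f (M n) (N n)
    \<le> (\<Sum>i\<in>{1..M n}. odds (a n i) z) + (\<Sum>j\<in>{1..N n}. odds (b n j) (1 / z)) + e * real n)"
proof -
  have "whp (\<lambda>n. boundary_law (a n) (b n) z (M n) (N n)) (\<lambda>n f. lpt f (M n) (N n)
    \<le> (\<Sum>i\<in>{1..M n}. odds (a n i) z) + (\<Sum>j\<in>{1..N n}. odds (b n j) (1 / z)) + e * real n)"
    using blp_concentration[OF a b z size e]
  proof (rule whp_mono', goal_cases)
    case (1 n f)
    with lpt_le_blp[of f "M n" "N n"] show ?case by linarith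
  qed
  then show ?thesis
    unfolding bulk_of_boundary_law[where z = z, symmetric] whp_map lpt_bulk .
qed

lemma bulk_law_translate:
  assumes "k + m' = m"
  shows "map_pmf (\<lambda>f p. if p \<in> {1..m'} \<times> {1..n} then translate k 0 f p else 0) (bulk_law a b m n)
    = bulk_law (\<lambda>i. a (i + k)) b m' n"
proof -
  let ?h = "\<lambda>(i, j). (i + k, j :: nat)"
  have "map_pmf (\<lambda>f p. if p \<in> {1..m'} \<times> {1..n} then f (?h p) else 0) (bulk_law a b m n)
      = geo_field ({1..m'} \<times> {1..n}) (\<lambda>p. (\<lambda>(i, j). a i * b j) (?h p))"
    unfolding bulk_law_def using assms by (intro geo_field_reindex) (auto simp: inj_on_def)
  also have "(\<lambda>f p. if p \<in> {1..m'} \<times> {1..n} then f (?h p) else 0)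
      = (\<lambda>f p. if p \<in> {1..m'} \<times> {1..n} then translate k 0 f p else 0)"
    by (auto simp: translate_def fun_eq_iff)
  also have "geo_field ({1..m'} \<times> {1..n}) (\<lambda>p. (\<lambda>(i, j). a i * b j) (?h p)) = bulk_law (\<lambda>i. a (i + k)) b m' n"
    unfolding bulk_law_def by (rule geo_field_cong) auto
  finally show ?thesis .
qed

text \<open>
  Reflection in the diagonal turns statements about exits from the horizontal axis into statements
  about exits from the vertical one.
\<close>

lemma boundary_law_transpose:
  assumes "0 < z"
  shows "map_pmf (\<lambda>f. f \<circ> prod.swap) (boundary_law a b z m n) = boundary_law b a (1 / z) n m"
proof -
  let ?K = "{0..m} \<times> {0..n} - {(0, 0)}" and ?J = "{0..n} \<times> {0..m} - {(0, 0)}"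
  have "map_pmf (\<lambda>f. f \<circ> prod.swap) (boundary_law a b z m n)
      = map_pmf (\<lambda>f p. if p \<in> ?J then f (prod.swap p) else 0) (boundary_law a b z m n)"
  proof (rule map_pmf_cong[OF refl])
    fix f assume f: "f \<in> set_pmf (boundary_law a b z m n)"
    have sub: "set_pmf (boundary_law a b z m n) \<subseteq> {f. \<forall>p. p \<notin> ?K \<longrightarrow> f p = 0}"
      unfolding boundary_law_def geo_field_def by (rule set_Pi_pmf_subset) simp
    have off: "\<forall>p. p \<notin> ?K \<longrightarrow> f p = 0"
      using subsetD[OF sub f] by (simp only: mem_Collect_eq)
    have swap: "prod.swap p \<in> ?K \<longleftrightarrow> p \<in> ?J" for p :: "nat \<times> nat" by (cases p) auto
    show "f \<circ> prod.swap = (\<lambda>p. if p \<in> ?J then f (prod.swap p) else 0)"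
    proof
      fix p
      show "(f \<circ> prod.swap) p = (if p \<in> ?J then f (prod.swap p) else 0)"
        using off[rule_format, of "prod.swap p"] swap[of p] by (simp only: o_apply) argo
    qed
  qed
  also have "\<dots> = geo_field ?J (\<lambda>p. boundary_rate a b z (prod.swap p))"
    unfolding boundary_law_def by (rule geo_field_reindex) auto
  also have "\<dots> = boundary_law b a (1 / z) n m"
    unfolding boundary_law_def using assms by (intro geo_field_cong) (auto simp: boundary_rate_def split: if_splits)
  finally show ?thesis .
qed

section \<open>Lattice points in a fixed direction\<close>

definition cesaro :: "(nat \<Rightarrow> real) \<Rightarrow> real \<Rightarrow> bool" where
  "cesaro x c \<longleftrightarrow> (\<lambda>n. (\<Sum>i\<in>{1..n}. x i) / real n) \<longlonglongrightarrow> c"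

definition scaled :: "nat \<Rightarrow> real \<Rightarrow> nat" where
  "scaled n r = nat \<lfloor>real n * r\<rfloor>"

lemma scaled_mono: "r \<le> s \<Longrightarrow> scaled n r \<le> scaled n s"
  unfolding scaled_def by (intro nat_mono floor_mono mult_left_mono) auto

lemma scaled_0 [simp]: "scaled n 0 = 0"
  by (simp add: scaled_def)

lemma scaled_le: "0 \<le> r \<Longrightarrow> real (scaled n r) \<le> r * real n"
  by (simp add: scaled_def mult.commute)

lemma scaled_gt: "r * real n - 1 < real (scaled n r)"
proof -
  have "real n * r < real_of_int \<lfloor>real n * r\<rfloor> + 1" by linarith
  moreover have "real_of_int \<lfloor>real n * r\<rfloor> \<le> real (scaled n r)" by (simp add: scaled_def)
  ultimately have "real n * r - 1 < real (scaled n r)" by linarith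
  then show ?thesis by (simp only: mult.commute[of r])
qed

lemma scaled_tendsto: "(\<lambda>n. real (scaled n r) / real n) \<longlonglongrightarrow> r" if "0 \<le> r"
proof (rule tendsto_sandwich)
  show "eventually (\<lambda>n. r - 1 / real n \<le> real (scaled n r) / real n) sequentially"
    using eventually_gt_at_top[of 0]
  proof eventually_elim
    case (elim n)
    have "(r * real n - 1) / real n \<le> real (scaled n r) / real n"
      using scaled_gt[of r n] by (intro divide_right_mono) auto
    with elim show ?case by (simp add: diff_divide_distrib)
  qed
  show "eventually (\<lambda>n. real (scaled n r) / real n \<le> r) sequentially"
    using eventually_gt_at_top[of 0]
  proof eventually_elim
    case (elim n)
    then show ?case using scaled_le[OF that, of n] by (simp add: field_simps)
  qed
  show "(\<lambda>n. r - 1 / real n) \<longlonglongrightarrow> r"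
    using tendsto_diff[OF tendsto_const lim_1_over_n, of r] by simp
qed simp

lemma scaled_at_top: "0 < r \<Longrightarrow> filterlim (\<lambda>n. scaled n r) at_top sequentially"
  unfolding filterlim_at_top
proof
  fix Z assume r: "0 < r"
  show "eventually (\<lambda>n. Z \<le> scaled n r) sequentially"
    using eventually_ge_at_top[of "nat \<lceil>(real Z + 1) / r\<rceil>"]
  proof eventually_elim
    case (elim n)
    then have "(real Z + 1) / r \<le> real n" by linarith
    then have "real Z + 1 \<le> r * real n" using r by (simp add: field_simps)
    then show ?case using scaled_gt[of r n] by linarith
  qed
qed

lemma cesaro_scaled:
  assumes "cesaro x c" "0 \<le> r"
  shows "(\<lambda>n. (\<Sum>i\<in>{1..scaled n r}. x i) / real n) \<longlonglongrightarrow> r * c"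
proof (cases "r = 0")
  case False
  with assms have r: "0 < r" by simp
  have "(\<lambda>n. (real (scaled n r) / real n) * ((\<Sum>i\<in>{1..scaled n r}. x i) / real (scaled n r))) \<longlonglongrightarrow> r * c"
    using scaled_tendsto[OF assms(2)] filterlim_compose[OF assms(1)[unfolded cesaro_def] scaled_at_top[OF r]]
    by (rule tendsto_mult)
  moreover have "eventually (\<lambda>n. 0 < scaled n r) sequentially"
    using scaled_at_top[OF r, unfolded filterlim_at_top, rule_format, of 1]
    by (rule eventually_mono) simp
  then have "eventually (\<lambda>n. (real (scaled n r) / real n) * ((\<Sum>i\<in>{1..scaled n r}. x i) / real (scaled n r))
      = (\<Sum>i\<in>{1..scaled n r}. x i) / real n) sequentially"
    by eventually_elim simp
  ultimately show ?thesis by (rule Lim_transform_eventually)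
qed simp

lemma cesaro_scaled_close:
  assumes "cesaro x c" "0 \<le> r" "0 < e"
  shows "eventually (\<lambda>n. \<bar>(\<Sum>i\<in>{1..scaled n r}. x i) - real n * (r * c)\<bar> \<le> e * real n) sequentially"
proof -
  have "eventually (\<lambda>n. \<bar>(\<Sum>i\<in>{1..scaled n r}. x i) / real n - r * c\<bar> < e) sequentially"
    using tendstoD[OF cesaro_scaled[OF assms(1,2)] assms(3)] by (simp add: dist_real_def)
  then show ?thesis using eventually_gt_at_top[of 0]
  proof eventually_elim
    case (elim n)
    then have "\<bar>(\<Sum>i\<in>{1..scaled n r}. x i) / real n - r * c\<bar> * real n \<le> e * real n"
      by (intro mult_right_mono) auto
    also have "\<bar>(\<Sum>i\<in>{1..scaled n r}. x i) / real n - r * c\<bar> * real n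
        = \<bar>((\<Sum>i\<in>{1..scaled n r}. x i) / real n - r * c) * real n\<bar>" by (simp add: abs_mult)
    also have "((\<Sum>i\<in>{1..scaled n r}. x i) / real n - r * c) * real n
        = (\<Sum>i\<in>{1..scaled n r}. x i) - real n * (r * c)" using elim by (simp add: field_simps)
    finally show ?case .
  qed
qed

section \<open>Growth in a fixed environment\<close>

lemma block_index:
  fixes c :: "nat \<Rightarrow> nat"
  assumes "c 0 \<le> k" "k < c R"
  shows "\<exists>r<R. c r \<le> k \<and> k < c (Suc r)"
  using assms(2)
proof (induction R)
  case (Suc R)
  show ?case
  proof (cases "k < c R")
    case True
    with Suc.IH show ?thesis using less_Suc_eq by blast
  next
    case False
    with Suc.prems show ?thesis by (intro exI[of _ R]) auto
  qed
qed (use assms(1) in simp)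

text \<open>
  The largest weight of a path that runs on the horizontal axis up to column \<open>Suc k\<close> and then steps
  upwards.
\<close>

definition right_exit :: "(nat \<times> nat \<Rightarrow> nat) \<Rightarrow> nat \<Rightarrow> nat \<Rightarrow> nat \<Rightarrow> real" where
  "right_exit f m n k = (\<Sum>i\<in>{1..Suc k}. real (f (i, 0))) + lpt (translate k 0 f) (m - k) n"

text \<open>
  Either leaving the horizontal axis brings at most \<open>\<eta> * n\<close> more than the original model has, or it stays
  definitely below the value \<open>c * n\<close>.  With \<open>c\<close> the growth rate of the larger model, the second
  alternative cannot be optimal.
\<close>

definition right_exits_controlled ::
  "(nat \<Rightarrow> real) \<Rightarrow> (nat \<Rightarrow> real) \<Rightarrow> real \<Rightarrow> real \<Rightarrow> real \<Rightarrow> real \<Rightarrow> real \<Rightarrow> bool" where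
  "right_exits_controlled a b z s t c \<eta> \<longleftrightarrow> (\<exists>\<gamma>>0.
     whp (\<lambda>n. boundary_law a b z (scaled n s) (scaled n t)) (\<lambda>n f. \<forall>k<scaled n s.
       right_exit f (scaled n s) (scaled n t) k
         \<le> max (lpt f (scaled n s) (scaled n t) + \<eta> * real n) ((c - \<gamma>) * real n)))"

lemma boundary_sum_concentration:
  assumes a: "bounded_env u a" and b: "bounded_env v b" and z: "u < z" "z * v < 1"
    and A: "cesaro (\<lambda>i. odds (a i) z) A" and x: "0 \<le> x" "x \<le> s" and e: "0 < e"
  shows "whp (\<lambda>n. boundary_law a b z (scaled n s) (scaled n t)) (\<lambda>n f.
    \<bar>(\<Sum>i\<in>{1..scaled n x}. real (f (i, 0))) - real n * (x * A)\<bar> \<le> e * real n)"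
proof -
  have "whp (\<lambda>n. boundary_law a b z (scaled n s) (scaled n t)) (\<lambda>n f.
    \<bar>(\<Sum>i\<in>{1..scaled n x}. real (f (i, 0))) - (\<Sum>i\<in>{1..scaled n x}. odds (a i) z)\<bar> \<le> e / 2 * real n)"
    using a b z x e scaled_le[OF x(1)]
    by (intro bottom_concentration[where u = u and v = v and C = x]) (auto intro: scaled_mono)
  moreover have "eventually (\<lambda>n. \<bar>(\<Sum>i\<in>{1..scaled n x}. odds (a i) z) - real n * (x * A)\<bar> \<le> e / 2 * real n) sequentially"
    using cesaro_scaled_close[OF A x(1), of "e / 2"] e by simp
  then have "eventually (\<lambda>n. \<forall>f.
    \<bar>(\<Sum>i\<in>{1..scaled n x}. real (f (i, 0 :: nat))) - (\<Sum>i\<in>{1..scaled n x}. odds (a i) z)\<bar> \<le> e / 2 * real n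
    \<longrightarrow> \<bar>(\<Sum>i\<in>{1..scaled n x}. real (f (i, 0))) - real n * (x * A)\<bar> \<le> e * real n) sequentially"
  proof eventually_elim
    case (elim n)
    moreover have "e / 2 * real n = e * real n / 2" by simp
    ultimately show ?case unfolding abs_le_iff by (intro allI impI) linarith
  qed
  ultimately show ?thesis by (rule whp_mono)
qed

text \<open>
  The growth rate of \<open>H\<close> bounds \<open>G\<close> from above, also when paths start at a macroscopic distance \<open>x\<close> to
  the right: only the averages of the environment over the remaining columns enter.
\<close>

lemma translated_upper_tail:
  assumes a: "bounded_env u a" and b: "bounded_env v b" and z: "u < z" "z * v < 1"
    and A: "cesaro (\<lambda>i. odds (a i) z) A" and B: "cesaro (\<lambda>j. odds (b j) (1 / z)) B"
    and x: "0 \<le> x" "x \<le> s" and t: "0 \<le> t" and e: "0 < e"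
  shows "whp (\<lambda>n. bulk_law a b (scaled n s) (scaled n t)) (\<lambda>n f.
    lpt (translate (scaled n x) 0 f) (scaled n s - scaled n x) (scaled n t)
      \<le> ((s - x) * A + t * B + e) * real n)"
proof -
  let ?M = "\<lambda>n. scaled n s - scaled n x" and ?N = "\<lambda>n. scaled n t"
  let ?a = "\<lambda>n i. a (i + scaled n x)"
  have le: "scaled n x \<le> scaled n s" for n using x by (simp add: scaled_mono)
  have translated: "bulk_law (?a n) b (?M n) (?N n)
      = map_pmf (\<lambda>f p. if p \<in> {1..?M n} \<times> {1..?N n} then translate (scaled n x) 0 f p else 0)
          (bulk_law a b (scaled n s) (?N n))" for n
    using le[of n] by (intro bulk_law_translate[symmetric]) simp
  have "whp (\<lambda>n. bulk_law (?a n) b (?M n) (?N n)) (\<lambda>n f. lpt f (?M n) (?N n)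
    \<le> (\<Sum>i\<in>{1..?M n}. odds (?a n i) z) + (\<Sum>j\<in>{1..?N n}. odds (b j) (1 / z)) + e / 4 * real n)"
  proof (rule lpt_upper_tail[where u = u and v = v and C = "max s t"])
    show "bounded_env u (?a n)" for n using a by (auto simp: bounded_env_def)
    show "real (?M n) \<le> max s t * real n" for n
    proof -
      have "real (?M n) \<le> real (scaled n s)" by simp
      also have "\<dots> \<le> s * real n" using x by (intro scaled_le) auto
      also have "\<dots> \<le> max s t * real n" by (intro mult_right_mono) auto
      finally show ?thesis .
    qed
    show "real (?N n) \<le> max s t * real n" for n
    proof -
      have "real (?N n) \<le> t * real n" using t by (intro scaled_le) auto
      also have "\<dots> \<le> max s t * real n" by (intro mult_right_mono) auto
      finally show ?thesis .
    qed
  qed (use b z e in auto)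
  then have "whp (\<lambda>n. bulk_law a b (scaled n s) (scaled n t)) (\<lambda>n f.
    lpt (translate (scaled n x) 0 f) (?M n) (?N n)
    \<le> (\<Sum>i\<in>{1..?M n}. odds (?a n i) z) + (\<Sum>j\<in>{1..?N n}. odds (b j) (1 / z)) + e / 4 * real n)"
    unfolding translated whp_map lpt_bulk .
  then show ?thesis
  proof (rule whp_mono)
    have e4: "0 < e / 4" using e by simp
    have s: "0 \<le> s" using x by simp
    show "eventually (\<lambda>n. \<forall>f. lpt (translate (scaled n x) 0 f) (?M n) (?N n)
    \<le> (\<Sum>i\<in>{1..?M n}. odds (?a n i) z) + (\<Sum>j\<in>{1..?N n}. odds (b j) (1 / z)) + e / 4 * real n
    \<longrightarrow> lpt (translate (scaled n x) 0 f) (scaled n s - scaled n x) (scaled n t)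
      \<le> ((s - x) * A + t * B + e) * real n) sequentially"
      using cesaro_scaled_close[OF A x(1) e4] cesaro_scaled_close[OF A s e4] cesaro_scaled_close[OF B t e4]
    proof eventually_elim
      case (elim n)
      have "(\<Sum>i\<in>{1..?M n}. odds (?a n i) z) = (\<Sum>i\<in>{scaled n x + 1..scaled n s}. odds (a i) z)"
        using le[of n]
        by (intro sum.reindex_bij_witness[of _ "\<lambda>i. i - scaled n x" "\<lambda>i. i + scaled n x"]) auto
      also have "\<dots> = (\<Sum>i\<in>{1..scaled n s}. odds (a i) z) - (\<Sum>i\<in>{1..scaled n x}. odds (a i) z)"
      proof -
        have "{1..scaled n s} = {1..scaled n x} \<union> {scaled n x + 1..scaled n s}" using le[of n] by auto
        then have "(\<Sum>i\<in>{1..scaled n s}. odds (a i) z)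
            = (\<Sum>i\<in>{1..scaled n x}. odds (a i) z) + (\<Sum>i\<in>{scaled n x + 1..scaled n s}. odds (a i) z)"
          by (simp only:) (rule sum.union_disjoint, auto)
        then show ?thesis by simp
      qed
      finally have split: "(\<Sum>i\<in>{1..?M n}. odds (?a n i) z)
          = (\<Sum>i\<in>{1..scaled n s}. odds (a i) z) - (\<Sum>i\<in>{1..scaled n x}. odds (a i) z)" .
      have "((s - x) * A + t * B + e) * real n
          = real n * (s * A) - real n * (x * A) + real n * (t * B) + e * real n"
        and "e / 4 * real n = e * real n / 4" by (simp_all add: algebra_simps)
      then show ?case using elim split unfolding abs_le_iff by (intro allI impI) linarith
    qed
  qed
qed

lemma lpt_linear_upper_bound:
  assumes a: "bounded_env u a" and b: "bounded_env v b" and z: "u < z" "z * v < 1"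
    and A: "cesaro (\<lambda>i. odds (a i) z) A" and B: "cesaro (\<lambda>j. odds (b j) (1 / z)) B"
    and st: "0 \<le> s" "0 \<le> t" and e: "0 < e"
  shows "whp (\<lambda>n. bulk_law a b (scaled n s) (scaled n t)) (\<lambda>n f.
    lpt f (scaled n s) (scaled n t) \<le> (s * A + t * B + e) * real n)"
  using translated_upper_tail[OF a b z A B order.refl st e] by simp

lemma whp_boundary_of_bulk:
  assumes "whp (\<lambda>n. bulk_law a b (M n) (N n)) E"
    and "\<And>n f. E n (\<lambda>p. if p \<in> {1..M n} \<times> {1..N n} then f p else 0) \<longleftrightarrow> E n f"
  shows "whp (\<lambda>n. boundary_law a b z (M n) (N n)) E"
  using assms(1) unfolding bulk_of_boundary_law[where z = z, symmetric] whp_map assms(2) .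

lemma partial_sums_mono:
  fixes g :: "nat \<Rightarrow> real"
  assumes "k \<le> l" "\<And>i. 0 \<le> g i"
  shows "(\<Sum>i\<in>{1..k}. g i) \<le> (\<Sum>i\<in>{1..l}. g i)"
  using assms by (intro sum_mono2) auto

text \<open>
  Exits beyond \<open>x0 * n\<close> are compared with the boundary parameter \<open>z'\<close>: at distance \<open>x\<close> they bring at
  most \<open>s * A' + t * B' - x * (A' - A)\<close> per unit of \<open>n\<close>, which is largest at \<open>x = x0\<close>.  Exits before \<open>x0 * n\<close>
  collect at most \<open>x0 * A * n\<close> on the axis.  Chebyshev's inequality controls finitely many exit points
  only, therefore the axis is cut into \<open>R\<close> blocks of equal length and each exit is compared with
  the two ends of its block.
\<close>

lemma right_exits_controlled_by_comparison:
  assumes a: "bounded_env u a" and b: "bounded_env v b"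
    and z: "u < z" "z * v < 1" and z': "u < z'" "z' * v < 1"
    and A: "cesaro (\<lambda>i. odds (a i) z) A" and A': "cesaro (\<lambda>i. odds (a i) z') A'"
    and B': "cesaro (\<lambda>j. odds (b j) (1 / z')) B'"
    and st: "0 < s" "0 < t" and A0: "0 \<le> A" and AA': "A \<le> A'" and x0: "0 \<le> x0"
    and gain: "s * A' + t * B' - x0 * (A' - A) < c" and \<eta>: "x0 * A < \<eta>"
  shows "right_exits_controlled a b z s t c \<eta>"
proof -
  define gap where "gap = c - (s * A' + t * B' - x0 * (A' - A))"
  have gap: "0 < gap" using gain by (simp add: gap_def)
  \<comment> \<open>Far exits accumulate errors of at most \<open>3 * e\<close> and must stay \<open>gap / 2\<close> below \<open>c\<close>; near exits
    accumulate at most \<open>2 * e\<close>.\<close>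
  define e where "e = min gap (\<eta> - x0 * A) / 8"
  have e: "0 < e" "8 * e \<le> gap" "8 * e \<le> \<eta> - x0 * A" using gap \<eta> by (auto simp: e_def)
  obtain R :: nat where R: "s * A / e < real R" using reals_Archimedean2 by blast
  moreover have "0 \<le> s * A / e" using st A0 e by simp
  ultimately have R0: "0 < R" by (metis of_nat_0_less_iff order_le_less_trans)
  define y where "y r = real r * s / real R" for r
  have y: "0 \<le> y r" "r \<le> R \<Longrightarrow> y r \<le> s" for r
    using st R0 by (auto simp: y_def divide_simps)
  have yA: "y (Suc r) * A \<le> y r * A + e" for r
  proof -
    have "y (Suc r) * A = y r * A + s * A / real R" using R0 by (simp add: y_def field_simps)
    moreover have "s * A / real R \<le> e" using R R0 e by (simp add: field_simps)
    ultimately show ?thesis by simp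
  qed
  let ?P = "\<lambda>n. boundary_law a b z (scaled n s) (scaled n t)"
  have 1: "whp ?P (\<lambda>n f. \<forall>r\<in>{..R}.
    \<bar>(\<Sum>i\<in>{1..scaled n (y r)}. real (f (i, 0))) - real n * (y r * A)\<bar> \<le> e * real n)"
    using y e by (intro whp_ball boundary_sum_concentration[OF a b z A]) auto
  have 2: "whp ?P (\<lambda>n f. \<forall>r\<in>{..R}.
    lpt (translate (scaled n (y r)) 0 f) (scaled n s - scaled n (y r)) (scaled n t)
      \<le> ((s - y r) * A' + t * B' + e) * real n)"
  proof (rule whp_ball)
    fix r assume r: "r \<in> {..R}"
    show "whp ?P (\<lambda>n f. lpt (translate (scaled n (y r)) 0 f) (scaled n s - scaled n (y r)) (scaled n t)
      \<le> ((s - y r) * A' + t * B' + e) * real n)"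
    proof (rule whp_boundary_of_bulk)
      show "whp (\<lambda>n. bulk_law a b (scaled n s) (scaled n t))
        (\<lambda>n f. lpt (translate (scaled n (y r)) 0 f) (scaled n s - scaled n (y r)) (scaled n t)
      \<le> ((s - y r) * A' + t * B' + e) * real n)"
        using y r st e by (intro translated_upper_tail[OF a b z' A' B']) auto
    next
      fix n and f :: "nat \<times> nat \<Rightarrow> nat"
      let ?K = "{1..scaled n s} \<times> {1..scaled n t}"
      have "scaled n (y r) \<le> scaled n s" using y r by (auto intro!: scaled_mono)
      then have "lpt (translate (scaled n (y r)) 0 (\<lambda>p. if p \<in> ?K then f p else 0))
          (scaled n s - scaled n (y r)) (scaled n t)
        = lpt (translate (scaled n (y r)) 0 f) (scaled n s - scaled n (y r)) (scaled n t)"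
        by (intro lpt_cong) (auto simp: translate_def)
      then show "(lpt (translate (scaled n (y r)) 0 (\<lambda>p. if p \<in> ?K then f p else 0))
          (scaled n s - scaled n (y r)) (scaled n t) \<le> ((s - y r) * A' + t * B' + e) * real n)
        = (lpt (translate (scaled n (y r)) 0 f) (scaled n s - scaled n (y r)) (scaled n t)
          \<le> ((s - y r) * A' + t * B' + e) * real n)" by simp
    qed
  qed simp
  have "whp ?P (\<lambda>n f. \<forall>k<scaled n s. right_exit f (scaled n s) (scaled n t) k
         \<le> max (lpt f (scaled n s) (scaled n t) + \<eta> * real n) ((c - gap / 2) * real n))"
    using whp_conj[OF 1 2]
  proof (rule whp_mono)
    have "eventually (\<lambda>n. 1 \<le> scaled n t) sequentially"
      using scaled_at_top[OF st(2)] unfolding filterlim_at_top by blast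
    then show "eventually (\<lambda>n. \<forall>f.
      (\<forall>r\<in>{..R}. \<bar>(\<Sum>i\<in>{1..scaled n (y r)}. real (f (i, 0))) - real n * (y r * A)\<bar> \<le> e * real n) \<and>
      (\<forall>r\<in>{..R}. lpt (translate (scaled n (y r)) 0 f) (scaled n s - scaled n (y r)) (scaled n t)
        \<le> ((s - y r) * A' + t * B' + e) * real n)
      \<longrightarrow> (\<forall>k<scaled n s. right_exit f (scaled n s) (scaled n t) k
         \<le> max (lpt f (scaled n s) (scaled n t) + \<eta> * real n) ((c - gap / 2) * real n))) sequentially"
    proof eventually_elim
      case (elim n)
      show ?case
      proof (intro allI impI, elim conjE)
        fix f :: "nat \<times> nat \<Rightarrow> nat" and k
        assume S: "\<forall>r\<in>{..R}. \<bar>(\<Sum>i\<in>{1..scaled n (y r)}. real (f (i, 0))) - real n * (y r * A)\<bar> \<le> e * real n"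
          and T: "\<forall>r\<in>{..R}. lpt (translate (scaled n (y r)) 0 f) (scaled n s - scaled n (y r)) (scaled n t)
            \<le> ((s - y r) * A' + t * B' + e) * real n"
          and k: "k < scaled n s"
        have "\<exists>r<R. scaled n (y r) \<le> k \<and> k < scaled n (y (Suc r))"
          using k R0 by (intro block_index) (auto simp: y_def)
        then obtain r where r: "r < R" "scaled n (y r) \<le> k" "k < scaled n (y (Suc r))" by blast
        have "(\<Sum>i\<in>{1..Suc k}. real (f (i, 0))) \<le> (\<Sum>i\<in>{1..scaled n (y (Suc r))}. real (f (i, 0)))"
          using r by (intro partial_sums_mono) auto
        also have "\<dots> \<le> (y (Suc r) * A + e) * real n"
          using S[rule_format, of "Suc r"] r by (simp add: abs_le_iff algebra_simps)
        also have "\<dots> \<le> (y r * A + 2 * e) * real n"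
          using yA[of r] by (intro mult_right_mono) auto
        finally have S': "(\<Sum>i\<in>{1..Suc k}. real (f (i, 0))) \<le> (y r * A + 2 * e) * real n" .
        show "right_exit f (scaled n s) (scaled n t) k
          \<le> max (lpt f (scaled n s) (scaled n t) + \<eta> * real n) ((c - gap / 2) * real n)"
        proof (cases "x0 \<le> y r")
          case True
          have "lpt (translate k 0 f) (scaled n s - k) (scaled n t)
              \<le> lpt (translate (scaled n (y r)) 0 f) (scaled n s - scaled n (y r)) (scaled n t)"
            using r k elim by (intro lpt_translate_mono) auto
          also have "\<dots> \<le> ((s - y r) * A' + t * B' + e) * real n" using T r by simp
          finally have "right_exit f (scaled n s) (scaled n t) k
              \<le> ((s - y r) * A' + t * B' + y r * A + 3 * e) * real n"
            using S' by (simp add: right_exit_def algebra_simps)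
          also have "\<dots> \<le> (c - gap / 2) * real n"
          proof (rule mult_right_mono)
            have "x0 * (A' - A) \<le> y r * (A' - A)" using True AA' by (intro mult_right_mono) auto
            moreover have "s * A' + t * B' - x0 * (A' - A) = c - gap" by (simp add: gap_def)
            moreover have "(s - y r) * A' + y r * A = s * A' - y r * (A' - A)"
              by (simp add: algebra_simps)
            ultimately show "(s - y r) * A' + t * B' + y r * A + 3 * e \<le> c - gap / 2"
              using e gap by linarith
          qed simp
          finally show ?thesis by simp
        next
          case False
          have "lpt (translate k 0 f) (scaled n s - k) (scaled n t) \<le> lpt f (scaled n s) (scaled n t)"
            using lpt_translate_mono[of 0 k "scaled n s" "scaled n t" f] k elim by simp
          moreover have "(y r * A + 2 * e) * real n \<le> \<eta> * real n"
            using False A0 e mult_right_mono[of "y r" x0 A] by (intro mult_right_mono) auto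
          ultimately show ?thesis using S' by (simp add: right_exit_def)
        qed
      qed
    qed
  qed
  then show ?thesis unfolding right_exits_controlled_def using gap by (intro exI[of _ "gap / 2"]) simp
qed

text \<open>
  The first row has ratios \<open>a i * b 1\<close>, at least those of a row with parameter \<open>b0\<close>; the averages of the
  environment are needed at \<open>1 / b0\<close> only, which does not depend on the value of \<open>b 1\<close>.
\<close>

lemma row_lower_tail:
  assumes a: "bounded_env u a" and b: "bounded_env v b" and z: "u < z" "z * v < 1"
    and b0: "0 < b0" "b0 \<le> b 1"
    and A: "cesaro (\<lambda>i. odds (a i) (1 / b0)) A" and x: "0 \<le> x" "x \<le> s" and t: "0 < t" and e: "0 < e"
  shows "whp (\<lambda>n. boundary_law a b z (scaled n s) (scaled n t)) (\<lambda>n f.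
    real n * (x * A) - e * real n \<le> (\<Sum>i\<in>{1..scaled n x}. real (f (i, 1))))"
proof -
  have u: "0 < u" and v: "0 < v" using a b bounded_env_pos by auto
  let ?q = "boundary_rate a b z"
  \<comment> \<open>For small \<open>n\<close> the rectangle may have no row at all.\<close>
  let ?L = "\<lambda>n. if 1 \<le> scaled n t then {1..scaled n x} \<times> {1 :: nat} else {}"
  have "whp (\<lambda>n. boundary_law a b z (scaled n s) (scaled n t)) (\<lambda>n f.
    \<bar>(\<Sum>p\<in>?L n. real (f p)) - (\<Sum>p\<in>?L n. ?q p / (1 - ?q p))\<bar> \<le> e / 2 * real n)"
    unfolding boundary_law_def
  proof (rule geo_field_sum_concentration[where C = x])
    show "?L n \<subseteq> {0..scaled n s} \<times> {0..scaled n t} - {(0, 0)}" for n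
      using scaled_mono[OF x(2), of n] by auto
    show "0 < ?q p \<and> ?q p \<le> Max {u * v, u / z, z * v}" if "p \<in> ?L n" for n p
      using that by (intro conjI boundary_rate_bounds[OF a b z]) (auto split: if_splits)
    show "Max {u * v, u / z, z * v} < 1"
      by (rule boundary_rate_bounds[OF a b z, of "(1, 1)"]) simp
    show "real (card (?L n)) \<le> x * real n" for n
      using scaled_le[OF x(1), of n] x by auto
  qed (use e in auto)
  then show ?thesis
  proof (rule whp_mono)
    have e2: "0 < e / 2" using e by simp
    have "eventually (\<lambda>n. 1 \<le> scaled n t) sequentially"
      using scaled_at_top[OF t] unfolding filterlim_at_top by blast
    then show "eventually (\<lambda>n. \<forall>f.
      \<bar>(\<Sum>p\<in>?L n. real (f p)) - (\<Sum>p\<in>?L n. ?q p / (1 - ?q p))\<bar> \<le> e / 2 * real n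
      \<longrightarrow> real n * (x * A) - e * real n \<le> (\<Sum>i\<in>{1..scaled n x}. real (f (i, 1)))) sequentially"
      using cesaro_scaled_close[OF A x(1) e2]
    proof eventually_elim
      case (elim n)
      have sumL: "(\<Sum>p\<in>?L n. g p) = (\<Sum>i\<in>{1..scaled n x}. g (i, 1))" for g :: "nat \<times> nat \<Rightarrow> real"
        using elim by (auto intro!: sum.reindex_bij_witness[of _ "\<lambda>i. (i, 1)" fst])
      have means: "(\<Sum>i\<in>{1..scaled n x}. odds (a i) (1 / b0)) \<le> (\<Sum>i\<in>{1..scaled n x}. ?q (i, 1) / (1 - ?q (i, 1)))"
      proof (rule sum_mono)
        fix i assume i: "i \<in> {1..scaled n x}"
        then have ai: "0 < a i" "a i \<le> u" using bounded_envD[OF a] by auto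
        have "b 1 \<le> v" using bounded_envD[OF b] by simp
        then have "a i * b 1 \<le> u * v" using ai b0 u by (intro mult_mono) auto
        also have "\<dots> < z * v" using z v by simp
        finally have lt: "a i * b 1 < 1" using z by simp
        have le: "a i * b0 \<le> a i * b 1" using ai b0 by simp
        have "odds (a i) (1 / b0) = a i * b0 / (1 - a i * b0)"
          using b0 by (simp add: odds_inverse_eq)
        also have "\<dots> \<le> a i * b 1 / (1 - a i * b 1)"
          using le lt ai b0 by (intro frac_le) auto
        finally show "odds (a i) (1 / b0) \<le> ?q (i, 1) / (1 - ?q (i, 1))"
          using i by (simp add: boundary_rate_def)
      qed
      show ?case
      proof (intro allI impI)
        fix f :: "nat \<times> nat \<Rightarrow> nat"
        assume "\<bar>(\<Sum>p\<in>?L n. real (f p)) - (\<Sum>p\<in>?L n. ?q p / (1 - ?q p))\<bar> \<le> e / 2 * real n"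
        moreover have "e / 2 * real n = e * real n / 2" by simp
        moreover note sumL[of "\<lambda>p. real (f p)"] sumL[of "\<lambda>p. ?q p / (1 - ?q p)"]
        ultimately show "real n * (x * A) - e * real n \<le> (\<Sum>i\<in>{1..scaled n x}. real (f (i, 1)))"
          using elim(2) means unfolding abs_le_iff by linarith
      qed
    qed
  qed
qed

text \<open>
  A path on the axis up to column \<open>k + 1\<close> is replaced by one on the first row up to column \<open>k\<close>, which
  is a path of the original model.  This loses at most \<open>s * (A - A') * n\<close> up to a small error, wherever the
  exit takes place, so the first alternative of \<open>right_exits_controlled\<close> always occurs.  The blocks serve the same purpose as
  in the comparison with another parameter.
\<close>

lemma right_exits_controlled_by_row:
  assumes a: "bounded_env u a" and b: "bounded_env v b"
    and z: "u < z" "z * v < 1" and b0: "0 < b0" "b0 \<le> b 1"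
    and A: "cesaro (\<lambda>i. odds (a i) z) A" and A': "cesaro (\<lambda>i. odds (a i) (1 / b0)) A'"
    and st: "0 < s" "0 < t" and A0: "0 \<le> A" and AA': "A' \<le> A" and \<eta>: "s * (A - A') < \<eta>"
  shows "right_exits_controlled a b z s t c \<eta>"
proof -
  define e where "e = (\<eta> - s * (A - A')) / 4"
  have "0 < e" "4 * e = \<eta> - s * (A - A')" using \<eta> by (simp_all add: e_def)
  then have e: "0 < e" "s * (A - A') + 4 * e = \<eta>" by linarith+
  obtain R :: nat where R: "s * A / e < real R" using reals_Archimedean2 by blast
  moreover have "0 \<le> s * A / e" using st A0 e by simp
  ultimately have R0: "0 < R" by (metis of_nat_0_less_iff order_le_less_trans)
  define y where "y r = real r * s / real R" for r
  have y: "0 \<le> y r" "r \<le> R \<Longrightarrow> y r \<le> s" for r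
    using st R0 by (auto simp: y_def divide_simps)
  have yA: "y (Suc r) * A \<le> y r * A + e" for r
  proof -
    have "y (Suc r) * A = y r * A + s * A / real R" using R0 by (simp add: y_def field_simps)
    moreover have "s * A / real R \<le> e" using R R0 e by (simp add: field_simps)
    ultimately show ?thesis by simp
  qed
  let ?P = "\<lambda>n. boundary_law a b z (scaled n s) (scaled n t)"
  have 1: "whp ?P (\<lambda>n f. \<forall>r\<in>{..R}.
    \<bar>(\<Sum>i\<in>{1..scaled n (y r)}. real (f (i, 0))) - real n * (y r * A)\<bar> \<le> e * real n)"
    using y e by (intro whp_ball boundary_sum_concentration[OF a b z A]) auto
  have 2: "whp ?P (\<lambda>n f. \<forall>r\<in>{..R}.
    real n * (y r * A') - e * real n \<le> (\<Sum>i\<in>{1..scaled n (y r)}. real (f (i, 1))))"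
    using y e st by (intro whp_ball row_lower_tail[OF a b z b0 A']) auto
  have "whp ?P (\<lambda>n f. \<forall>k<scaled n s. right_exit f (scaled n s) (scaled n t) k
         \<le> max (lpt f (scaled n s) (scaled n t) + \<eta> * real n) ((c - 1) * real n))"
    using whp_conj[OF 1 2]
  proof (rule whp_mono)
    have "eventually (\<lambda>n. 1 \<le> scaled n t) sequentially"
      using scaled_at_top[OF st(2)] unfolding filterlim_at_top by blast
    then show "eventually (\<lambda>n. \<forall>f.
      (\<forall>r\<in>{..R}. \<bar>(\<Sum>i\<in>{1..scaled n (y r)}. real (f (i, 0))) - real n * (y r * A)\<bar> \<le> e * real n) \<and>
      (\<forall>r\<in>{..R}. real n * (y r * A') - e * real n \<le> (\<Sum>i\<in>{1..scaled n (y r)}. real (f (i, 1))))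
      \<longrightarrow> (\<forall>k<scaled n s. right_exit f (scaled n s) (scaled n t) k
         \<le> max (lpt f (scaled n s) (scaled n t) + \<eta> * real n) ((c - 1) * real n))) sequentially"
    proof eventually_elim
      case (elim n)
      show ?case
      proof (intro allI impI, elim conjE)
        fix f :: "nat \<times> nat \<Rightarrow> nat" and k
        assume S: "\<forall>r\<in>{..R}. \<bar>(\<Sum>i\<in>{1..scaled n (y r)}. real (f (i, 0))) - real n * (y r * A)\<bar> \<le> e * real n"
          and T: "\<forall>r\<in>{..R}. real n * (y r * A') - e * real n \<le> (\<Sum>i\<in>{1..scaled n (y r)}. real (f (i, 1)))"
          and k: "k < scaled n s"
        have "\<exists>r<R. scaled n (y r) \<le> k \<and> k < scaled n (y (Suc r))"
          using k R0 by (intro block_index) (auto simp: y_def)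
        then obtain r where r: "r < R" "scaled n (y r) \<le> k" "k < scaled n (y (Suc r))" by blast
        have "(\<Sum>i\<in>{1..Suc k}. real (f (i, 0))) \<le> (\<Sum>i\<in>{1..scaled n (y (Suc r))}. real (f (i, 0)))"
          using r by (intro partial_sums_mono) auto
        also have "\<dots> \<le> (y (Suc r) * A + e) * real n"
          using S[rule_format, of "Suc r"] r by (simp add: abs_le_iff algebra_simps)
        also have "\<dots> \<le> (y r * A + 2 * e) * real n"
          using yA[of r] by (intro mult_right_mono) auto
        finally have S': "(\<Sum>i\<in>{1..Suc k}. real (f (i, 0))) \<le> (y r * A + 2 * e) * real n" .
        have "real n * (y r * A') - e * real n \<le> (\<Sum>i\<in>{1..scaled n (y r)}. real (f (i, 1)))"
          using T r by simp
        also have "\<dots> \<le> (\<Sum>i\<in>{1..k}. real (f (i, 1)))" using r by (intro partial_sums_mono) auto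
        finally have "right_exit f (scaled n s) (scaled n t) k
            \<le> lpt f (scaled n s) (scaled n t) + (y r * (A - A') + 3 * e) * real n"
          using row_path_translate_le_lpt[OF elim, of f k "scaled n s - k"] k S'
          by (simp add: right_exit_def algebra_simps)
        also have "(y r * (A - A') + 3 * e) * real n \<le> \<eta> * real n"
          using e y(2)[of r] r AA' mult_right_mono[of "y r" s "A - A'"] by (intro mult_right_mono) auto
        finally show "right_exit f (scaled n s) (scaled n t) k
          \<le> max (lpt f (scaled n s) (scaled n t) + \<eta> * real n) ((c - 1) * real n)"
          by simp
      qed
    qed
  qed
  then show ?thesis unfolding right_exits_controlled_def by (intro exI[of _ 1]) simp
qed

lemma right_exit_transpose:
  "right_exit (f \<circ> prod.swap) n m l = (\<Sum>j\<in>{1..Suc l}. real (f (0, j))) + lpt (translate 0 l f) m (n - l)"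
proof -
  have "translate l 0 (f \<circ> prod.swap) = translate 0 l f \<circ> prod.swap"
    by (auto simp: translate_def fun_eq_iff)
  then show ?thesis by (simp add: right_exit_def lpt_transpose)
qed

text \<open>
  Since the larger model grows at rate \<open>s * A + t * B\<close>, its optimal path can only use an exit of the
  first kind allowed by \<open>right_exits_controlled\<close>, on whichever axis.
\<close>

lemma lpt_linear_lower_bound:
  assumes a: "bounded_env u a" and b: "bounded_env v b" and z: "u < z" "z * v < 1"
    and A: "cesaro (\<lambda>i. odds (a i) z) A" and B: "cesaro (\<lambda>j. odds (b j) (1 / z)) B"
    and st: "0 < s" "0 < t" and \<eta>: "0 < \<eta>"
    and right: "right_exits_controlled a b z s t (s * A + t * B) \<eta>"
    and up: "right_exits_controlled b a (1 / z) t s (s * A + t * B) \<eta>"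
  shows "whp (\<lambda>n. bulk_law a b (scaled n s) (scaled n t)) (\<lambda>n f.
    (s * A + t * B - 2 * \<eta>) * real n \<le> lpt f (scaled n s) (scaled n t))"
proof -
  let ?c = "s * A + t * B"
  let ?P = "\<lambda>n. boundary_law a b z (scaled n s) (scaled n t)"
  have z0: "0 < z" using z bounded_env_pos[OF a] by simp
  obtain \<gamma>1 where \<gamma>1: "0 < \<gamma>1" and R: "whp ?P (\<lambda>n f. \<forall>k<scaled n s.
       right_exit f (scaled n s) (scaled n t) k
         \<le> max (lpt f (scaled n s) (scaled n t) + \<eta> * real n) ((?c - \<gamma>1) * real n))"
    using right unfolding right_exits_controlled_def by blast
  obtain \<gamma>2 where \<gamma>2: "0 < \<gamma>2" and "whp (\<lambda>n. boundary_law b a (1 / z) (scaled n t) (scaled n s))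
    (\<lambda>n f. \<forall>k<scaled n t. right_exit f (scaled n t) (scaled n s) k
         \<le> max (lpt f (scaled n t) (scaled n s) + \<eta> * real n) ((?c - \<gamma>2) * real n))"
    using up unfolding right_exits_controlled_def by blast
  then have U: "whp ?P (\<lambda>n f. \<forall>k<scaled n t. right_exit (f \<circ> prod.swap) (scaled n t) (scaled n s) k
         \<le> max (lpt f (scaled n s) (scaled n t) + \<eta> * real n) ((?c - \<gamma>2) * real n))"
    by (simp only: boundary_law_transpose[OF z0, symmetric] whp_map lpt_transpose)
  define e where "e = min \<eta> (min \<gamma>1 \<gamma>2) / 4"
  have e: "0 < e" "4 * e \<le> \<eta>" "4 * e \<le> \<gamma>1" "4 * e \<le> \<gamma>2" using \<eta> \<gamma>1 \<gamma>2 by (auto simp: e_def)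
  have H: "whp ?P (\<lambda>n f. \<bar>real (blp f (scaled n s) (scaled n t))
      - ((\<Sum>i\<in>{1..scaled n s}. odds (a i) z) + (\<Sum>j\<in>{1..scaled n t}. odds (b j) (1 / z)))\<bar> \<le> e * real n)"
  proof (rule blp_concentration[where u = u and v = v and C = "max s t"])
    show "real (scaled n s) \<le> max s t * real n" "real (scaled n t) \<le> max s t * real n" for n
      using scaled_le[of s n] scaled_le[of t n] st mult_right_mono[of s "max s t" "real n"]
        mult_right_mono[of t "max s t" "real n"] by auto
  qed (use a b z e in auto)
  have "whp ?P (\<lambda>n f. (?c - 2 * \<eta>) * real n \<le> lpt f (scaled n s) (scaled n t))"
    using whp_conj[OF H whp_conj[OF R U]]
  proof (rule whp_mono)
    have "eventually (\<lambda>n. 1 \<le> scaled n s) sequentially" "eventually (\<lambda>n. 1 \<le> scaled n t) sequentially"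
      using scaled_at_top[OF st(1)] scaled_at_top[OF st(2)] unfolding filterlim_at_top by blast+
    then show "eventually (\<lambda>n. \<forall>f. \<bar>real (blp f (scaled n s) (scaled n t))
        - ((\<Sum>i\<in>{1..scaled n s}. odds (a i) z) + (\<Sum>j\<in>{1..scaled n t}. odds (b j) (1 / z)))\<bar> \<le> e * real n \<and>
      (\<forall>k<scaled n s. right_exit f (scaled n s) (scaled n t) k
         \<le> max (lpt f (scaled n s) (scaled n t) + \<eta> * real n) ((?c - \<gamma>1) * real n)) \<and>
      (\<forall>k<scaled n t. right_exit (f \<circ> prod.swap) (scaled n t) (scaled n s) k
         \<le> max (lpt f (scaled n s) (scaled n t) + \<eta> * real n) ((?c - \<gamma>2) * real n))
      \<longrightarrow> (?c - 2 * \<eta>) * real n \<le> lpt f (scaled n s) (scaled n t)) sequentially"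
      using cesaro_scaled_close[OF A less_imp_le[OF st(1)] e(1)]
        cesaro_scaled_close[OF B less_imp_le[OF st(2)] e(1)] eventually_gt_at_top[of 0]
    proof eventually_elim
      case (elim n)
      show ?case
      proof (intro allI impI, elim conjE)
        fix f :: "nat \<times> nat \<Rightarrow> nat"
        let ?l = "lpt f (scaled n s) (scaled n t)" and ?h = "real (blp f (scaled n s) (scaled n t))"
        assume H: "\<bar>?h - ((\<Sum>i\<in>{1..scaled n s}. odds (a i) z) + (\<Sum>j\<in>{1..scaled n t}. odds (b j) (1 / z)))\<bar>
            \<le> e * real n"
          and R: "\<forall>k<scaled n s. right_exit f (scaled n s) (scaled n t) k
             \<le> max (?l + \<eta> * real n) ((?c - \<gamma>1) * real n)"
          and U: "\<forall>k<scaled n t. right_exit (f \<circ> prod.swap) (scaled n t) (scaled n s) k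
             \<le> max (?l + \<eta> * real n) ((?c - \<gamma>2) * real n)"
        have h: "(?c - 3 * e) * real n \<le> ?h"
          using H elim by (simp add: abs_le_iff algebra_simps)
        have "(\<exists>k<scaled n s. ?h \<le> right_exit f (scaled n s) (scaled n t) k)
            \<or> (\<exists>l<scaled n t. ?h \<le> right_exit (f \<circ> prod.swap) (scaled n t) (scaled n s) l)"
          using blp_exit_bound[OF elim(1,2), of f] by (simp only: right_exit_transpose right_exit_def[of f])
        then have "?h \<le> max (?l + \<eta> * real n) ((?c - \<gamma>1) * real n)
            \<or> ?h \<le> max (?l + \<eta> * real n) ((?c - \<gamma>2) * real n)"
          using R U by (meson order_trans)
        moreover have "(?c - \<gamma>1) * real n < (?c - 3 * e) * real n"
          "(?c - \<gamma>2) * real n < (?c - 3 * e) * real n"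
          using e elim by (auto intro!: mult_strict_right_mono)
        ultimately have "(?c - 3 * e) * real n \<le> ?l + \<eta> * real n" using h by auto
        moreover have "3 * e * real n \<le> \<eta> * real n" using e by (intro mult_right_mono) auto
        ultimately show "(?c - 2 * \<eta>) * real n \<le> ?l" by (simp add: algebra_simps)
      qed
    qed
  qed
  then show ?thesis
    unfolding bulk_of_boundary_law[where z = z, symmetric] whp_map lpt_bulk .
qed

section \<open>Ergodic averages\<close>

text \<open>
  Birkhoff's theorem for an ergodic map and a bounded function, by a short route that the
  ergodicity makes possible.  If \<open>f\<close> has negative mean, the set on which the partial sums along
  the orbit are unbounded from above is invariant.  Were it of full measure, the running maxima \<open>peak f n\<close> of these
  sums would satisfy \<open>peak f (Suc n) x - peak f n (T x) \<longlonglongrightarrow> f x\<close>, although the integrals of the left sides are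
  nonnegative by invariance.
\<close>

context
  fixes M :: "'x measure" and T :: "'x \<Rightarrow> 'x"
  assumes M: "prob_space M" and erg: "ergodic_map M T"
begin

interpretation prob_space M by (rule M)

lemma T_measurable: "T \<in> measurable M M"
  using erg by (simp add: ergodic_map_def)

lemma funpow_T_measurable: "(T ^^ i) \<in> measurable M M"
proof (induction i)
  case (Suc i)
  then show ?case using measurable_comp[OF Suc T_measurable] by (simp add: o_def)
qed (simp add: id_def)

lemma integral_T: "f \<in> borel_measurable M \<Longrightarrow> (\<integral>x. f (T x) \<partial>M) = (\<integral>x. f x \<partial>M)" for f :: "'x \<Rightarrow> real"
  using erg integral_distr[OF T_measurable, of f] by (simp add: ergodic_map_def)

text \<open>
  The maximum of the partial sums of length at most \<open>n\<close> along the orbit of \<open>x\<close>, including the empty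
  one.
\<close>

fun peak :: "('x \<Rightarrow> real) \<Rightarrow> nat \<Rightarrow> 'x \<Rightarrow> real" where
  "peak f 0 x = 0"
| "peak f (Suc n) x = max 0 (f x + peak f n (T x))"

lemma peak_nonneg: "0 \<le> peak f n x"
  by (cases n) auto

lemma peak_measurable: "f \<in> borel_measurable M \<Longrightarrow> peak f n \<in> borel_measurable M"
proof (induction n)
  case 0
  then show ?case by (simp add: peak.simps[abs_def])
next
  case (Suc n)
  then have [measurable]: "f \<in> borel_measurable M" "peak f n \<in> borel_measurable M" by auto
  note T_measurable [measurable]
  show ?case by (simp add: peak.simps[abs_def])
qed

lemma peak_le: "(\<And>x. \<bar>f x\<bar> \<le> K) \<Longrightarrow> peak f n x \<le> real n * K"
proof (induction n arbitrary: x)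
  case (Suc n)
  have "0 \<le> K" using Suc.prems[of x] by linarith
  moreover have "f x \<le> K" using Suc.prems[of x] by linarith
  moreover have "peak f n (T x) \<le> real n * K" using Suc by simp
  moreover have "0 \<le> real n * K" using \<open>0 \<le> K\<close> by simp
  ultimately show ?case by (simp add: algebra_simps)
qed simp

lemma peak_mono: "peak f n x \<le> peak f (Suc n) x"
proof (induction n arbitrary: x)
  case (Suc n)
  have "peak f n (T x) \<le> peak f (Suc n) (T x)" by (rule Suc)
  then show ?case by (simp add: max.coboundedI2)
qed simp

lemma sum_orbit_Suc: "(\<Sum>i<Suc n. f ((T ^^ i) x)) = f x + (\<Sum>i<n. f ((T ^^ i) (T x)))" for f :: "'x \<Rightarrow> real"
  by (simp add: sum.lessThan_Suc_shift funpow_swap1 del: sum.lessThan_Suc)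

lemma orbit_sum_le_peak: "(\<Sum>i<n. f ((T ^^ i) x)) \<le> peak f n x"
proof (induction n arbitrary: x)
  case (Suc n)
  show ?case unfolding sum_orbit_Suc using Suc[of "T x"] by (simp add: le_max_iff_disj)
qed simp

lemma bdd_above_orbit_sums_iff:
  "bdd_above (range (\<lambda>n. \<Sum>i<n. f ((T ^^ i) (T x)))) \<longleftrightarrow> bdd_above (range (\<lambda>n. \<Sum>i<n. f ((T ^^ i) x)))"
  for f :: "'x \<Rightarrow> real"
proof
  assume "bdd_above (range (\<lambda>n. \<Sum>i<n. f ((T ^^ i) (T x))))"
  then obtain C where C: "\<And>n. (\<Sum>i<n. f ((T ^^ i) (T x))) \<le> C" by (auto simp: bdd_above_def)
  have "(\<Sum>i<n. f ((T ^^ i) x)) \<le> max 0 (f x + C)" for n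
    using C by (cases n) (auto simp: sum_orbit_Suc le_max_iff_disj simp del: sum.lessThan_Suc)
  then show "bdd_above (range (\<lambda>n. \<Sum>i<n. f ((T ^^ i) x)))" by (auto simp: bdd_above_def)
next
  assume "bdd_above (range (\<lambda>n. \<Sum>i<n. f ((T ^^ i) x)))"
  then obtain C where C: "\<And>n. (\<Sum>i<n. f ((T ^^ i) x)) \<le> C" by (auto simp: bdd_above_def)
  have "(\<Sum>i<n. f ((T ^^ i) (T x))) \<le> C - f x" for n
    using C[of "Suc n"] by (simp add: sum_orbit_Suc del: sum.lessThan_Suc)
  then show "bdd_above (range (\<lambda>n. \<Sum>i<n. f ((T ^^ i) (T x))))" by (auto simp: bdd_above_def)
qed

lemma orbit_sums_bdd_above:
  fixes f :: "'x \<Rightarrow> real"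
  assumes f [measurable]: "f \<in> borel_measurable M" and K: "\<And>x. \<bar>f x\<bar> \<le> K"
    and neg: "(\<integral>x. f x \<partial>M) < 0"
  shows "AE x in M. bdd_above (range (\<lambda>n. \<Sum>i<n. f ((T ^^ i) x)))"
proof -
  note T_measurable [measurable] funpow_T_measurable [measurable]
  let ?S = "\<lambda>n x. (\<Sum>i<n. f ((T ^^ i) x)) :: real"
  define A where "A = {x \<in> space M. \<not> bdd_above (range (\<lambda>n. ?S n x))}"
  have cofinal: "bdd_above (range (\<lambda>n. ?S n x)) \<longleftrightarrow> (\<exists>C::nat. \<forall>n. ?S n x \<le> real C)" for x
  proof
    assume "bdd_above (range (\<lambda>n. ?S n x))"
    then obtain C where C: "\<And>n. ?S n x \<le> C" by (auto simp: bdd_above_def)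
    obtain C' :: nat where "C \<le> real C'" using real_arch_simple by blast
    with C show "\<exists>C::nat. \<forall>n. ?S n x \<le> real C" by (meson order_trans)
  qed (auto simp: bdd_above_def)
  have A_eq: "A = space M - {x \<in> space M. \<exists>C::nat. \<forall>n. ?S n x \<le> real C}"
    unfolding A_def cofinal by auto
  have "{x \<in> space M. \<exists>C::nat. \<forall>n. ?S n x \<le> real C} \<in> sets M" by measurable
  then have A: "A \<in> sets M" unfolding A_eq by (rule sets.compl_sets)
  have "T -` A \<inter> space M = A"
    using measurable_space[OF T_measurable] by (auto simp: A_def bdd_above_orbit_sums_iff)
  then have "emeasure M A = 0 \<or> emeasure M (space M - A) = 0"
    using erg A by (simp add: ergodic_map_def)
  moreover have False if "emeasure M (space M - A) = 0"
  proof -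
    have AE_A: "AE x in M. x \<in> A"
      using that A by (intro AE_I[of _ _ "space M - A"]) auto
    have pm [measurable]: "peak f n \<in> borel_measurable M" for n by (rule peak_measurable[OF f])
    have pint: "integrable M (peak f n)" for n
      using peak_le[OF K] peak_nonneg[of f n]
      by (intro integrable_const_bound[where B = "real n * K"]) auto
    have pintT: "integrable M (\<lambda>x. peak f n (T x))" for n
      using peak_le[OF K] peak_nonneg[of f n]
      by (intro integrable_const_bound[where B = "real n * K"]) auto
    let ?d = "\<lambda>n x. peak f (Suc n) x - peak f n (T x)"
    \<comment> \<open>Once the running maximum along the orbit of \<open>T x\<close> exceeds \<open>K\<close>, the first argument of this
      maximum is below \<open>f x\<close>.\<close>
    have d_eq: "?d n x = max (- peak f n (T x)) (f x)" for n x by (simp add: max_def)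
    have "(\<lambda>n. \<integral>x. ?d n x \<partial>M) \<longlonglongrightarrow> (\<integral>x. f x \<partial>M)"
    proof (rule integral_dominated_convergence[where w = "\<lambda>_. K"])
      show "AE x in M. (\<lambda>n. ?d n x) \<longlonglongrightarrow> f x"
        using AE_A
      proof eventually_elim
        case (elim x)
        then have "\<not> bdd_above (range (\<lambda>n. ?S n (T x)))" by (simp add: A_def bdd_above_orbit_sums_iff)
        then obtain N where N: "K < ?S N (T x)" by (auto simp: bdd_above_def not_le)
        have "K \<le> peak f n (T x)" if "N \<le> n" for n
        proof -
          have "peak f N (T x) \<le> peak f n (T x)"
            using that by (rule lift_Suc_mono_le[of "\<lambda>n. peak f n (T x)", OF peak_mono])
          with N orbit_sum_le_peak[where n = N and f = f and x = "T x"] show ?thesis by linarith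
        qed
        then have "eventually (\<lambda>n. f x = ?d n x) sequentially"
          using K[of x] unfolding d_eq
          by (intro eventually_sequentiallyI[of N]) (smt (verit))
        then show ?case by (intro tendsto_eventually) (auto elim: eventually_mono)
      qed
      show "AE x in M. norm (?d n x) \<le> K" for n
      proof (rule AE_I2)
        fix x
        show "norm (?d n x) \<le> K"
          unfolding d_eq using K[of x] peak_nonneg[of f n "T x"] by (auto simp: max_def abs_le_iff)
      qed
    qed auto
    moreover have "0 \<le> (\<integral>x. ?d n x \<partial>M)" for n
    proof -
      have "(\<integral>x. ?d n x \<partial>M) = (\<integral>x. peak f (Suc n) x \<partial>M) - (\<integral>x. peak f n x \<partial>M)"
        using integral_T[OF pm[of n]] pint pintT by (subst Bochner_Integration.integral_diff) auto
      also have "\<dots> \<ge> 0"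
        using integral_mono[OF pint pint peak_mono, of n] by simp
      finally show ?thesis .
    qed
    ultimately have "0 \<le> (\<integral>x. f x \<partial>M)" by (intro LIMSEQ_le_const) auto
    with neg show False by simp
  qed
  ultimately have "emeasure M A = 0" by blast
  then show ?thesis using A by (intro AE_I[of _ _ A]) (auto simp: A_def)
qed

lemma orbit_averages_upper:
  fixes f :: "'x \<Rightarrow> real"
  assumes f [measurable]: "f \<in> borel_measurable M" and K: "\<And>x. \<bar>f x\<bar> \<le> K" and e: "0 < e"
  shows "AE x in M. \<exists>C. \<forall>n. (\<Sum>i<n. f ((T ^^ i) x)) \<le> real n * ((\<integral>x. f x \<partial>M) + e) + C"
proof -
  let ?c = "(\<integral>x. f x \<partial>M) + e"
  have int: "integrable M f" using K by (intro integrable_const_bound[where B = K]) auto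
  have "AE x in M. bdd_above (range (\<lambda>n. \<Sum>i<n. (\<lambda>x. f x - ?c) ((T ^^ i) x)))"
  proof (rule orbit_sums_bdd_above)
    show "\<bar>f x - ?c\<bar> \<le> K + \<bar>?c\<bar>" for x using K[of x] by linarith
    show "(\<integral>x. f x - ?c \<partial>M) < 0" using int e by (simp add: prob_space)
  qed auto
  then show ?thesis
  proof eventually_elim
    case (elim x)
    then obtain C where "\<And>n. (\<Sum>i<n. f ((T ^^ i) x) - ?c) \<le> C" by (auto simp: bdd_above_def)
    then show ?case by (intro exI[of _ C]) (simp add: sum_subtractf algebra_simps)
  qed
qed

theorem ergodic_averages_converge:
  fixes f :: "'x \<Rightarrow> real"
  assumes f [measurable]: "f \<in> borel_measurable M" and K: "\<And>x. \<bar>f x\<bar> \<le> K"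
  shows "AE x in M. (\<lambda>n. (\<Sum>i<n. f ((T ^^ i) x)) / real n) \<longlonglongrightarrow> (\<integral>x. f x \<partial>M)"
proof -
  let ?I = "\<integral>x. f x \<partial>M"
  have "AE x in M. \<forall>m::nat. (\<exists>C. \<forall>n. (\<Sum>i<n. f ((T ^^ i) x)) \<le> real n * (?I + 1 / real (Suc m)) + C)
      \<and> (\<exists>C. \<forall>n. (\<Sum>i<n. - f ((T ^^ i) x)) \<le> real n * (- ?I + 1 / real (Suc m)) + C)"
    using orbit_averages_upper[OF f K] orbit_averages_upper[of "\<lambda>x. - f x" K] K
    by (simp add: AE_all_countable)
  then show ?thesis
  proof eventually_elim
    case (elim x)
    let ?S = "\<lambda>n. \<Sum>i<n. f ((T ^^ i) x)"
    show ?case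
    proof (rule LIMSEQ_I)
      fix r :: real assume r: "0 < r"
      then obtain m :: nat where m: "1 / real (Suc m) < r / 2"
        using reals_Archimedean[of "r / 2"] by (auto simp: inverse_eq_divide)
      from elim[rule_format, of m] obtain C1 C2
        where C1: "\<And>n. ?S n \<le> real n * (?I + 1 / real (Suc m)) + C1"
          and C2: "\<And>n. - ?S n \<le> real n * (- ?I + 1 / real (Suc m)) + C2"
        by (auto simp: sum_negf)
      define C where "C = max 0 (max C1 C2)"
      have bound: "\<bar>?S n - real n * ?I\<bar> \<le> real n * (1 / real (Suc m)) + C" for n
      proof -
        have "C1 \<le> C" "C2 \<le> C" by (auto simp: C_def)
        moreover have "\<bar>y - p\<bar> \<le> q + c" if "y \<le> p + q + c1" "- y \<le> - p + q + c2" "c1 \<le> c" "c2 \<le> c"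
          for y p q c c1 c2 :: real using that by linarith
        ultimately show ?thesis using C1[of n] C2[of n] by (simp only: distrib_left mult_minus_right)
      qed
      obtain N :: nat where N: "2 * C / r < real N" using reals_Archimedean2 by blast
      have "norm (?S n / real n - ?I) < r" if n: "Suc N \<le> n" for n
      proof -
        have n0: "0 < real n" using n by simp
        have "C / real n < r / 2"
        proof -
          have "2 * C / r < real n" using N n by linarith
          then show ?thesis using n0 r by (simp add: field_simps)
        qed
        have "norm (?S n / real n - ?I) = \<bar>?S n - real n * ?I\<bar> / real n"
        proof -
          have "?S n / real n - ?I = (?S n - real n * ?I) / real n" using n0 by (simp add: diff_divide_distrib)
          then show ?thesis by (simp add: abs_divide)
        qed
        also have "\<dots> \<le> (real n * (1 / real (Suc m)) + C) / real n"
          using bound by (intro divide_right_mono) auto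
        also have "\<dots> = 1 / real (Suc m) + C / real n" using n0 by (simp add: add_divide_distrib)
        also have "\<dots> < r" using m \<open>C / real n < r / 2\<close> by linarith
        finally show ?thesis .
      qed
      then show "\<exists>N. \<forall>n\<ge>N. norm (?S n / real n - ?I) < r" by blast
    qed
  qed
qed

end

section \<open>The quenched law on finite rectangles\<close>

lemma measurable_last_passage_PiM:
  assumes "{1..m} \<times> {1..n} \<subseteq> K"
  shows "(\<lambda>W. last_passage W m n) \<in> borel_measurable (PiM K (\<lambda>_. borel))"
  using assms
proof (induction m arbitrary: n)
  case (Suc m)
  note IH = Suc.IH
  from Suc.prems show ?case
  proof (induction n)
    case (Suc n)
    have [measurable]: "(\<lambda>W. last_passage W m (Suc n)) \<in> borel_measurable (PiM K (\<lambda>_. borel))"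
      by (rule IH) (use Suc.prems in auto)
    have "{1..Suc m} \<times> {1..n} \<subseteq> K" using Suc.prems by auto
    from Suc.IH[OF this] have [measurable]: "(\<lambda>W. last_passage W (Suc m) n) \<in> borel_measurable (PiM K (\<lambda>_. borel))" .
    have "(Suc m, Suc n) \<in> K" using Suc.prems by auto
    then have [measurable]: "(\<lambda>W. W (Suc m, Suc n)) \<in> borel_measurable (PiM K (\<lambda>_. borel))"
      by (rule measurable_component_singleton)
    show ?case by simp
  qed simp
qed simp

lemma PiM_geometric_law:
  assumes K: "finite K"
  shows "PiM K (\<lambda>p. geometric_law (q p))
    = distr (measure_pmf (geo_field K q)) (PiM K (\<lambda>_. borel)) (\<lambda>f. \<lambda>p\<in>K. real (f p))"
proof (rule product_sigma_finite.PiM_eqI[symmetric])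
  show "product_sigma_finite (\<lambda>p. geometric_law (q p))"
    by (simp add: product_sigma_finite_def prob_space_imp_sigma_finite)
  show "sets (distr (measure_pmf (geo_field K q)) (PiM K (\<lambda>_. borel)) (\<lambda>f. \<lambda>p\<in>K. real (f p)))
    = sets (PiM K (\<lambda>p. geometric_law (q p)))"
    unfolding sets_distr by (rule sets_PiM_cong[OF refl]) (simp only: sets_geometric_law)
  fix A assume A: "\<And>p. p \<in> K \<Longrightarrow> A p \<in> sets (geometric_law (q p))"
  then have A': "\<And>p. p \<in> K \<Longrightarrow> A p \<in> sets borel" by (simp only: sets_geometric_law)
  have PiE_A: "Pi\<^sub>E K A \<in> sets (PiM K (\<lambda>_. borel))"
    by (rule sets_PiM_I_finite[OF K A'])
  have "emeasure (distr (measure_pmf (geo_field K q)) (PiM K (\<lambda>_. borel)) (\<lambda>f. \<lambda>p\<in>K. real (f p))) (Pi\<^sub>E K A)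
      = emeasure (measure_pmf (geo_field K q))
          ((\<lambda>f. \<lambda>p\<in>K. real (f p)) -` Pi\<^sub>E K A \<inter> space (measure_pmf (geo_field K q)))"
    by (rule emeasure_distr[OF _ PiE_A]) (simp add: space_PiM)
  also have "(\<lambda>f. \<lambda>p\<in>K. real (f p)) -` Pi\<^sub>E K A \<inter> space (measure_pmf (geo_field K q))
      = Pi K (\<lambda>p. real -` A p)"
    by (auto simp: PiE_iff Pi_iff)
  also have "emeasure (measure_pmf (geo_field K q)) (Pi K (\<lambda>p. real -` A p))
      = (\<Prod>p\<in>K. emeasure (measure_pmf (geometric_pmf (1 - q p))) (real -` A p))"
    using K by (simp add: measure_pmf.emeasure_eq_measure geo_field_def measure_Pi_pmf_Pi prod_ennreal)
  also have "\<dots> = (\<Prod>p\<in>K. emeasure (geometric_law (q p)) (A p))"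
  proof (rule prod.cong[OF refl])
    fix p assume "p \<in> K"
    then have "A p \<in> sets borel" by (rule A')
    then show "emeasure (measure_pmf (geometric_pmf (1 - q p))) (real -` A p) = emeasure (geometric_law (q p)) (A p)"
      unfolding geometric_law_def by (subst emeasure_distr) simp_all
  qed
  finally show "emeasure (distr (measure_pmf (geo_field K q)) (PiM K (\<lambda>_. borel)) (\<lambda>f. \<lambda>p\<in>K. real (f p)))
    (Pi\<^sub>E K A) = (\<Prod>p\<in>K. emeasure (geometric_law (q p)) (A p))" .
qed (use K in auto)

lemma sets_quenched_law: "sets (quenched_law e) = sets weight_space"
  by (auto simp: quenched_law_def weight_space_def split: prod.splits intro!: sets_PiM_cong)

lemma prob_space_quenched_law: "prob_space (quenched_law e)"
  by (auto simp: quenched_law_def split: prod.splits intro!: prob_space_PiM)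

lemma quenched_last_passage_law:
  "distr (quenched_law (a, b)) borel (\<lambda>W. last_passage W m n)
    = distr (measure_pmf (bulk_law a b m n)) borel (\<lambda>f. lpt f m n)"
proof -
  let ?I = "{1..} \<times> {1..} :: (nat \<times> nat) set" and ?K = "{1..m} \<times> {1..n}"
  let ?q = "\<lambda>(i, j). a i * b j" and ?B = "PiM ?K (\<lambda>_. borel :: real measure)"
  let ?M = "\<lambda>p. geometric_law (?q p)"
  have Q: "quenched_law (a, b) = PiM ?I ?M" by (simp add: quenched_law_def case_prod_beta')
  have setsM: "sets (PiM ?K ?M) = sets ?B" by (intro sets_PiM_cong) auto
  have lp: "(\<lambda>W. last_passage W m n) \<in> borel_measurable ?B"
    by (rule measurable_last_passage_PiM) simp
  then have lp': "(\<lambda>W. last_passage W m n) \<in> borel_measurable (PiM ?K ?M)"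
    by (simp add: measurable_cong_sets[OF setsM refl])
  have restr: "(\<lambda>W. restrict W ?K) \<in> measurable (PiM ?I ?M) (PiM ?K ?M)"
    by (rule measurable_restrict_subset) auto
  have "distr (PiM ?I ?M) borel (\<lambda>W. last_passage W m n)
      = distr (PiM ?I ?M) borel ((\<lambda>W. last_passage W m n) \<circ> (\<lambda>W. restrict W ?K))"
    by (intro distr_cong refl) (auto intro!: last_passage_cong)
  also have "\<dots> = distr (distr (PiM ?I ?M) (PiM ?K ?M) (\<lambda>W. restrict W ?K)) borel (\<lambda>W. last_passage W m n)"
    by (rule distr_distr[OF lp' restr, symmetric])
  also have "distr (PiM ?I ?M) (PiM ?K ?M) (\<lambda>W. restrict W ?K) = PiM ?K ?M"
    by (rule product_prob_space.distr_PiM_restrict_finite) (auto intro!: product_prob_spaceI)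
  also have "PiM ?K ?M = distr (measure_pmf (bulk_law a b m n)) ?B (\<lambda>f. \<lambda>p\<in>?K. real (f p))"
    unfolding bulk_law_def by (rule PiM_geometric_law) simp
  also have "distr \<dots> borel (\<lambda>W. last_passage W m n)
      = distr (measure_pmf (bulk_law a b m n)) borel ((\<lambda>W. last_passage W m n) \<circ> (\<lambda>f. \<lambda>p\<in>?K. real (f p)))"
    by (intro distr_distr lp) (simp add: space_PiM)
  also have "\<dots> = distr (measure_pmf (bulk_law a b m n)) borel (\<lambda>f. lpt f m n)"
    by (intro distr_cong refl) (auto simp: lpt_def intro!: last_passage_cong)
  finally show ?thesis unfolding Q .
qed

text \<open>
  An almost sure limit is a limit in probability, so it lies in every closed set in which the
  rescaled last-passage times of finite rectangles lie with high probability.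
\<close>

lemma quenched_limit_in_closed:
  fixes C :: "ennreal set" and g :: ennreal
  assumes conv: "AE W in quenched_law (a, b).
      (\<lambda>n. ennreal (last_passage W (scaled n s) (scaled n t) / real n)) \<longlonglongrightarrow> g"
    and C: "closed C"
    and whp: "whp (\<lambda>n. bulk_law a b (scaled n s) (scaled n t))
      (\<lambda>n f. ennreal (lpt f (scaled n s) (scaled n t) / real n) \<in> C)"
  shows "g \<in> C"
proof (rule ccontr)
  assume g: "g \<notin> C"
  let ?Q = "quenched_law (a, b)"
  interpret Q: prob_space ?Q by (rule prob_space_quenched_law)
  let ?X = "\<lambda>n W. last_passage W (scaled n s) (scaled n t)"
  have X [measurable]: "?X n \<in> borel_measurable ?Q" for n
    unfolding measurable_cong_sets[OF sets_quenched_law refl] weight_space_def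
    by (rule measurable_last_passage_PiM) auto
  have C' [measurable]: "C \<in> sets borel" using C by (rule borel_closed)
  let ?A = "\<lambda>n. {x :: real. ennreal (x / real n) \<notin> C}"
  have A [measurable]: "?A n \<in> sets borel" for n by measurable
  have "(\<lambda>n. \<integral>W. indicator (?A n) (?X n W) \<partial>?Q) \<longlonglongrightarrow> (\<integral>W. 1 \<partial>?Q :: real)"
  proof (rule integral_dominated_convergence[where w = "\<lambda>_. 1"])
    show "AE W in ?Q. (\<lambda>n. indicator (?A n) (?X n W) :: real) \<longlonglongrightarrow> 1"
      using conv
    proof eventually_elim
      case (elim W)
      have "eventually (\<lambda>n. ennreal (?X n W / real n) \<in> - C) sequentially"
        using C g by (intro topological_tendstoD[OF elim]) auto
      then show ?case
        by (intro tendsto_eventually) (auto elim!: eventually_mono simp: indicator_def)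
    qed
  qed (auto simp: indicator_def)
  moreover have "(\<integral>W. indicator (?A n) (?X n W) \<partial>?Q)
      = measure_pmf.prob (bulk_law a b (scaled n s) (scaled n t))
          {f. \<not> ennreal (lpt f (scaled n s) (scaled n t) / real n) \<in> C}" for n
  proof -
    have "(\<integral>W. indicator (?A n) (?X n W) \<partial>?Q) = (\<integral>x. indicator (?A n) x \<partial>distr ?Q borel (?X n) :: real)"
      by (subst integral_distr) auto
    also have "\<dots> = measure (distr ?Q borel (?X n)) (?A n)"
      by simp
    also have "\<dots> = measure_pmf.prob (bulk_law a b (scaled n s) (scaled n t))
          {f. \<not> ennreal (lpt f (scaled n s) (scaled n t) / real n) \<in> C}"
      unfolding quenched_last_passage_law by (subst measure_distr) (auto simp: vimage_def)
    finally show ?thesis .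
  qed
  ultimately have "(\<lambda>n. measure_pmf.prob (bulk_law a b (scaled n s) (scaled n t))
          {f. \<not> ennreal (lpt f (scaled n s) (scaled n t) / real n) \<in> C}) \<longlonglongrightarrow> 1"
    by (simp add: Q.prob_space)
  with whp show False unfolding whp_def using LIMSEQ_unique by fastforce
qed

section \<open>The right endpoint of a law on the unit interval\<close>

text \<open>
  The complement of the support is a union of open null sets; by the Lindelof property countably many
  of them suffice.
\<close>

lemma emeasure_compl_measure_support:
  assumes sets: "sets \<eta> = sets borel"
  shows "measure_support \<eta> \<in> sets borel" "emeasure \<eta> (- measure_support \<eta>) = 0"
proof -
  let ?F = "{U :: real set. open U \<and> emeasure \<eta> U = 0}"
  have eq: "- measure_support \<eta> = \<Union>?F"
    by (auto simp: measure_support_def zero_less_iff_neq_zero)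
  then have "open (- measure_support \<eta>)" by auto
  then show "measure_support \<eta> \<in> sets borel" by (metis borel_closed closed_def)
  obtain F' where F': "F' \<subseteq> ?F" "countable F'" "\<Union>F' = \<Union>?F"
    using Lindelof[of ?F] by auto
  have "(\<Union>U\<in>F'. U) \<in> null_sets \<eta>"
    using F'(1,2) sets by (intro null_sets_UN') (auto simp: null_sets_def)
  then show "emeasure \<eta> (- measure_support \<eta>) = 0"
    unfolding eq F'(3)[symmetric] by (auto simp: null_sets_def)
qed

lemma right_endpoint_properties:
  fixes \<eta> :: "real measure"
  assumes "prob_space \<eta>" and sets: "sets \<eta> = sets borel" and bounds: "AE x in \<eta>. 0 < x \<and> x < 1"
  shows "AE x in \<eta>. x \<le> right_endpoint \<eta>" and "0 < right_endpoint \<eta>"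
    and "c < right_endpoint \<eta> \<Longrightarrow> 0 < emeasure \<eta> {c<..}"
proof -
  interpret prob_space \<eta> by fact
  let ?S = "measure_support \<eta>"
  have AE_S: "AE x in \<eta>. x \<in> ?S"
    using emeasure_compl_measure_support[OF sets] sets
    by (intro AE_I[of _ _ "- ?S"]) auto
  have le1: "x \<le> 1" if "x \<in> ?S" for x
  proof (rule ccontr)
    assume "\<not> x \<le> 1"
    then have "0 < emeasure \<eta> {1<..}" using that by (auto simp: measure_support_def)
    moreover have "emeasure \<eta> {1<..} = 0"
    proof -
      have "AE x in \<eta>. x \<notin> {1<..}" using bounds by eventually_elim auto
      moreover have "{x \<in> space \<eta>. \<not> x \<notin> {1<..}} = {1<..}"
        using sets_eq_imp_space_eq[OF sets] by auto
      ultimately show ?thesis using AE_iff_measurable[of "{1<..}" \<eta> "\<lambda>x. x \<notin> {1<..}"] sets by simp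
    qed
    ultimately show False by simp
  qed
  then have bdd: "bdd_above ?S" by (auto simp: bdd_above_def)
  show AE_le: "AE x in \<eta>. x \<le> right_endpoint \<eta>"
    using AE_S by eventually_elim (auto simp: right_endpoint_def intro: cSup_upper[OF _ bdd])
  have "\<exists>x. x \<in> ?S \<and> 0 < x \<and> x \<le> right_endpoint \<eta>"
  proof (rule ccontr)
    assume none: "\<not> ?thesis"
    have "AE x in \<eta>. False" using AE_S AE_le bounds by eventually_elim (use none in auto)
    then show False by (simp add: AE_False)
  qed
  then obtain x where x: "x \<in> ?S" "0 < x" "x \<le> right_endpoint \<eta>" by blast
  then show "0 < right_endpoint \<eta>" by simp
  assume "c < right_endpoint \<eta>"
  then obtain y where "y \<in> ?S" "c < y"
    unfolding right_endpoint_def using less_cSup_iff[OF _ bdd] x by auto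
  then show "0 < emeasure \<eta> {c<..}" by (auto simp: measure_support_def)
qed

section \<open>Choice of the boundary parameter\<close>

text \<open>
  What is used about the functions \<open>F z = E [X / (z - X)]\<close>.  Their difference quotients
  \<open>D z w = E [X / ((z - X) * (w - X))]\<close> (up to sign) are positive and
  jointly continuous, so that \<open>- D z z\<close> is the derivative of \<open>F\<close>.
\<close>

definition odds_profile :: "real \<Rightarrow> (real \<Rightarrow> real) \<Rightarrow> (real \<Rightarrow> real \<Rightarrow> real) \<Rightarrow> bool" where
  "odds_profile u F D \<longleftrightarrow> 0 < u
    \<and> (\<forall>z>u. 0 \<le> F z)
    \<and> (\<forall>z>u. \<forall>w>u. 0 < D z w \<and> F z - F w = (w - z) * D z w)
    \<and> continuous_on ({u<..} \<times> {u<..}) (\<lambda>(z, w). D z w)"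

lemma odds_profile_expectation:
  fixes X :: "'x \<Rightarrow> real"
  assumes "prob_space M" and X [measurable]: "X \<in> borel_measurable M"
    and u: "0 < u" and bounds: "AE x in M. 0 < X x \<and> X x \<le> u"
  shows "odds_profile u (\<lambda>z. \<integral>x. odds (X x) z \<partial>M) (\<lambda>z w. \<integral>x. X x / ((z - X x) * (w - X x)) \<partial>M)"
proof -
  interpret prob_space M by fact
  let ?D = "\<lambda>z w x. X x / ((z - X x) * (w - X x))"
  have D_bound: "0 < ?D z w x \<and> norm (?D z w x) \<le> u / (d * d)"
    if "0 < X x \<and> X x \<le> u" "0 < d" "u + d \<le> z" "u + d \<le> w" for z w d x
  proof -
    have "d \<le> z - X x" "d \<le> w - X x" using that by auto
    then have "d * d \<le> (z - X x) * (w - X x)" using that by (intro mult_mono) auto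
    moreover have "0 < d * d" using that by simp
    ultimately show ?thesis using that by (auto intro!: frac_le divide_pos_pos)
  qed
  have odds_int: "integrable M (\<lambda>x. odds (X x) z)" if "u < z" for z
  proof (rule integrable_const_bound[where B = "u / (z - u)"])
    show "AE x in M. norm (odds (X x) z) \<le> u / (z - u)"
      using bounds by eventually_elim (use that in \<open>auto simp: odds_def intro!: frac_le\<close>)
  qed (simp add: odds_def)
  have D_int: "integrable M (?D z w)" if "u < z" "u < w" for z w
  proof (rule integrable_const_bound)
    show "AE x in M. norm (?D z w x) \<le> u / (min (z - u) (w - u) * min (z - u) (w - u))"
      using bounds
    proof eventually_elim
      case (elim x)
      show ?case using D_bound[OF elim, of "min (z - u) (w - u)" z w] that by auto
    qed
  qed simp
  have "continuous_on ({u<..} \<times> {u<..}) (\<lambda>(z, w). \<integral>x. ?D z w x \<partial>M)"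
  proof (unfold continuous_on_sequentially, intro allI ballI impI, elim conjE)
    fix s :: "nat \<Rightarrow> real \<times> real" and p
    assume p: "p \<in> {u<..} \<times> {u<..}" and s: "\<forall>n. s n \<in> {u<..} \<times> {u<..}" and lim: "s \<longlonglongrightarrow> p"
    obtain z w where zw: "p = (z, w)" "u < z" "u < w" using p by (cases p) auto
    define d where "d = min (z - u) (w - u) / 2"
    have d: "0 < d" "u + d < z" "u + d < w" using zw by (auto simp: d_def min_def field_simps)
    have l1: "(\<lambda>n. fst (s n)) \<longlonglongrightarrow> z" and l2: "(\<lambda>n. snd (s n)) \<longlonglongrightarrow> w"
      using tendsto_fst[OF lim] tendsto_snd[OF lim] zw by auto
    have "eventually (\<lambda>n. u + d < fst (s n) \<and> u + d < snd (s n)) sequentially"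
      using order_tendstoD(1)[OF l1 d(2)] order_tendstoD(1)[OF l2 d(3)] by eventually_elim simp
    then obtain N where N: "\<And>n. N \<le> n \<Longrightarrow> u + d < fst (s n) \<and> u + d < snd (s n)"
      by (auto simp: eventually_sequentially)
    have "(\<lambda>n. \<integral>x. ?D (fst (s (n + N))) (snd (s (n + N))) x \<partial>M) \<longlonglongrightarrow> (\<integral>x. ?D z w x \<partial>M)"
    proof (rule integral_dominated_convergence[where w = "\<lambda>_. u / (d * d)"])
      show "AE x in M. (\<lambda>n. ?D (fst (s (n + N))) (snd (s (n + N))) x) \<longlonglongrightarrow> ?D z w x"
        using bounds
      proof eventually_elim
        case (elim x)
        show ?case
          using elim zw LIMSEQ_ignore_initial_segment[OF l1, of N] LIMSEQ_ignore_initial_segment[OF l2, of N]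
          by (intro tendsto_intros) auto
      qed
      show "AE x in M. norm (?D (fst (s (n + N))) (snd (s (n + N))) x) \<le> u / (d * d)" for n
        using bounds
      proof eventually_elim
        case (elim x)
        show ?case using D_bound[OF elim d(1)] N[of "n + N"] by auto
      qed
    qed auto
    then have "(\<lambda>n. \<integral>x. ?D (fst (s n)) (snd (s n)) x \<partial>M) \<longlonglongrightarrow> (\<integral>x. ?D z w x \<partial>M)"
      by (rule LIMSEQ_offset)
    then show "((\<lambda>(z, w). \<integral>x. ?D z w x \<partial>M) \<circ> s) \<longlonglongrightarrow> (case p of (z, w) \<Rightarrow> \<integral>x. ?D z w x \<partial>M)"
      by (simp add: zw o_def case_prod_beta')
  qed
  moreover have "0 \<le> (\<integral>x. odds (X x) z \<partial>M)" if "u < z" for z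
  proof (rule integral_nonneg_AE)
    show "AE x in M. 0 \<le> odds (X x) z"
      using bounds by eventually_elim (use that in \<open>auto simp: odds_def\<close>)
  qed
  moreover have "0 < (\<integral>x. ?D z w x \<partial>M)" if "u < z" "u < w" for z w
  proof -
    have pos: "AE x in M. 0 < ?D z w x"
      using bounds by eventually_elim (use that in \<open>auto intro!: divide_pos_pos mult_pos_pos\<close>)
    have "0 \<le> (\<integral>x. ?D z w x \<partial>M)"
      using pos by (intro integral_nonneg_AE) (auto elim: eventually_mono)
    moreover have "(\<integral>x. ?D z w x \<partial>M) \<noteq> 0"
    proof
      assume "(\<integral>x. ?D z w x \<partial>M) = 0"
      moreover have "AE x in M. 0 \<le> ?D z w x" using pos by eventually_elim simp
      ultimately have "AE x in M. ?D z w x = 0"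
        using integral_nonneg_eq_0_iff_AE[OF D_int[OF that]] by simp
      with pos have "AE x in M. False" by eventually_elim simp
      then show False by (simp add: AE_False)
    qed
    ultimately show ?thesis by simp
  qed
  moreover have "(\<integral>x. odds (X x) z \<partial>M) - (\<integral>x. odds (X x) w \<partial>M) = (w - z) * (\<integral>x. ?D z w x \<partial>M)"
    if "u < z" "u < w" for z w
  proof -
    have "(\<integral>x. odds (X x) z \<partial>M) - (\<integral>x. odds (X x) w \<partial>M) = (\<integral>x. odds (X x) z - odds (X x) w \<partial>M)"
      using odds_int that by simp
    also have "\<dots> = (\<integral>x. (w - z) * ?D z w x \<partial>M)"
    proof (rule integral_cong_AE)
      show "AE x in M. odds (X x) z - odds (X x) w = (w - z) * ?D z w x"
        using bounds
      proof eventually_elim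
        case (elim x)
        then have "z - X x \<noteq> 0" "w - X x \<noteq> 0" using that by auto
        then show ?case by (simp add: odds_def divide_simps) (simp add: algebra_simps)
      qed
    qed (auto simp: odds_def)
    also have "\<dots> = (w - z) * (\<integral>x. ?D z w x \<partial>M)" by (rule integral_mult_right_zero)
    finally show ?thesis .
  qed
  ultimately show ?thesis using u by (auto simp: odds_profile_def)
qed

definition energy :: "(real \<Rightarrow> real) \<Rightarrow> (real \<Rightarrow> real) \<Rightarrow> real \<Rightarrow> real \<Rightarrow> real \<Rightarrow> real" where
  "energy F G s t z = s * F z + t * G (1 / z)"

text \<open>
  The derivative of \<open>energy\<close> in \<open>z\<close>, expressed by the difference quotients on the diagonal.
\<close>

definition energy_slope ::
  "(real \<Rightarrow> real \<Rightarrow> real) \<Rightarrow> (real \<Rightarrow> real \<Rightarrow> real) \<Rightarrow> real \<Rightarrow> real \<Rightarrow> real \<Rightarrow> real" where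
  "energy_slope D D' s t z = t / z\<^sup>2 * D' (1 / z) (1 / z) - s * D z z"

lemma energy_swap: "energy F G s t z = energy G F t s (1 / z)"
  by (simp add: energy_def)

text \<open>
  Under the transposition \<open>z\<close> becomes \<open>1 / z\<close>, so the sign of the slope changes.
\<close>

lemma energy_slope_swap:
  "0 < z \<Longrightarrow> energy_slope D' D t s (1 / z) = - (z\<^sup>2 * energy_slope D D' s t z)"
  by (simp add: energy_slope_def field_simps power2_eq_square)

lemma odds_profileD:
  assumes "odds_profile u F D"
  shows "0 < u" "u < z \<Longrightarrow> 0 \<le> F z" "u < z \<Longrightarrow> u < w \<Longrightarrow> 0 < D z w"
    "u < z \<Longrightarrow> u < w \<Longrightarrow> F z - F w = (w - z) * D z w"
  using assms by (auto simp: odds_profile_def)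

lemma odds_profile_antimono:
  assumes "odds_profile u F D" "u < z" "z \<le> w"
  shows "F w \<le> F z"
  using odds_profileD(3,4)[OF assms(1), of z w] assms by (smt (verit) mult_nonneg_nonneg)

lemma odds_profile_tendsto:
  assumes "odds_profile u F D" and "(f \<longlongrightarrow> z) A" "(g \<longlongrightarrow> w) A" "u < z" "u < w"
  shows "((\<lambda>x. D (f x) (g x)) \<longlongrightarrow> D z w) A"
proof -
  have "open ({u<..} \<times> {u<..})" by (intro open_Times) auto
  then have "isCont (\<lambda>(z, w). D z w) (z, w)"
    using assms continuous_on_eq_continuous_at unfolding odds_profile_def by blast
  from isCont_tendsto_compose[OF this tendsto_Pair[OF assms(2,3)]] show ?thesis by simp
qed

lemma odds_profile_continuous:
  assumes "odds_profile u F D" "u < z"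
  shows "isCont F z"
proof -
  have "((\<lambda>w. F z - (w - z) * D z w) \<longlongrightarrow> F z - (z - z) * D z z) (at z)"
    using assms by (intro tendsto_intros odds_profile_tendsto[OF assms(1)]) auto
  moreover have "eventually (\<lambda>w. F z - (w - z) * D z w = F w) (at z)"
  proof -
    have "eventually (\<lambda>w. u < w) (at z)" using order_tendstoD(1)[OF tendsto_ident_at assms(2)] .
    then show ?thesis
    proof eventually_elim
      case (elim w)
      then show ?case using odds_profileD(4)[OF assms(1,2), of w] by linarith
    qed
  qed
  ultimately show ?thesis unfolding isCont_def by (simp add: filterlim_cong)
qed

text \<open>
  If \<open>h\<close> does not decrease at \<open>z\<close>, then for \<open>z'\<close> slightly below \<open>z\<close> the value \<open>h z'\<close> exceeds \<open>h z\<close> by at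
  most \<open>o(z - z')\<close>, whereas \<open>x * (F z' - F z)\<close> is of exact order \<open>z - z'\<close>.
\<close>

lemma comparison_parameter:
  assumes F: "odds_profile u F D" and G: "odds_profile v G D'"
    and z: "u < z" "z * v < 1" and st: "0 < s" "0 < t" and x: "0 < x"
    and slope: "0 \<le> energy_slope D D' s t z"
  obtains z' where "u < z'" "z' < z" "energy F G s t z' - x * (F z' - F z) < energy F G s t z"
proof -
  have u: "0 < u" and v: "0 < v" using F G odds_profileD(1) by auto
  have z0: "0 < z" using u z by simp
  have vz: "v < 1 / z" using z z0 by (simp add: field_simps)
  let ?h = "\<lambda>z'. (s - x) * D z' z - t / (z * z') * D' (1 / z') (1 / z)"
  have id: "((\<lambda>z'. z') \<longlongrightarrow> z) (at_left z)" by (rule tendsto_ident_at)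
  have "(?h \<longlongrightarrow> (s - x) * D z z - t / (z * z) * D' (1 / z) (1 / z)) (at_left z)"
    using z z0 vz id
    by (intro tendsto_intros odds_profile_tendsto[OF F] odds_profile_tendsto[OF G]) auto
  moreover have "(s - x) * D z z - t / (z * z) * D' (1 / z) (1 / z) < 0"
  proof -
    have "0 < x * D z z" using x odds_profileD(3)[OF F z(1) z(1)] by simp
    then show ?thesis using slope by (simp add: energy_slope_def power2_eq_square algebra_simps)
  qed
  ultimately have "eventually (\<lambda>z'. ?h z' < 0) (at_left z)" by (rule order_tendstoD)
  moreover have "eventually (\<lambda>z'. u < z') (at_left z)" using order_tendstoD(1)[OF id z(1)] .
  moreover have "eventually (\<lambda>z'. z' < z) (at_left z)" by (simp add: eventually_at_filter)
  ultimately have "eventually (\<lambda>z'. ?h z' < 0 \<and> u < z' \<and> z' < z) (at_left z)" by eventually_elim simp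
  then obtain z' where z': "?h z' < 0" "u < z'" "z' < z"
    using eventually_happens'[OF trivial_limit_at_left_real] by blast
  have z'0: "0 < z'" using z' u by simp
  have "z' * v < z * v" using z' v by simp
  then have "z' * v < 1" using z by simp
  then have vz': "v < 1 / z'" using z'0 by (simp add: field_simps)
  have 1: "F z' - F z = (z - z') * D z' z" using odds_profileD(4)[OF F z'(2) z(1)] .
  have "G (1 / z') - G (1 / z) = (1 / z - 1 / z') * D' (1 / z') (1 / z)"
    using odds_profileD(4)[OF G vz' vz] .
  also have "(1 / z - 1 / z') = - ((z - z') / (z * z'))" using z0 z'0 by (simp add: field_simps)
  finally have 2: "G (1 / z') - G (1 / z) = - ((z - z') / (z * z')) * D' (1 / z') (1 / z)" .
  have "energy F G s t z' - x * (F z' - F z) - energy F G s t z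
      = (s - x) * (F z' - F z) + t * (G (1 / z') - G (1 / z))"
    by (simp add: energy_def algebra_simps)
  also have "\<dots> = (z - z') * ?h z'" unfolding 1 2 by (simp add: algebra_simps)
  also have "\<dots> < 0" using z' by (simp add: mult_pos_neg)
  finally show thesis using that[of z'] z' by simp
qed

definition cesaro_odds :: "(nat \<Rightarrow> real) \<Rightarrow> (real \<Rightarrow> real) \<Rightarrow> real set \<Rightarrow> bool" where
  "cesaro_odds a F Z \<longleftrightarrow> (\<forall>z\<in>Z. cesaro (\<lambda>i. odds (a i) z) (F z))"

text \<open>
  The parameter \<open>z'\<close> depends on \<open>F\<close> and \<open>G\<close> alone, not on the environment; this matters because the
  environment is chosen afterwards, for finitely many parameters.
\<close>

lemma right_exits_comparison:
  assumes F: "odds_profile u F D" and G: "odds_profile v G D'"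
    and z: "u < z" "z * v < 1" and st: "0 < s" "0 < t" and \<eta>: "0 < \<eta>"
    and slope: "0 \<le> energy_slope D D' s t z"
  obtains z' where "u < z'" "z' * v < 1"
    "\<And>a b. bounded_env u a \<Longrightarrow> bounded_env v b \<Longrightarrow> cesaro_odds a F {z, z'} \<Longrightarrow> cesaro_odds b G {1 / z'} \<Longrightarrow>
      right_exits_controlled a b z s t (energy F G s t z) \<eta>"
proof -
  have v: "0 < v" using G odds_profileD(1) by auto
  \<comment> \<open>Exits before \<open>x * n\<close> collect at most \<open>x * F z < \<eta>\<close> on the axis; the summand one covers \<open>F z = 0\<close>.\<close>
  define x where "x = \<eta> / (2 * (F z + 1))"
  have Fz: "0 \<le> F z" using odds_profileD(2)[OF F z(1)] .
  have x: "0 < x" using \<eta> Fz by (simp add: x_def)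
  have "x * F z < \<eta>"
  proof -
    have "x * F z \<le> x * (F z + 1)" using x by simp
    also have "\<dots> = \<eta> / 2" using Fz by (simp add: x_def field_simps)
    also have "\<dots> < \<eta>" using \<eta> by simp
    finally show ?thesis .
  qed
  obtain z' where z': "u < z'" "z' < z" "energy F G s t z' - x * (F z' - F z) < energy F G s t z"
    using comparison_parameter[OF F G z st x slope] .
  have z'v: "z' * v < 1" using mult_strict_right_mono[OF z'(2) v] z by simp
  show thesis
  proof (rule that[OF z'(1) z'v])
    fix a b assume a: "bounded_env u a" and b: "bounded_env v b"
      and A: "cesaro_odds a F {z, z'}" and B: "cesaro_odds b G {1 / z'}"
    show "right_exits_controlled a b z s t (energy F G s t z) \<eta>"
    proof (rule right_exits_controlled_by_comparison[OF a b z z'(1) z'v])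
      show "cesaro (\<lambda>i. odds (a i) z) (F z)" "cesaro (\<lambda>i. odds (a i) z') (F z')"
        "cesaro (\<lambda>j. odds (b j) (1 / z')) (G (1 / z'))"
        using A B by (auto simp: cesaro_odds_def)
      show "F z \<le> F z'" using odds_profile_antimono[OF F z'(1)] z' by simp
      show "s * F z' + t * G (1 / z') - x * (F z' - F z) < energy F G s t z"
        using z'(3) by (simp add: energy_def)
    qed (use st Fz x \<open>x * F z < \<eta>\<close> in auto)
  qed
qed

text \<open>
  For \<open>z\<close> close to \<open>1 / v\<close> and \<open>b0\<close> close to \<open>v\<close>, both \<open>F z\<close> and \<open>F (1 / b0)\<close> are close to
  \<open>F (1 / v)\<close>, by continuity of \<open>F\<close> at this point, which is larger than \<open>u\<close>.
\<close>

lemma right_exits_row: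
  assumes F: "odds_profile u F D" and v: "0 < v" "u * v < 1"
    and st: "0 < s" "0 < t" and \<eta>: "0 < \<eta>"
  obtains b0 \<zeta> where "0 < b0" "b0 < v" "\<zeta> * v < 1"
    "\<And>z a b c. u < z \<Longrightarrow> \<zeta> \<le> z \<Longrightarrow> z * v < 1 \<Longrightarrow> bounded_env u a \<Longrightarrow> bounded_env v b \<Longrightarrow> b0 \<le> b 1 \<Longrightarrow>
      cesaro_odds a F {z, 1 / b0} \<Longrightarrow> right_exits_controlled a b z s t c \<eta>"
proof -
  have u: "0 < u" using F odds_profileD(1) by auto
  have uv: "u < 1 / v" using v by (simp add: field_simps)
  define e where "e = \<eta> / (4 * s)"
  have e: "0 < e" using \<eta> st by (simp add: e_def)
  have "isCont F (1 / v)" using odds_profile_continuous[OF F uv] .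
  then obtain d where d: "0 < d" "\<And>w. \<bar>w - 1 / v\<bar> < d \<Longrightarrow> \<bar>F w - F (1 / v)\<bar> < e"
    unfolding continuous_at_eps_delta using e by (auto simp: dist_real_def)
  define b0 where "b0 = 1 / (1 / v + d / 2)"
  have b0: "0 < b0" using v d by (simp add: b0_def add_pos_pos)
  have b0v: "b0 < v" using v d by (simp add: b0_def field_simps add_pos_pos)
  have inv: "1 / b0 = 1 / v + d / 2" by (simp add: b0_def)
  define \<zeta> where "\<zeta> = 1 / v - d / 2"
  have \<zeta>: "\<zeta> * v < 1" using v d by (simp add: \<zeta>_def field_simps)
  show thesis
  proof (rule that[OF b0 b0v \<zeta>])
    fix z c and a b :: "nat \<Rightarrow> real"
    assume z: "u < z" "\<zeta> \<le> z" "z * v < 1" and a: "bounded_env u a" and b: "bounded_env v b"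
      and b1: "b0 \<le> b 1" and A: "cesaro_odds a F {z, 1 / b0}"
    have zv: "z < 1 / v" using z v by (simp add: field_simps)
    have 1: "\<bar>F z - F (1 / v)\<bar> < e" using z zv d by (intro d(2)) (auto simp: \<zeta>_def abs_if)
    have 2: "\<bar>F (1 / b0) - F (1 / v)\<bar> < e" using d by (intro d(2)) (auto simp: inv)
    show "right_exits_controlled a b z s t c \<eta>"
    proof (rule right_exits_controlled_by_row[OF a b z(1,3) b0 b1])
      show "cesaro (\<lambda>i. odds (a i) z) (F z)" "cesaro (\<lambda>i. odds (a i) (1 / b0)) (F (1 / b0))"
        using A by (auto simp: cesaro_odds_def)
      show "0 \<le> F z" using odds_profileD(2)[OF F z(1)] .
      show "F (1 / b0) \<le> F z" using zv d by (intro odds_profile_antimono[OF F z(1)]) (simp add: inv)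
      have "s * (F z - F (1 / b0)) \<le> s * (2 * e)" using 1 2 st by (intro mult_left_mono) auto
      also have "\<dots> = \<eta> / 2" using st by (simp add: e_def)
      finally show "s * (F z - F (1 / b0)) < \<eta>" using \<eta> by simp
    qed (use st in auto)
  qed
qed

lemma energy_slope_continuous:
  assumes F: "odds_profile u F D" and G: "odds_profile v G D'"
  shows "continuous_on {u<..<1 / v} (energy_slope D D' s t)"
proof -
  have u: "0 < u" and v: "0 < v" using F G odds_profileD(1) by auto
  have "isCont (energy_slope D D' s t) z" if "z \<in> {u<..<1 / v}" for z
  proof -
    have z: "u < z" "0 < z" "v < 1 / z" using that u v by (auto simp: field_simps)
    have id: "((\<lambda>z'. z') \<longlongrightarrow> z) (at z)" by (rule tendsto_ident_at)
    have "((\<lambda>z. t / z\<^sup>2 * D' (1 / z) (1 / z) - s * D z z) \<longlongrightarrow> t / z\<^sup>2 * D' (1 / z) (1 / z) - s * D z z) (at z)"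
      using z id by (intro tendsto_intros odds_profile_tendsto[OF F] odds_profile_tendsto[OF G]) auto
    then show ?thesis by (simp add: isCont_def energy_slope_def[abs_def])
  qed
  then show ?thesis by (simp add: continuous_at_imp_continuous_on)
qed

lemma slope_trichotomy:
  fixes f :: "real \<Rightarrow> real"
  assumes "continuous_on {l<..<r} f" "l < r"
  obtains (zero) z where "l < z" "z < r" "f z = 0"
    | (pos) "\<And>z. l < z \<Longrightarrow> z < r \<Longrightarrow> 0 < f z"
    | (neg) "\<And>z. l < z \<Longrightarrow> z < r \<Longrightarrow> f z < 0"
proof (cases "\<exists>z. l < z \<and> z < r \<and> f z = 0")
  case False
  have conn: "connected (f ` {l<..<r})" using assms(1) by (intro connected_continuous_image) auto
  have opposite: False if "l < z" "z < r" "l < w" "w < r" "f z < 0" "0 < f w" for z w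
  proof -
    have "f z \<in> f ` {l<..<r}" "f w \<in> f ` {l<..<r}" using that by simp_all
    then have "0 \<in> f ` {l<..<r}"
      by (rule connectedD_interval[OF conn]) (use that in simp_all)
    with False show False by auto
  qed
  show ?thesis
  proof (cases "\<exists>w. l < w \<and> w < r \<and> 0 < f w")
    case True
    then obtain w where w: "l < w" "w < r" "0 < f w" by blast
    have "0 < f z" if "l < z" "z < r" for z
      using opposite[OF that w(1,2) _ w(3)] False that by (meson linorder_neqE_linordered_idom)
    then show ?thesis by (rule pos)
  next
    case none: False
    have "f z < 0" if "l < z" "z < r" for z
      using none False that by (meson linorder_neqE_linordered_idom)
    then show ?thesis by (rule neg)
  qed
qed (use zero in blast)

text \<open>
  The three cases of a critical point, an increasing and a decreasing energy.  The numbers \<open>a0\<close> and \<open>b0\<close>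
  are lower bounds required of the first column and the first row.  One of them is zero and
  so no restriction: joint information on \<open>a 1\<close> and \<open>b 1\<close> would not follow from their separate laws.
\<close>

lemma linear_lower_bound_parameters:
  assumes F: "odds_profile u F D" and G: "odds_profile v G D'" and uv: "u * v < 1"
    and st: "0 < s" "0 < t" and \<eta>: "0 < \<eta>"
  obtains z Z Z' a0 b0 where "u < z" "z * v < 1" "finite Z" "finite Z'" "Z \<subseteq> {u<..}" "Z' \<subseteq> {v<..}"
    "a0 < u" "b0 < v" "a0 = 0 \<or> b0 = 0"
    "\<And>a b. bounded_env u a \<Longrightarrow> bounded_env v b \<Longrightarrow> a0 \<le> a 1 \<Longrightarrow> b0 \<le> b 1 \<Longrightarrow>
      cesaro_odds a F Z \<Longrightarrow> cesaro_odds b G Z' \<Longrightarrow>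
      whp (\<lambda>n. bulk_law a b (scaled n s) (scaled n t)) (\<lambda>n f.
        (energy F G s t z - 2 * \<eta>) * real n \<le> lpt f (scaled n s) (scaled n t))"
proof -
  have u: "0 < u" and v: "0 < v" using F G odds_profileD(1) by auto
  have uv': "u < 1 / v" "v < 1 / u" and vu: "v * u < 1" using uv u v by (auto simp: field_simps mult.commute)
  have conclude: "whp (\<lambda>n. bulk_law a b (scaled n s) (scaled n t)) (\<lambda>n f.
        (energy F G s t z - 2 * \<eta>) * real n \<le> lpt f (scaled n s) (scaled n t))"
    if "bounded_env u a" "bounded_env v b" "u < z" "z * v < 1"
      "cesaro_odds a F {z}" "cesaro_odds b G {1 / z}"
      "right_exits_controlled a b z s t (energy F G s t z) \<eta>"
      "right_exits_controlled b a (1 / z) t s (energy F G s t z) \<eta>" for a b z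
    using lpt_linear_lower_bound[OF that(1-4) _ _ st \<eta>, of "F z" "G (1 / z)"] that(5-8)
    by (simp add: cesaro_odds_def energy_def)
  have swap: "v < 1 / z" "1 / z * u < 1" if "u < z" "z * v < 1" for z
    using that u by (auto simp: field_simps)
  have swap_slope: "0 \<le> energy_slope D' D t s (1 / z) \<longleftrightarrow> energy_slope D D' s t z \<le> 0" if "u < z" for z
  proof -
    have "0 < z\<^sup>2" using that u by simp
    then show ?thesis
      using energy_slope_swap[of z D' D t s] that u by (simp add: mult_le_0_iff)
  qed
  let ?\<phi> = "energy_slope D D' s t"
  consider (zero) z where "u < z" "z < 1 / v" "?\<phi> z = 0"
    | (pos) "\<And>z. u < z \<Longrightarrow> z < 1 / v \<Longrightarrow> 0 < ?\<phi> z"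
    | (neg) "\<And>z. u < z \<Longrightarrow> z < 1 / v \<Longrightarrow> ?\<phi> z < 0"
    by (rule slope_trichotomy[OF energy_slope_continuous[OF F G, of s t] uv'(1)]; blast)
  then show thesis
  proof cases
    case (zero z)
    have z: "u < z" "z * v < 1" using zero v by (auto simp: field_simps)
    obtain z1 where z1: "u < z1" "z1 * v < 1"
      "\<And>a b. bounded_env u a \<Longrightarrow> bounded_env v b \<Longrightarrow> cesaro_odds a F {z, z1} \<Longrightarrow> cesaro_odds b G {1 / z1} \<Longrightarrow>
        right_exits_controlled a b z s t (energy F G s t z) \<eta>"
      by (rule right_exits_comparison[OF F G z st \<eta>]) (use zero in auto)
    obtain z2 where z2: "v < z2" "z2 * u < 1"
      "\<And>a b. bounded_env v a \<Longrightarrow> bounded_env u b \<Longrightarrow> cesaro_odds a G {1 / z, z2} \<Longrightarrow> cesaro_odds b F {1 / z2} \<Longrightarrow>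
        right_exits_controlled a b (1 / z) t s (energy G F t s (1 / z)) \<eta>"
      by (rule right_exits_comparison[OF G F swap[OF z] st(2,1) \<eta>]) (use zero swap_slope[OF z(1)] in auto)
    show thesis
    proof (rule that[OF z, of "{z, z1, 1 / z2}" "{1 / z, 1 / z1, z2}" 0 0])
      show "{z, z1, 1 / z2} \<subseteq> {u<..}" "{1 / z, 1 / z1, z2} \<subseteq> {v<..}"
        using z z1(1,2) z2(1,2) u v by (auto simp: field_simps)
      fix a b assume "bounded_env u a" "bounded_env v b"
        "cesaro_odds a F {z, z1, 1 / z2}" "cesaro_odds b G {1 / z, 1 / z1, z2}"
      then show "whp (\<lambda>n. bulk_law a b (scaled n s) (scaled n t)) (\<lambda>n f.
        (energy F G s t z - 2 * \<eta>) * real n \<le> lpt f (scaled n s) (scaled n t))"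
        using z1(3)[of a b] z2(3)[of b a] z
        by (intro conclude) (auto simp: cesaro_odds_def energy_swap[of F G s t z])
    qed (use u v in auto)
  next
    case pos
    obtain a0 \<zeta> where a0: "0 < a0" "a0 < u" "\<zeta> * u < 1"
      "\<And>z a b c. v < z \<Longrightarrow> \<zeta> \<le> z \<Longrightarrow> z * u < 1 \<Longrightarrow> bounded_env v a \<Longrightarrow> bounded_env u b \<Longrightarrow> a0 \<le> b 1 \<Longrightarrow>
        cesaro_odds a G {z, 1 / a0} \<Longrightarrow> right_exits_controlled a b z t s c \<eta>"
      by (rule right_exits_row[OF G u vu st(2,1) \<eta>]; blast)
    define y where "y = (max \<zeta> v + 1 / u) / 2"
    have "\<zeta> < 1 / u" using a0(3) u by (simp add: pos_less_divide_eq)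
    then have "v \<le> max \<zeta> v" "\<zeta> \<le> max \<zeta> v" "max \<zeta> v < 1 / u" using uv'(2) by simp_all
    moreover have "2 * y = max \<zeta> v + 1 / u" by (simp add: y_def)
    ultimately have y: "v < y" "\<zeta> \<le> y" "y < 1 / u" using uv'(2) by linarith+
    define z where "z = 1 / y"
    have y0: "0 < y" using y v by simp
    have z: "u < z" "z * v < 1" "1 / z = y" using y y0 u v by (auto simp: z_def field_simps)
    have "z < 1 / v" using z v by (simp add: field_simps)
    have yu: "y * u < 1" using y u by (simp add: field_simps)
    obtain z1 where z1: "u < z1" "z1 * v < 1"
      "\<And>a b. bounded_env u a \<Longrightarrow> bounded_env v b \<Longrightarrow> cesaro_odds a F {z, z1} \<Longrightarrow> cesaro_odds b G {1 / z1} \<Longrightarrow>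
        right_exits_controlled a b z s t (energy F G s t z) \<eta>"
      by (rule right_exits_comparison[OF F G z(1,2) st \<eta>]) (use pos[OF z(1) \<open>z < 1 / v\<close>] in auto)
    show thesis
    proof (rule that[OF z(1,2), of "{z, z1}" "{1 / z, 1 / z1, 1 / a0}" a0 0])
      have "v < 1 / a0" using uv'(2) a0 u by (smt (verit) frac_less2)
      then show "{1 / z, 1 / z1, 1 / a0} \<subseteq> {v<..}"
        using z z1(1,2) y u v by (auto simp: field_simps)
      fix a b assume "bounded_env u a" "bounded_env v b" "a0 \<le> a 1"
        "cesaro_odds a F {z, z1}" "cesaro_odds b G {1 / z, 1 / z1, 1 / a0}"
      then show "whp (\<lambda>n. bulk_law a b (scaled n s) (scaled n t)) (\<lambda>n f.
        (energy F G s t z - 2 * \<eta>) * real n \<le> lpt f (scaled n s) (scaled n t))"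
        using z1(3)[of a b] a0(4)[of y b a] z y yu
        by (intro conclude) (auto simp: cesaro_odds_def)
    qed (use z z1 u v a0 in auto)
  next
    case neg
    obtain b0 \<zeta> where b0: "0 < b0" "b0 < v" "\<zeta> * v < 1"
      "\<And>z a b c. u < z \<Longrightarrow> \<zeta> \<le> z \<Longrightarrow> z * v < 1 \<Longrightarrow> bounded_env u a \<Longrightarrow> bounded_env v b \<Longrightarrow> b0 \<le> b 1 \<Longrightarrow>
        cesaro_odds a F {z, 1 / b0} \<Longrightarrow> right_exits_controlled a b z s t c \<eta>"
      by (rule right_exits_row[OF F v uv st \<eta>]; blast)
    define z where "z = (max \<zeta> u + 1 / v) / 2"
    have "\<zeta> < 1 / v" using b0(3) v by (simp add: pos_less_divide_eq)
    then have "u \<le> max \<zeta> u" "\<zeta> \<le> max \<zeta> u" "max \<zeta> u < 1 / v" using uv'(1) by simp_all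
    moreover have "2 * z = max \<zeta> u + 1 / v" by (simp add: z_def)
    ultimately have z: "u < z" "\<zeta> \<le> z" "z < 1 / v" using uv'(1) by linarith+
    have zv: "z * v < 1" using z v by (simp add: field_simps)
    obtain z2 where z2: "v < z2" "z2 * u < 1"
      "\<And>a b. bounded_env v a \<Longrightarrow> bounded_env u b \<Longrightarrow> cesaro_odds a G {1 / z, z2} \<Longrightarrow> cesaro_odds b F {1 / z2} \<Longrightarrow>
        right_exits_controlled a b (1 / z) t s (energy G F t s (1 / z)) \<eta>"
      by (rule right_exits_comparison[OF G F swap[OF z(1) zv] st(2,1) \<eta>])
         (use neg[OF z(1,3)] swap_slope[OF z(1)] in auto)
    show thesis
    proof (rule that[OF z(1) zv, of "{z, 1 / b0, 1 / z2}" "{1 / z, z2}" 0 b0])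
      have "u < 1 / b0" using uv'(1) b0 v by (smt (verit) frac_less2)
      then show "{z, 1 / b0, 1 / z2} \<subseteq> {u<..}"
        using z z2(1,2) u v by (auto simp: field_simps)
      show "{1 / z, z2} \<subseteq> {v<..}" using swap[OF z(1) zv] z2 by auto
      fix a b assume "bounded_env u a" "bounded_env v b" "b0 \<le> b 1"
        "cesaro_odds a F {z, 1 / b0, 1 / z2}" "cesaro_odds b G {1 / z, z2}"
      then show "whp (\<lambda>n. bulk_law a b (scaled n s) (scaled n t)) (\<lambda>n f.
        (energy F G s t z - 2 * \<eta>) * real n \<le> lpt f (scaled n s) (scaled n t))"
        using z2(3)[of b a] b0(4)[of z a b] z zv
        by (intro conclude) (auto simp: cesaro_odds_def energy_swap[of F G s t z])
    qed (use z z2 u v b0 in auto)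
  qed
qed

section \<open>Ergodic environments\<close>

locale environment =
  fixes \<mu> :: "env measure"
  assumes ergodic: "ergodic_environment \<mu>"
begin

sublocale prob_space \<mu>
  using ergodic by (simp add: ergodic_environment_def)

lemma sets_env: "sets \<mu> = sets env_space"
  using ergodic by (simp add: ergodic_environment_def)

lemma space_env: "space \<mu> = space env_space"
  by (rule sets_eq_imp_space_eq[OF sets_env])

lemma coordinate_measurable:
  assumes "1 \<le> i"
  shows "(\<lambda>e. fst e i) \<in> borel_measurable \<mu>" "(\<lambda>e. snd e i) \<in> borel_measurable \<mu>"
  using measurable_compose[OF measurable_fst measurable_seq_component[OF assms], of seq_space]
    measurable_compose[OF measurable_snd measurable_seq_component[OF assms], of seq_space]
  unfolding measurable_cong_sets[OF sets_env refl] env_space_def by auto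

lemma coordinate_bounds:
  assumes "e \<in> space \<mu>" "1 \<le> i"
  shows "0 < fst e i \<and> fst e i < 1" "0 < snd e i \<and> snd e i < 1"
  using assms space_seq_spaceD[of "fst e" i] space_seq_spaceD[of "snd e" i]
  by (auto simp: space_env env_space_def space_pair_measure)

lemma shift_ergodic: "1 \<le> k \<Longrightarrow> ergodic_map \<mu> (map_prod (shift k) (shift k))"
  using ergodic by (simp add: ergodic_environment_def)

lemma shift_apply: "1 \<le> i \<Longrightarrow> shift k c i = c (i + k)"
  by (simp add: shift_def)

lemma funpow_shift:
  assumes "1 \<le> i"
  shows "fst ((map_prod (shift 1) (shift 1) ^^ k) e) i = fst e (i + k)"
    and "snd ((map_prod (shift 1) (shift 1) ^^ k) e) i = snd e (i + k)"
  using assms by (induction k arbitrary: i) (auto simp: shift_apply)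

lemma AE_shift:
  assumes "AE e in \<mu>. P e" "1 \<le> k"
  shows "AE e in \<mu>. P (map_prod (shift k) (shift k) e)"
proof -
  have T: "map_prod (shift k) (shift k) \<in> measurable \<mu> \<mu>"
    "distr \<mu> \<mu> (map_prod (shift k) (shift k)) = \<mu>"
    using shift_ergodic[OF assms(2)] by (simp_all add: ergodic_map_def)
  show ?thesis by (rule AE_distrD[OF T(1)]) (unfold T(2), rule assms(1))
qed

lemma coordinate_law:
  fixes c :: "env \<Rightarrow> nat \<Rightarrow> real" and law :: "real measure"
  assumes c: "c = fst \<or> c = snd" and law: "law = distr \<mu> borel (\<lambda>e. c e 1)"
  shows "0 < right_endpoint law"
    and "AE e in \<mu>. bounded_env (right_endpoint law) (c e)"
    and "x < right_endpoint law \<Longrightarrow> \<not> (AE e in \<mu>. \<not> x \<le> c e 1)"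
proof -
  have c1 [measurable]: "(\<lambda>e. c e 1) \<in> borel_measurable \<mu>" using c coordinate_measurable[of 1] by auto
  have law_prob: "prob_space law" unfolding law by (rule prob_space_distr[OF c1])
  have law_sets: "sets law = sets borel" by (simp add: law)
  have bnd: "0 < c e i \<and> c e i < 1" if "e \<in> space \<mu>" "1 \<le> i" for e i
    using c coordinate_bounds[OF that] by auto
  have law_bnd: "AE x in law. 0 < x \<and> x < 1"
    unfolding law using c1 by (subst AE_distr_iff) (simp_all add: AE_I2 bnd del: One_nat_def)
  note endpoint = right_endpoint_properties[OF law_prob law_sets law_bnd]
  show "0 < right_endpoint law" by (rule endpoint(2))
  have le1: "AE e in \<mu>. c e 1 \<le> right_endpoint law"
    using endpoint(1) c1 unfolding law by (subst (asm) AE_distr_iff) (simp_all del: One_nat_def)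
  have "AE e in \<mu>. c e (Suc k) \<le> right_endpoint law" for k
  proof (cases "k = 0")
    case False
    then have "AE e in \<mu>. c (map_prod (shift k) (shift k) e) 1 \<le> right_endpoint law"
      by (intro AE_shift[OF le1]) auto
    moreover have "c (map_prod (shift k) (shift k) e) 1 = c e (Suc k)" for e
      using c by (auto simp: shift_apply)
    ultimately show ?thesis by simp
  qed (use le1 in simp)
  then have "AE e in \<mu>. \<forall>k. c e (Suc k) \<le> right_endpoint law" by (simp add: AE_all_countable)
  then show "AE e in \<mu>. bounded_env (right_endpoint law) (c e)"
    using AE_space
  proof eventually_elim
    case (elim e)
    show ?case unfolding bounded_env_def
    proof (intro allI impI conjI)
      fix i :: nat assume i: "1 \<le> i"
      show "0 < c e i" using bnd[OF elim(2) i] by simp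
      show "c e i \<le> right_endpoint law" using elim(1)[rule_format, of "i - 1"] i by simp
    qed
  qed
  assume "x < right_endpoint law"
  then have pos: "0 < emeasure law {x<..}" by (rule endpoint(3))
  show "\<not> (AE e in \<mu>. \<not> x \<le> c e 1)"
  proof
    assume "AE e in \<mu>. \<not> x \<le> c e 1"
    then have "AE e in \<mu>. \<not> x < c e 1" by eventually_elim simp
    moreover have "{e \<in> space \<mu>. x < c e 1} \<in> sets \<mu>" by measurable
    ultimately have "emeasure \<mu> {e \<in> space \<mu>. x < c e 1} = 0"
      by (subst (asm) AE_iff_measurable[OF _ refl]) auto
    moreover have "emeasure law {x<..} = emeasure \<mu> {e \<in> space \<mu>. x < c e 1}"
      unfolding law by (subst emeasure_distr[OF c1]) (auto intro!: arg_cong[where f = "emeasure \<mu>"])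
    ultimately show False using pos by simp
  qed
qed

text \<open>
  The ergodic theorem along the diagonal shift, for either of the two sequences.
\<close>

lemma coordinate_cesaro:
  fixes c :: "env \<Rightarrow> nat \<Rightarrow> real"
  assumes c: "c = fst \<or> c = snd" and bounded: "AE e in \<mu>. bounded_env u (c e)" and u: "0 < u" "u < z"
  shows "AE e in \<mu>. cesaro (\<lambda>i. odds (c e i) z) (\<integral>e. odds (c e 1) z \<partial>\<mu>)"
proof -
  let ?T = "map_prod (shift 1) (shift 1)"
  have c1 [measurable]: "(\<lambda>e. c e 1) \<in> borel_measurable \<mu>" using c coordinate_measurable[of 1] by auto
  \<comment> \<open>The ergodic theorem above wants a function that is bounded everywhere, while \<open>odds (c e 1) z\<close> is so
    only for environments bounded by \<open>u\<close>.\<close>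
  define f where "f e = odds (max 0 (min u (c e 1))) z" for e
  have f [measurable]: "f \<in> borel_measurable \<mu>" unfolding f_def[abs_def] odds_def by measurable
  have "\<bar>f e\<bar> \<le> u / (z - u)" for e
    unfolding f_def odds_def using u by (auto intro!: frac_le simp: max_def min_def)
  note avg = ergodic_averages_converge[OF prob_space_axioms shift_ergodic[of 1] f this]
  have "(\<integral>e. f e \<partial>\<mu>) = (\<integral>e. odds (c e 1) z \<partial>\<mu>)"
  proof (rule integral_cong_AE)
    show "AE e in \<mu>. f e = odds (c e 1) z"
      using bounded
    proof eventually_elim
      case (elim e)
      with bounded_envD[OF elim, of 1] show ?case by (simp add: f_def)
    qed
  qed (simp_all add: odds_def del: One_nat_def)
  moreover have "AE e in \<mu>. (\<lambda>n. (\<Sum>i<n. f ((?T ^^ i) e)) / real n) \<longlonglongrightarrow> (\<integral>e. f e \<partial>\<mu>)"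
    using avg by simp
  ultimately have "AE e in \<mu>. (\<lambda>n. (\<Sum>i<n. f ((?T ^^ i) e)) / real n) \<longlonglongrightarrow> (\<integral>e. odds (c e 1) z \<partial>\<mu>)"
    by simp
  then show ?thesis using bounded
  proof eventually_elim
    case (elim e)
    have "f ((?T ^^ i) e) = odds (c e (Suc i)) z" for i
    proof -
      have "c ((?T ^^ i) e) 1 = c e (Suc i)" using c funpow_shift[of 1 i e] by auto
      moreover have "0 < c e (Suc i)" "c e (Suc i) \<le> u" using bounded_envD[OF elim(2), of "Suc i"] by auto
      ultimately show ?thesis by (simp add: f_def)
    qed
    then have "(\<Sum>i<n. f ((?T ^^ i) e)) = (\<Sum>i\<in>{1..n}. odds (c e i) z)" for n
      by (intro sum.reindex_bij_witness[of _ "\<lambda>i. i - 1" Suc]) auto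
    with elim(1) show ?case by (simp add: cesaro_def)
  qed
qed

text \<open>
  The annealed law is the mixture of the quenched laws, so an almost sure statement about the
  weights holds almost surely under almost every quenched law.
\<close>

lemma quenched_convergence:
  assumes "shape_function \<mu> g" and st: "0 < s" "0 < t"
  shows "AE e in \<mu>. AE W in quenched_law e.
    (\<lambda>n. ennreal (last_passage W (scaled n s) (scaled n t) / real n)) \<longlonglongrightarrow> g s t"
proof -
  let ?P = "\<lambda>W. (\<lambda>n. ennreal (last_passage W (scaled n s) (scaled n t) / real n)) \<longlonglongrightarrow> g s t"
  have "AE W in annealed_law \<mu>. ?P W"
    using assms unfolding shape_function_def scaled_def by (auto elim: eventually_mono)
  moreover have kernel: "quenched_law \<in> measurable \<mu> (subprob_algebra weight_space)"
    using measurable_prob_algebraD[OF measurable_quenched_law]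
    unfolding measurable_cong_sets[OF sets_env refl] .
  moreover have "Measurable.pred weight_space ?P"
  proof -
    have X: "(\<lambda>W. ennreal (last_passage W (scaled n s) (scaled n t) / real n)) \<in> borel_measurable weight_space" for n
    proof -
      have [measurable]: "(\<lambda>W. last_passage W (scaled n s) (scaled n t)) \<in> borel_measurable weight_space"
        unfolding weight_space_def by (rule measurable_last_passage_PiM) auto
      show ?thesis by measurable
    qed
    \<comment> \<open>Convergence to a given limit is expressed by measurable functions.\<close>
    have eq: "?P W \<longleftrightarrow>
        liminf (\<lambda>n. ennreal (last_passage W (scaled n s) (scaled n t) / real n)) = g s t
      \<and> limsup (\<lambda>n. ennreal (last_passage W (scaled n s) (scaled n t) / real n)) = g s t" for W
      by (simp add: tendsto_iff_Liminf_eq_Limsup)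
    show ?thesis unfolding eq using X by measurable
  qed
  ultimately show ?thesis unfolding annealed_law_def by (subst (asm) AE_bind) auto
qed

end

section \<open>The shape function\<close>

theorem theorem2p6:
  fixes \<mu> :: "env measure" and g :: "real \<Rightarrow> real \<Rightarrow> ennreal"
  assumes "ergodic_environment \<mu>"
    and "shape_function \<mu> g"
    and "right_endpoint (law_a \<mu>) * right_endpoint (law_b \<mu>) < 1"
  shows "\<forall>s>0. \<forall>t>0. g s t = ennreal
    (INF z\<in>{right_endpoint (law_a \<mu>)<..<1 / right_endpoint (law_b \<mu>)}.
       s * (\<integral>(a, b). (a 1 / z) / (1 - a 1 / z) \<partial>\<mu>) + t * (\<integral>(a, b). (b 1 * z) / (1 - b 1 * z) \<partial>\<mu>))"
proof (intro allI impI)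
  fix s t :: real assume st: "0 < s" "0 < t"
  interpret environment \<mu> by unfold_locales fact
  define u v where "u = right_endpoint (law_a \<mu>)" and "v = right_endpoint (law_b \<mu>)"
  have laws: "law_a \<mu> = distr \<mu> borel (\<lambda>e. fst e 1)" "law_b \<mu> = distr \<mu> borel (\<lambda>e. snd e 1)"
    by (simp_all add: law_a_def law_b_def case_prod_beta')
  note A = coordinate_law[OF disjI1[OF refl] laws(1), folded u_def]
  note B = coordinate_law[OF disjI2[OF refl] laws(2), folded v_def]
  have uv: "u * v < 1" using assms(3) by (simp add: u_def v_def)
  define F G where "F z = (\<integral>e. odds (fst e 1) z \<partial>\<mu>)" and "G z = (\<integral>e. odds (snd e 1) z \<partial>\<mu>)" for z
  obtain D where F: "odds_profile u F D"
  proof -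
    have "AE e in \<mu>. 0 < fst e 1 \<and> fst e 1 \<le> u"
      using A(2) by eventually_elim (auto simp: bounded_env_def)
    from odds_profile_expectation[OF prob_space_axioms coordinate_measurable(1)[of 1] A(1) this]
    show thesis using that unfolding F_def[abs_def] by simp
  qed
  obtain D' where G: "odds_profile v G D'"
  proof -
    have "AE e in \<mu>. 0 < snd e 1 \<and> snd e 1 \<le> v"
      using B(2) by eventually_elim (auto simp: bounded_env_def)
    from odds_profile_expectation[OF prob_space_axioms coordinate_measurable(2)[of 1] B(1) this]
    show thesis using that unfolding G_def[abs_def] by simp
  qed
  have u0: "0 < u" and v0: "0 < v" using A(1) B(1) by auto
  let ?I = "{u<..<1 / v}" and ?h = "energy F G s t"
  have I: "?I \<noteq> {}" using uv u0 v0 by (simp add: field_simps)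
  have in_I: "z \<in> ?I \<longleftrightarrow> u < z \<and> z * v < 1" for z using v0 by (auto simp: field_simps)
  have inv: "v < 1 / z" if "z \<in> ?I" for z using that u0 v0 by (auto simp: field_simps)
  have h_eq: "s * (\<integral>(a, b). (a 1 / z) / (1 - a 1 / z) \<partial>\<mu>) + t * (\<integral>(a, b). (b 1 * z) / (1 - b 1 * z) \<partial>\<mu>) = ?h z"
    if "z \<in> ?I" for z
    using that u0 by (simp add: energy_def F_def G_def odds_eq odds_inverse_eq case_prod_beta')
  have h_nonneg: "0 \<le> ?h z" if "z \<in> ?I" for z
    using that st inv[OF that] odds_profileD(2)[OF F, of z] odds_profileD(2)[OF G, of "1 / z"]
    by (auto simp: energy_def)
  have cesA: "AE e in \<mu>. cesaro_odds (fst e) F Z" if "finite Z" "Z \<subseteq> {u<..}" for Z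
  proof -
    have "\<forall>z\<in>Z. AE e in \<mu>. cesaro (\<lambda>i. odds (fst e i) z) (F z)"
      unfolding F_def using that(2)
      by (intro ballI coordinate_cesaro[OF disjI1[OF refl] A(2) A(1)]) auto
    then show ?thesis unfolding cesaro_odds_def AE_finite_all[OF that(1)] .
  qed
  have cesB: "AE e in \<mu>. cesaro_odds (snd e) G Z" if "finite Z" "Z \<subseteq> {v<..}" for Z
  proof -
    have "\<forall>z\<in>Z. AE e in \<mu>. cesaro (\<lambda>i. odds (snd e i) z) (G z)"
      unfolding G_def using that(2)
      by (intro ballI coordinate_cesaro[OF disjI2[OF refl] B(2) B(1)]) auto
    then show ?thesis unfolding cesaro_odds_def AE_finite_all[OF that(1)] .
  qed
  note conv = quenched_convergence[OF assms(2) st]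
  have AE_witness: "\<exists>e. P e" if "AE e in \<mu>. P e" for P
  proof (rule ccontr)
    assume none: "\<not> (\<exists>e. P e)"
    have "AE e in \<mu>. False" by (rule eventually_mono[OF that]) (use none in blast)
    then show False by (simp only: AE_False)
  qed
  have upper: "g s t \<le> ennreal (?h z)" if z: "z \<in> ?I" for z
  proof (rule ennreal_le_epsilon)
    fix \<epsilon> :: real assume \<epsilon>: "0 < \<epsilon>"
    have ces: "AE e in \<mu>. cesaro_odds (fst e) F {z}" "AE e in \<mu>. cesaro_odds (snd e) G {1 / z}"
      using z inv[OF z] by (auto intro!: cesA cesB)
    have "AE e in \<mu>. g s t \<le> ennreal (?h z + \<epsilon>)"
      using conv A(2) B(2) ces
    proof eventually_elim
      case (elim e)
      obtain a b where e: "e = (a, b)" by (cases e)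
      have z': "u < z" "z * v < 1" using z in_I by auto
      have "whp (\<lambda>n. bulk_law a b (scaled n s) (scaled n t)) (\<lambda>n f.
          lpt f (scaled n s) (scaled n t) \<le> (s * F z + t * G (1 / z) + \<epsilon>) * real n)"
        using elim st \<epsilon> z' inv[OF z]
        by (intro lpt_linear_upper_bound[of u a v b z]) (auto simp: e cesaro_odds_def)
      then have "whp (\<lambda>n. bulk_law a b (scaled n s) (scaled n t)) (\<lambda>n f.
          ennreal (lpt f (scaled n s) (scaled n t) / real n) \<in> {..ennreal (?h z + \<epsilon>)})"
      proof (rule whp_mono)
        show "eventually (\<lambda>n. \<forall>f. lpt f (scaled n s) (scaled n t) \<le> (s * F z + t * G (1 / z) + \<epsilon>) * real n
          \<longrightarrow> ennreal (lpt f (scaled n s) (scaled n t) / real n) \<in> {..ennreal (?h z + \<epsilon>)}) sequentially"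
          using eventually_gt_at_top[of 0]
          by eventually_elim (auto simp: energy_def divide_le_eq intro!: ennreal_leI)
      qed
      with elim(1) have "g s t \<in> {..ennreal (?h z + \<epsilon>)}"
        unfolding e by (intro quenched_limit_in_closed[where C = "{..ennreal (?h z + \<epsilon>)}"]) auto
      then show ?case by simp
    qed
    then show "g s t \<le> ennreal (?h z) + ennreal \<epsilon>"
      using AE_witness[of "\<lambda>e. g s t \<le> ennreal (?h z + \<epsilon>)"] h_nonneg[OF z] \<epsilon> by (simp add: ennreal_plus)
  qed
  obtain z0 where z0: "z0 \<in> ?I" using I by blast
  obtain r where r: "g s t = ennreal r" "0 \<le> r"
    using upper[OF z0] by (cases "g s t") (auto simp: top_unique)
  have r_le: "r \<le> ?h z" if "z \<in> ?I" for z
    using upper[OF that] h_nonneg[OF that] r by simp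
  have bdd: "bdd_below (?h ` ?I)" using h_nonneg by (rule bdd_belowI2)
  have "(INF z\<in>?I. ?h z) \<le> r"
  proof (rule field_le_epsilon)
    fix \<epsilon> :: real assume "0 < \<epsilon>"
    then have \<eta>: "0 < \<epsilon> / 2" by simp
    obtain z Z Z' a0 b0 where z: "u < z" "z * v < 1"
      and Z: "finite Z" "finite Z'" "Z \<subseteq> {u<..}" "Z' \<subseteq> {v<..}"
      and ab0: "a0 < u" "b0 < v" "a0 = 0 \<or> b0 = 0"
      and lower: "\<And>a b. bounded_env u a \<Longrightarrow> bounded_env v b \<Longrightarrow> a0 \<le> a 1 \<Longrightarrow> b0 \<le> b 1 \<Longrightarrow>
        cesaro_odds a F Z \<Longrightarrow> cesaro_odds b G Z' \<Longrightarrow>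
        whp (\<lambda>n. bulk_law a b (scaled n s) (scaled n t)) (\<lambda>n f.
          (?h z - 2 * (\<epsilon> / 2)) * real n \<le> lpt f (scaled n s) (scaled n t))"
      by (rule linear_lower_bound_parameters[OF F G uv st \<eta>]) blast
    \<comment> \<open>Almost every environment is good, and with positive probability a good one also satisfies the
      bound on its first row or column.\<close>
    define good where "good e \<longleftrightarrow> bounded_env u (fst e) \<and> bounded_env v (snd e)
      \<and> cesaro_odds (fst e) F Z \<and> cesaro_odds (snd e) G Z'
      \<and> (AE W in quenched_law e.
          (\<lambda>n. ennreal (last_passage W (scaled n s) (scaled n t) / real n)) \<longlonglongrightarrow> g s t)" for e
    have AE_good: "AE e in \<mu>. good e"
      using conv A(2) B(2) cesA[OF Z(1,3)] cesB[OF Z(2,4)]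
      by eventually_elim (simp add: good_def)
    have "\<exists>e. good e \<and> a0 \<le> fst e 1 \<and> b0 \<le> snd e 1"
    proof (rule ccontr)
      assume none: "\<nexists>e. good e \<and> a0 \<le> fst e 1 \<and> b0 \<le> snd e 1"
      have pos: "0 < fst e 1" "0 < snd e 1" if "good e" for e
        using that bounded_envD(1)[of u "fst e" 1] bounded_envD(1)[of v "snd e" 1]
        unfolding good_def by auto
      from ab0(3) show False
      proof
        assume a0: "a0 = 0"
        have "\<not> b0 \<le> snd e 1" if "good e" for e
          using none that pos(1)[OF that] less_imp_le unfolding a0 by blast
        then have "AE e in \<mu>. \<not> b0 \<le> snd e 1" by (rule eventually_mono[OF AE_good])
        with B(3)[OF ab0(2)] show False by blast
      next
        assume b0: "b0 = 0"
        have "\<not> a0 \<le> fst e 1" if "good e" for e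
          using none that pos(2)[OF that] less_imp_le unfolding b0 by blast
        then have "AE e in \<mu>. \<not> a0 \<le> fst e 1" by (rule eventually_mono[OF AE_good])
        with A(3)[OF ab0(1)] show False by blast
      qed
    qed
    then obtain a b where ab: "good (a, b)" "a0 \<le> a 1" "b0 \<le> b 1" by auto
    have "whp (\<lambda>n. bulk_law a b (scaled n s) (scaled n t)) (\<lambda>n f.
          (?h z - 2 * (\<epsilon> / 2)) * real n \<le> lpt f (scaled n s) (scaled n t))"
      using ab by (intro lower) (auto simp: good_def)
    then have "whp (\<lambda>n. bulk_law a b (scaled n s) (scaled n t)) (\<lambda>n f.
        ennreal (lpt f (scaled n s) (scaled n t) / real n) \<in> {ennreal (?h z - \<epsilon>)..})"
    proof (rule whp_mono)
      show "eventually (\<lambda>n. \<forall>f. (?h z - 2 * (\<epsilon> / 2)) * real n \<le> lpt f (scaled n s) (scaled n t)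
        \<longrightarrow> ennreal (lpt f (scaled n s) (scaled n t) / real n) \<in> {ennreal (?h z - \<epsilon>)..}) sequentially"
        using eventually_gt_at_top[of 0]
        by eventually_elim (auto simp: le_divide_eq intro!: ennreal_leI)
    qed
    then have "g s t \<in> {ennreal (?h z - \<epsilon>)..}"
      using ab(1) by (intro quenched_limit_in_closed[where C = "{ennreal (?h z - \<epsilon>)..}"]) (auto simp: good_def)
    then have "?h z - \<epsilon> \<le> r" using r by (cases "0 \<le> ?h z - \<epsilon>") auto
    moreover have "(INF z\<in>?I. ?h z) \<le> ?h z" using z in_I by (intro cINF_lower[OF bdd]) auto
    ultimately show "(INF z\<in>?I. ?h z) \<le> r + \<epsilon>" by simp
  qed
  moreover have "r \<le> (INF z\<in>?I. ?h z)" using r_le by (intro cINF_greatest[OF I]) auto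
  ultimately have "g s t = ennreal (INF z\<in>?I. ?h z)" using r by simp
  also have "(INF z\<in>?I. ?h z) = (INF z\<in>?I.
       s * (\<integral>(a, b). (a 1 / z) / (1 - a 1 / z) \<partial>\<mu>) + t * (\<integral>(a, b). (b 1 * z) / (1 - b 1 * z) \<partial>\<mu>))"
    using h_eq by (intro INF_cong) auto
  finally show "g s t = ennreal
    (INF z\<in>{right_endpoint (law_a \<mu>)<..<1 / right_endpoint (law_b \<mu>)}.
       s * (\<integral>(a, b). (a 1 / z) / (1 - a 1 / z) \<partial>\<mu>) + t * (\<integral>(a, b). (b 1 * z) / (1 - b 1 * z) \<partial>\<mu>))"
    unfolding u_def v_def .
qed

end
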